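(* The following decision problem is undecidable: given a finite game graph $G=((V,E),(V_1,V_2))$ with an initial vertex $v_0\in V$, a weight function $w:E\to\mathbb{Q}^{10}$ (i.e., with ten dimensions), and a multidimensional mean-payoff condition $\varphi$ (a positive boolean formula over atoms of the form $\mathrm{LimInfAvg}_i\sim\nu_i$ with $\sim\in\{\geq,>,\leq,<\}$, $i\in\{1,\dots,10\}$, $\nu_i\in\mathbb{Q}$), decide whether player 1 has a winning strategy from $v_0$, i.e., a strategy $\tau$ such that every play from $v_0$ consistent with $\tau$ (against any player-2 strategy) satisfies $\varphi$.
   Context: A game graph $G=((V,E),(V_1,V_2))$ consists of a finite directed graph $(V,E)$ in which every vertex has at least one outgoing edge, and a partition $(V_1,V_2)$ of $V$. A play is an infinite sequence of vertices $v_0v_1v_2\dots$ with $(v_k,v_{k+1})\in E$ for all $k$; when the token is at a vertex of $V_j$, player $j$ chooses the successor. A strategy for player 1 is an arbitrary function $\tau:V^*\cdot V_1\to V$ choosing a successor of the last vertex (infinite memory allowed); player-2 strategies are defined analogously. For a finite path $\pi$, $w(\pi)$ is the sum of the weight vectors of its edges and $\mathrm{Avg}(\pi)=w(\pi)/|\pi|$, with $\mathrm{Avg}_i$ its $i$-th coordinate. For an infinite play $\pi$ with prefixes $\pi_n$ of length $n$, $\mathrm{LimInfAvg}_i(\pi)=\liminf_{n\to\infty}\mathrm{Avg}_i(\pi_n)$ and $\mathrm{LimSupAvg}_i(\pi)=\limsup_{n\to\infty}\mathrm{Avg}_i(\pi_n)$. A play satisfies the atom $\mathrm{LimInfAvg}_i\sim\nu_i$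 if $\mathrm{LimInfAvg}_i(\pi)\sim\nu_i$, and satisfaction of a positive boolean formula is defined as usual. *)

theory Defs
  imports "HOL-Analysis.Analysis" "HOL-Library.Nat_Bijection"
begin

record 'v game_graph =
  verts :: "'v set"
  edges :: "('v \<times> 'v) set"
  verts1 :: "'v set"
  verts2 :: "'v set"

definition is_game_graph :: "'v game_graph \<Rightarrow> bool" where
  "is_game_graph G \<longleftrightarrow>
     finite (verts G) \<and> edges G \<subseteq> verts G \<times> verts G \<and>
     (\<forall>v\<in>verts G. \<exists>u. (v, u) \<in> edges G) \<and>
     verts1 G \<union> verts2 G = verts G \<and> verts1 G \<inter> verts2 G = {}"

definition is_play :: "'v game_graph \<Rightarrow> 'v \<Rightarrow> (nat \<Rightarrow> 'v) \<Rightarrow> bool" where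
  "is_play G v0 \<pi> \<longleftrightarrow> \<pi> 0 = v0 \<and> (\<forall>k. (\<pi> k, \<pi> (Suc k)) \<in> edges G)"

text \<open>A strategy is applied to the whole history, whose last element is the current vertex; its
  values on lists outside \<open>V\<^sup>* \<cdot> V\<^sub>1\<close> are irrelevant.\<close>

definition is_strategy1 :: "'v game_graph \<Rightarrow> ('v list \<Rightarrow> 'v) \<Rightarrow> bool" where
  "is_strategy1 G \<tau> \<longleftrightarrow>
     (\<forall>h v. set h \<subseteq> verts G \<longrightarrow> v \<in> verts1 G \<longrightarrow> (v, \<tau> (h @ [v])) \<in> edges G)"

definition consistent1 :: "'v game_graph \<Rightarrow> ('v list \<Rightarrow> 'v) \<Rightarrow> (nat \<Rightarrow> 'v) \<Rightarrow> bool" where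
  "consistent1 G \<tau> \<pi> \<longleftrightarrow>
     (\<forall>k. \<pi> k \<in> verts1 G \<longrightarrow> \<pi> (Suc k) = \<tau> (map \<pi> [0..<Suc k]))"

definition prefix_weight ::
    "('v \<times> 'v \<Rightarrow> rat ^ 'd) \<Rightarrow> (nat \<Rightarrow> 'v) \<Rightarrow> nat \<Rightarrow> rat ^ 'd" where
  "prefix_weight w \<pi> n = (\<Sum>k<n. w (\<pi> k, \<pi> (Suc k)))"

definition prefix_avg ::
    "('v \<times> 'v \<Rightarrow> rat ^ 'd) \<Rightarrow> 'd \<Rightarrow> (nat \<Rightarrow> 'v) \<Rightarrow> nat \<Rightarrow> rat" where
  "prefix_avg w i \<pi> n = prefix_weight w \<pi> n $ i / of_nat n"

definition LimInfAvg :: "('v \<times> 'v \<Rightarrow> rat ^ 'd) \<Rightarrow> 'd \<Rightarrow> (nat \<Rightarrow> 'v) \<Rightarrow> ereal" where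
  "LimInfAvg w i \<pi> = liminf (\<lambda>n. ereal (of_rat (prefix_avg w i \<pi> n)))"

datatype cmp = GE | GT | LE | LT

fun cmp_holds :: "cmp \<Rightarrow> ereal \<Rightarrow> ereal \<Rightarrow> bool" where
  "cmp_holds GE x y \<longleftrightarrow> x \<ge> y"
| "cmp_holds GT x y \<longleftrightarrow> x > y"
| "cmp_holds LE x y \<longleftrightarrow> x \<le> y"
| "cmp_holds LT x y \<longleftrightarrow> x < y"

datatype 'd mp_cond =
    Atom 'd cmp rat
  | Conj "'d mp_cond" "'d mp_cond"
  | Disj "'d mp_cond" "'d mp_cond"

fun satisfies :: "('v \<times> 'v \<Rightarrow> rat ^ 'd) \<Rightarrow> (nat \<Rightarrow> 'v) \<Rightarrow> 'd mp_cond \<Rightarrow> bool" where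
  "satisfies w \<pi> (Atom i c \<nu>) \<longleftrightarrow> cmp_holds c (LimInfAvg w i \<pi>) (ereal (of_rat \<nu>))"
| "satisfies w \<pi> (Conj \<phi> \<psi>) \<longleftrightarrow> satisfies w \<pi> \<phi> \<and> satisfies w \<pi> \<psi>"
| "satisfies w \<pi> (Disj \<phi> \<psi>) \<longleftrightarrow> satisfies w \<pi> \<phi> \<or> satisfies w \<pi> \<psi>"

definition winning_strategy1 ::
    "'v game_graph \<Rightarrow> ('v \<times> 'v \<Rightarrow> rat ^ 'd) \<Rightarrow> 'v \<Rightarrow> 'd mp_cond \<Rightarrow> ('v list \<Rightarrow> 'v) \<Rightarrow> bool" where
  "winning_strategy1 G w v0 \<phi> \<tau> \<longleftrightarrow>
     is_strategy1 G \<tau> \<and>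
     (\<forall>\<pi>. is_play G v0 \<pi> \<longrightarrow> consistent1 G \<tau> \<pi> \<longrightarrow> satisfies w \<pi> \<phi>)"

definition player1_wins ::
    "'v game_graph \<Rightarrow> ('v \<times> 'v \<Rightarrow> rat ^ 'd) \<Rightarrow> 'v \<Rightarrow> 'd mp_cond \<Rightarrow> bool" where
  "player1_wins G w v0 \<phi> \<longleftrightarrow> (\<exists>\<tau>. winning_strategy1 G w v0 \<phi> \<tau>)"

datatype recf =
    Zero
  | Succ
  | Proj nat
  | Comp recf "recf list"
  | PrimRec recf recf
  | Mu recf

text \<open>\<open>rec_eval f xs y\<close>: the partial recursive function denoted by \<open>f\<close> is defined on the argument
  tuple \<open>xs\<close>, with value \<open>y\<close>. \<open>Zero\<close> denotes the constant zero function of every arity.\<close>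

inductive rec_eval :: "recf \<Rightarrow> nat list \<Rightarrow> nat \<Rightarrow> bool" where
  zero: "rec_eval Zero xs 0"
| succ: "rec_eval Succ [x] (Suc x)"
| proj: "i < length xs \<Longrightarrow> rec_eval (Proj i) xs (xs ! i)"
| comp: "length ys = length gs \<Longrightarrow> (\<forall>i<length gs. rec_eval (gs ! i) xs (ys ! i)) \<Longrightarrow>
    rec_eval f ys z \<Longrightarrow> rec_eval (Comp f gs) xs z"
| prim_0: "rec_eval f xs y \<Longrightarrow> rec_eval (PrimRec f g) (0 # xs) y"
| prim_Suc: "rec_eval (PrimRec f g) (n # xs) y \<Longrightarrow> rec_eval g (n # y # xs) z \<Longrightarrow>
    rec_eval (PrimRec f g) (Suc n # xs) z"
| mu: "rec_eval f (n # xs) 0 \<Longrightarrow> (\<forall>m<n. \<exists>y. rec_eval f (m # xs) (Suc y)) \<Longrightarrow>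
    rec_eval (Mu f) xs n"

inductive_cases rec_eval_ZeroE: "rec_eval Zero xs y"
inductive_cases rec_eval_SuccE: "rec_eval Succ xs y"
inductive_cases rec_eval_ProjE: "rec_eval (Proj i) xs y"
inductive_cases rec_eval_CompE: "rec_eval (Comp f gs) xs y"
inductive_cases rec_eval_PrimRec_0E: "rec_eval (PrimRec f g) (0 # xs) y"
inductive_cases rec_eval_PrimRec_SucE: "rec_eval (PrimRec f g) (Suc n # xs) y"
inductive_cases rec_eval_MuE: "rec_eval (Mu f) xs y"

lemma rec_eval_deterministic:
  assumes "rec_eval f xs y" and "rec_eval f xs z"
  shows "y = z"
  using assms
proof (induction arbitrary: z rule: rec_eval.induct)
  case (comp ys gs xs f z z')
  obtain ys' where ys': "length ys' = length gs"
      "\<forall>i<length gs. rec_eval (gs ! i) xs (ys' ! i)" "rec_eval f ys' z'"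
    using comp.prems by (rule rec_eval_CompE) blast
  have "ys = ys'"
    using comp.hyps comp.IH(1) ys' by (intro nth_equalityI) auto
  then show ?case using comp.IH(2) ys'(3) by blast
next
  case (prim_Suc f g n xs y z z')
  obtain y' where
    "rec_eval (PrimRec f g) (n # xs) y'" "rec_eval g (n # y' # xs) z'"
    using prim_Suc.prems by (rule rec_eval_PrimRec_SucE) blast
  then show ?case using prim_Suc.IH by blast
next
  case (mu f n xs n')
  have n': "rec_eval f (n' # xs) 0" "\<forall>m<n'. \<exists>y. rec_eval f (m # xs) (Suc y)"
    using mu.prems by (auto elim: rec_eval_MuE)
  have "\<not> n < n'" using n'(2) mu.IH(1) by fastforce
  moreover have "\<not> n' < n" using n'(1) mu.IH(2) by fastforce
  ultimately show ?case by simp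
qed (blast elim: rec_eval_ZeroE rec_eval_SuccE rec_eval_ProjE rec_eval_PrimRec_0E)+

text \<open>\<open>D\<close> is the set of instances and \<open>P\<close> selects the yes-instances. The algorithm must halt
  with the correct answer on all codes of instances; nothing is required on other inputs.\<close>

definition decidable_problem :: "('a \<Rightarrow> nat) \<Rightarrow> 'a set \<Rightarrow> ('a \<Rightarrow> bool) \<Rightarrow> bool" where
  "decidable_problem code D P \<longleftrightarrow>
     (\<exists>f. \<forall>x\<in>D. rec_eval f [code x] (if P x then 1 else 0))"

record mp_instance =
  vlist1 :: "nat list"
  vlist2 :: "nat list"
  arcs :: "((nat \<times> nat) \<times> (rat ^ 10)) list"
  init :: nat
  cond :: "10 mp_cond"

definition graph_of :: "mp_instance \<Rightarrow> nat game_graph" where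
  "graph_of I =
     \<lparr>verts = set (vlist1 I) \<union> set (vlist2 I), edges = set (map fst (arcs I)),
      verts1 = set (vlist1 I), verts2 = set (vlist2 I)\<rparr>"

definition weight_of :: "mp_instance \<Rightarrow> nat \<times> nat \<Rightarrow> rat ^ 10" where
  "weight_of I e = (case map_of (arcs I) e of Some x \<Rightarrow> x | None \<Rightarrow> 0)"

definition valid_instance :: "mp_instance \<Rightarrow> bool" where
  "valid_instance I \<longleftrightarrow>
     is_game_graph (graph_of I) \<and> init I \<in> verts (graph_of I) \<and> distinct (map fst (arcs I))"

definition instance_wins :: "mp_instance \<Rightarrow> bool" where
  "instance_wins I \<longleftrightarrow> player1_wins (graph_of I) (weight_of I) (init I) (cond I)"

text \<open>In the type \<open>10\<close> the numeral 10 equals 0, so that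
  the dimensions are \<open>of_nat k\<close> for \<open>k = 1, \<dots>, 10\<close>.\<close>

definition rat_code :: "rat \<Rightarrow> nat" where
  "rat_code q = (case quotient_of q of (a, b) \<Rightarrow> prod_encode (int_encode a, int_encode b))"

definition vec_code :: "rat ^ 10 \<Rightarrow> nat" where
  "vec_code x = list_encode (map (\<lambda>k. rat_code (x $ of_nat k)) [1..<11])"

definition dim_code :: "10 \<Rightarrow> nat" where
  "dim_code = inv_into {1..10} of_nat"

fun cmp_code :: "cmp \<Rightarrow> nat" where
  "cmp_code GE = 0"
| "cmp_code GT = 1"
| "cmp_code LE = 2"
| "cmp_code LT = 3"

fun cond_code :: "10 mp_cond \<Rightarrow> nat" where
  "cond_code (Atom i c \<nu>) =
     prod_encode (0, list_encode [dim_code i, cmp_code c, rat_code \<nu>])"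
| "cond_code (Conj \<phi> \<psi>) = prod_encode (1, prod_encode (cond_code \<phi>, cond_code \<psi>))"
| "cond_code (Disj \<phi> \<psi>) = prod_encode (2, prod_encode (cond_code \<phi>, cond_code \<psi>))"

fun arc_code :: "(nat \<times> nat) \<times> (rat ^ 10) \<Rightarrow> nat" where
  "arc_code ((u, v), x) = list_encode [u, v, vec_code x]"

definition instance_code :: "mp_instance \<Rightarrow> nat" where
  "instance_code I =
     list_encode
       [list_encode (vlist1 I), list_encode (vlist2 I),
        list_encode (map arc_code (arcs I)), init I, cond_code (cond I)]"

lemma bij_betw_of_nat_10: "bij_betw of_nat {1..10::nat} (UNIV :: 10 set)"
proof -
  have "inj_on (of_nat :: nat \<Rightarrow> 10) {1..10}"
  proof (rule inj_onI)
    fix x y :: nat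
    assume xy: "x \<in> {1..10}" "y \<in> {1..10}" and eq: "(of_nat x :: 10) = of_nat y"
    have "int x mod 10 = int y mod 10"
      using arg_cong[OF eq, of Rep_bit0] bit0.Rep_Abs_mod[where 'a = 5]
      by (simp add: bit0.of_nat_eq)
    moreover have "int k mod 10 = (if k = 10 then 0 else int k)" if "k \<in> {1..10}" for k :: nat
      using that by (cases "k = 10") auto
    ultimately show "x = y" using xy by (auto split: if_splits)
  qed
  moreover from this have "of_nat ` {1..10::nat} = (UNIV :: 10 set)"
    by (intro card_subset_eq) (auto simp: card_image)
  ultimately show ?thesis by (simp add: bij_betw_def)
qed

lemma rat_code_inject [simp]: "rat_code p = rat_code q \<longleftrightarrow> p = q"
  by (auto simp: rat_code_def prod_encode_eq int_encode_eq quotient_of_inject_eq[symmetric]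
      split: prod.splits)

lemma vec_code_inject [simp]: "vec_code x = vec_code y \<longleftrightarrow> x = y"
proof
  assume "vec_code x = vec_code y"
  then have *: "x $ of_nat k = y $ of_nat k" if "k \<in> {1..10}" for k :: nat
    using that by (auto simp: vec_code_def list_encode_eq)
  show "x = y"
  proof (rule vec_eq_iff[THEN iffD2, rule_format])
    fix i :: 10
    obtain k :: nat where "k \<in> {1..10}" "i = of_nat k"
      using bij_betw_of_nat_10 by (metis UNIV_I bij_betw_imp_surj_on imageE)
    with * show "x $ i = y $ i" by simp
  qed
qed simp

lemma dim_code_inject [simp]: "dim_code i = dim_code j \<longleftrightarrow> i = j"
  using bij_betw_inv_into[OF bij_betw_of_nat_10]
  unfolding dim_code_def by (auto simp: bij_betw_def inj_on_def)

lemma cmp_code_inject [simp]: "cmp_code c = cmp_code d \<longleftrightarrow> c = d"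
  by (cases c; cases d) simp_all

lemma cond_code_inject [simp]: "cond_code \<phi> = cond_code \<psi> \<longleftrightarrow> \<phi> = \<psi>"
proof (induction \<phi> arbitrary: \<psi>)
  case (Atom i c \<nu>)
  then show ?case by (cases \<psi>) (simp_all add: prod_encode_eq list_encode_eq del: list_encode.simps)
next
  case (Conj \<phi>1 \<phi>2)
  then show ?case by (cases \<psi>) (simp_all add: prod_encode_eq)
next
  case (Disj \<phi>1 \<phi>2)
  then show ?case by (cases \<psi>) (simp_all add: prod_encode_eq)
qed

lemma arc_code_inject [simp]: "arc_code a = arc_code b \<longleftrightarrow> a = b"
  by (cases a rule: arc_code.cases; cases b rule: arc_code.cases)
    (simp add: list_encode_eq del: list_encode.simps)

lemma inj_instance_code: "inj instance_code"
proof (rule injI)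
  fix I J :: mp_instance
  assume "instance_code I = instance_code J"
  then show "I = J"
    by (cases I; cases J)
      (auto simp: instance_code_def list_encode_eq inj_map_eq_map inj_def
        simp del: list_encode.simps)
qed

end

theory Submission
  imports Defs "HOL-Computational_Algebra.Primes"
begin

text \<open>
  Every partial recursive function is simulated by a two-counter machine, and a two-counter machine
  started with \<open>x\<close> is turned into a game in which \<open>x\<close> occurs only as a weight. A decision procedure
  for the games would thus decide halting of such machines on the codes of their own games.

  The game repeats rounds. Player 2 picks a scale \<open>K\<close> by looping at \<open>Scale\<close>; then player 1 simulates
  the machine, a counter value \<open>c\<close> being the weight \<open>c K\<close> in a dimension \<open>Pos\<close>. The value \<open>K\<close> itself
  sits in one of two further counters (\<open>Unit\<close>), and an instruction moves it from one to the other
  while changing the affected counter by the same amount. A counter never becomes negative because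
  \<open>LimInfAvg (Pos i) \<ge> 0\<close> is required. When player 1 claims that counter \<open>i\<close> is empty, player 2 may
  blame him: \<open>Neg i\<close> (about \<open>K\<close> plus the counter) and \<open>Slack\<close> (about \<open>K\<close>) are decreased together.
  Player 1 wins if some \<open>Neg i\<close> has a negative limit inferior, and otherwise he must keep \<open>Slack\<close>
  nonnegative, so a blame hurts player 1 iff the counter is really positive.
  Finally \<open>Gain\<close>, which grows only in proportion to \<open>K\<close>, must have a positive limit inferior, so that the
  length of the simulations has to stay bounded relative to \<open>K\<close>.

  If the machine halts, player 1 simulates its halting run exactly. If not, player 2 chooses \<open>K\<close> so
  large that the past is negligible and tolerates deviations that shrink geometrically with the
  number of simulated steps; then every round either contains a deviation that is a fixed fraction
  of the elapsed time or is long compared to \<open>K\<close>.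
\<close>

section \<open>The game of a two-counter machine\<close>

text \<open>An exact simulation cannot be enforced: earlier rounds leave residues in every
  dimension, and a limit average ignores deviations that are small compared with the elapsed time. A
  constant relative tolerance fails as well, because errors add up over the steps of a round and the
  counters drift. With a tolerance halved at each counting step the errors sum to less than a
  quarter of the unit, so that rounding recovers the true configuration. The price is that late
  deviations may be tiny. It is affordable because a gain rate \<delta> > 0 eventually leaves room
  for at most 8 / \<delta> counting steps in a round, so that a single positive tolerance serves for
  all late rounds. The self-reference comes from the input \<open>x\<close>. The vertices of the
  game and all weights except those on the loop at \<open>Scale\<close> do not depend on
  \<open>x\<close>; their codes are packed into \<open>x\<close> as exponents of primes, and the
  machine rebuilds the code of its own game from its input.\<close>

datatype 'r op = Inc 'r | Dec 'r | Tst 'r | Nop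

fun op_step :: "'r op \<Rightarrow> ('r \<Rightarrow> nat) \<Rightarrow> ('r \<Rightarrow> nat) \<Rightarrow> bool" where
  "op_step (Inc r) c c' \<longleftrightarrow> c' = c(r := Suc (c r))"
| "op_step (Dec r) c c' \<longleftrightarrow> c r > 0 \<and> c' = c(r := c r - 1)"
| "op_step (Tst r) c c' \<longleftrightarrow> c r = 0 \<and> c' = c"
| "op_step Nop c c' \<longleftrightarrow> c' = c"

type_synonym 'q trans = "'q \<times> bool op \<times> 'q"

inductive reaches :: "'q trans set \<Rightarrow> 'q \<Rightarrow> (bool \<Rightarrow> nat) \<Rightarrow> 'q \<Rightarrow> (bool \<Rightarrow> nat) \<Rightarrow> bool" for T where
  refl: "reaches T q c q c"
| step: "(q, o1, q') \<in> T \<Longrightarrow> op_step o1 c c' \<Longrightarrow> reaches T q' c' q'' c'' \<Longrightarrow> reaches T q c q'' c''"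

lemma reaches_trans:
  "reaches T q c q' c' \<Longrightarrow> reaches T q' c' q'' c'' \<Longrightarrow> reaches T q c q'' c''"
  by (induction rule: reaches.induct) (auto intro: reaches.step)

definition start_counters :: "nat \<Rightarrow> bool \<Rightarrow> nat" where
  "start_counters x i = (if i then 0 else x)"

text \<open>Acceptance is existential: machines may be nondeterministic, since in the game it is
  player 1 who picks the transitions and can follow an accepting run.\<close>

definition accepts :: "'q trans set \<Rightarrow> 'q \<Rightarrow> 'q \<Rightarrow> nat \<Rightarrow> bool" where
  "accepts T q0 qf x \<longleftrightarrow> (\<exists>c. reaches T q0 (start_counters x) qf c)"

datatype cnt = Cnt bool | Unit bool
datatype dim = Pos cnt | Neg cnt | Slack | Gain

text \<open>The flag \<open>b\<close> names the unit counter that currently holds \<open>K\<close>.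
  One passage through \<open>Loop\<close> and \<open>Check\<close> moves weight 1. At
  \<open>Check\<close> player 2 can react to a negative counter, at \<open>Claim\<close> to a false
  claim of emptiness.\<close>

datatype 'q vertex =
    Reset
  | Scale
  | Blame cnt
  | State 'q bool
  | Loop "'q trans" bool
  | Check "'q trans" bool
  | Claim "'q trans" bool

fun effect :: "bool op \<Rightarrow> bool \<Rightarrow> cnt \<Rightarrow> int" where
  "effect (Inc i) b j =
     (if j = Cnt i then 1 else if j = Unit b then - 1 else if j = Unit (\<not> b) then 1 else 0)"
| "effect (Dec i) b j =
     (if j = Cnt i then - 1 else if j = Unit b then - 1 else if j = Unit (\<not> b) then 1 else 0)"
| "effect (Tst i) b j = 0"
| "effect Nop b j = 0"

text \<open>An \<open>Inc\<close> or \<open>Dec\<close> ends with the claim that the old unit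
  counter has been emptied, which is what forces about \<open>K\<close> traversals. For
  \<open>Nop\<close> the counter named is the one that should be empty already, so a truthful player
  1 has nothing to fear from a blame there.\<close>

fun claimed :: "bool op \<Rightarrow> bool \<Rightarrow> cnt" where
  "claimed (Inc i) b = Unit b"
| "claimed (Dec i) b = Unit b"
| "claimed (Tst i) b = Cnt i"
| "claimed Nop b = Unit (\<not> b)"

fun flip :: "bool op \<Rightarrow> bool \<Rightarrow> bool" where
  "flip (Inc i) b = (\<not> b)"
| "flip (Dec i) b = (\<not> b)"
| "flip (Tst i) b = b"
| "flip Nop b = b"

fun unit_vec :: "nat \<Rightarrow> cnt \<Rightarrow> int" where
  "unit_vec x (Cnt i) = (if i then 0 else int x)"
| "unit_vec x (Unit b) = (if b then 0 else 1)"

fun scale_vec :: "nat \<Rightarrow> dim \<Rightarrow> int" where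
  "scale_vec x (Pos i) = unit_vec x i"
| "scale_vec x (Neg i) = unit_vec x i + 1"
| "scale_vec x Slack = 1"
| "scale_vec x Gain = 1"

text \<open>The gain on entering \<open>Scale\<close> keeps player 2 from starving player 1 with
  rounds in which \<open>K\<close> is 0. The gain on the loop at \<open>Blame\<close> pays for the
  time of the blame and for the later visits to the loop at \<open>Reset\<close> that restore
  \<open>Slack\<close>; the loop at \<open>Reset\<close> itself earns nothing, so player 1 cannot
  wait for free.\<close>

definition wt :: "nat \<Rightarrow> 'q vertex \<times> 'q vertex \<Rightarrow> dim \<Rightarrow> int" where
  "wt x e d =
     (case fst e of
        Reset \<Rightarrow> if snd e = Reset then (if d = Slack then 1 else 0) else (if d = Gain then 1 else 0)
      | Scale \<Rightarrow> if snd e = Scale then scale_vec x d else 0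
      | Blame i \<Rightarrow>
          if snd e = Reset then 0
          else (case d of Neg k \<Rightarrow> if k = i then - 1 else 0 | Pos k \<Rightarrow> 0 | Slack \<Rightarrow> - 1 | Gain \<Rightarrow> 1)
      | Loop t b \<Rightarrow>
          if snd e = Check t b
          then (case d of Pos k \<Rightarrow> effect (fst (snd t)) b k | Neg k \<Rightarrow> effect (fst (snd t)) b k | _ \<Rightarrow> 0)
          else 0
      | _ \<Rightarrow> 0)"

lemma wt_simps [simp]:
  "wt x (Reset, Reset) d = (if d = Slack then 1 else 0)"
  "wt x (Reset, Scale) d = (if d = Gain then 1 else 0)"
  "wt x (Scale, Scale) d = scale_vec x d"
  "wt x (Scale, State q b) d = 0"
  "wt x (Blame i, Reset) d = 0"
  "wt x (Blame i, Blame i) d =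
     (case d of Neg k \<Rightarrow> if k = i then - 1 else 0 | Pos k \<Rightarrow> 0 | Slack \<Rightarrow> - 1 | Gain \<Rightarrow> 1)"
  "wt x (State q b, v) d = 0"
  "wt x (Loop t b, Claim t' b') d = 0"
  "wt x (Loop t b, Check t b) d =
     (case d of Pos k \<Rightarrow> effect (fst (snd t)) b k | Neg k \<Rightarrow> effect (fst (snd t)) b k | _ \<Rightarrow> 0)"
  "wt x (Check t b, v) d = 0"
  "wt x (Claim t b, v) d = 0"
  by (simp_all add: wt_def)

definition states :: "'q trans set \<Rightarrow> 'q \<Rightarrow> 'q \<Rightarrow> 'q set" where
  "states T q0 qf = {q0, qf} \<union> fst ` T \<union> (snd \<circ> snd) ` T"

text \<open>The weightless loop at \<open>State\<close> provides a successor where the machine is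
  stuck. Staying there forever sends all averages to 0, which loses because \<open>Gain\<close> must
  be positive or some \<open>Neg i\<close> negative.\<close>

inductive edge :: "'q trans set \<Rightarrow> 'q \<Rightarrow> 'q \<Rightarrow> 'q vertex \<Rightarrow> 'q vertex \<Rightarrow> bool" for T q0 qf where
  Reset_Reset: "edge T q0 qf Reset Reset"
| Reset_Scale: "edge T q0 qf Reset Scale"
| Scale_Scale: "edge T q0 qf Scale Scale"
| Scale_State: "edge T q0 qf Scale (State q0 False)"
| Blame_Blame: "edge T q0 qf (Blame i) (Blame i)"
| Blame_Reset: "edge T q0 qf (Blame i) Reset"
| State_State: "q \<in> states T q0 qf \<Longrightarrow> edge T q0 qf (State q b) (State q b)"
| State_Reset: "edge T q0 qf (State qf b) Reset"
| State_Loop: "(q, o1, q') \<in> T \<Longrightarrow> edge T q0 qf (State q b) (Loop (q, o1, q') b)"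
| Loop_Check: "e \<in> T \<Longrightarrow> edge T q0 qf (Loop e b) (Check e b)"
| Loop_Claim: "e \<in> T \<Longrightarrow> edge T q0 qf (Loop e b) (Claim e b)"
| Check_Loop: "e \<in> T \<Longrightarrow> edge T q0 qf (Check e b) (Loop e b)"
| Check_Reset: "e \<in> T \<Longrightarrow> edge T q0 qf (Check e b) Reset"
| Claim_State: "(q, o1, q') \<in> T \<Longrightarrow> edge T q0 qf (Claim (q, o1, q') b) (State q' (flip o1 b))"
| Claim_Blame: "(q, o1, q') \<in> T \<Longrightarrow> edge T q0 qf (Claim (q, o1, q') b) (Blame (claimed o1 b))"

definition vertices1 :: "'q trans set \<Rightarrow> 'q \<Rightarrow> 'q \<Rightarrow> 'q vertex set" where
  "vertices1 T q0 qf =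
     {Reset} \<union> case_prod State ` (states T q0 qf \<times> UNIV) \<union> case_prod Loop ` (T \<times> UNIV)"

definition vertices2 :: "'q trans set \<Rightarrow> 'q vertex set" where
  "vertices2 T =
     {Scale} \<union> range Blame \<union> case_prod Check ` (T \<times> UNIV) \<union> case_prod Claim ` (T \<times> UNIV)"

definition machine_game :: "'q trans set \<Rightarrow> 'q \<Rightarrow> 'q \<Rightarrow> 'q vertex game_graph" where
  "machine_game T q0 qf =
     \<lparr>verts = vertices1 T q0 qf \<union> vertices2 T, edges = {(u, v). edge T q0 qf u v},
      verts1 = vertices1 T q0 qf, verts2 = vertices2 T\<rparr>"

lemma UNIV_cnt: "(UNIV :: cnt set) = {Cnt False, Cnt True, Unit False, Unit True}"
proof (rule UNIV_eq_I)
  fix i show "i \<in> {Cnt False, Cnt True, Unit False, Unit True}"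
    by (cases i) auto
qed

lemma finite_cnt [simp]: "finite (A :: cnt set)"
  by (rule finite_subset[OF subset_UNIV]) (simp add: UNIV_cnt)

lemma UNIV_dim: "(UNIV :: dim set) = range Pos \<union> range Neg \<union> {Slack, Gain}"
proof (rule UNIV_eq_I)
  fix d show "d \<in> range Pos \<union> range Neg \<union> {Slack, Gain}"
    by (cases d) auto
qed

lemma card_dim: "card (UNIV :: dim set) = 10"
  unfolding UNIV_dim UNIV_cnt by (simp add: card_insert_if)

lemma finite_edges:
  assumes "finite T" shows "finite {(u, v). edge T q0 qf u v}"
proof (rule finite_subset)
  show "{(u, v). edge T q0 qf u v} \<subseteq> (vertices1 T q0 qf \<union> vertices2 T) \<times> (vertices1 T q0 qf \<union> vertices2 T)"
    by (force elim!: edge.cases simp: vertices1_def vertices2_def states_def image_iff)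
  show "finite ((vertices1 T q0 qf \<union> vertices2 T) \<times> (vertices1 T q0 qf \<union> vertices2 T))"
    using assms by (auto simp: vertices1_def vertices2_def states_def)
qed

lemma is_game_graph_machine_game:
  assumes "finite T" shows "is_game_graph (machine_game T q0 qf)"
proof -
  have "\<exists>u. edge T q0 qf v u" if "v \<in> vertices1 T q0 qf \<union> vertices2 T" for v
    using that
    by (auto simp: vertices1_def vertices2_def intro: edge.intros)
  moreover have "{(u, v). edge T q0 qf u v} \<subseteq> (vertices1 T q0 qf \<union> vertices2 T) \<times> (vertices1 T q0 qf \<union> vertices2 T)"
    by (force elim!: edge.cases simp: vertices1_def vertices2_def states_def image_iff)
  moreover have "finite (vertices1 T q0 qf \<union> vertices2 T)"
    using assms by (auto simp: vertices1_def vertices2_def states_def)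
  ultimately show ?thesis
    by (auto simp: is_game_graph_def machine_game_def vertices1_def vertices2_def)
qed

section \<open>The ten weight dimensions and the winning condition\<close>

definition dim_bij :: "dim \<Rightarrow> 10" where
  "dim_bij = (SOME f. bij f)"

lemma bij_dim_bij: "bij dim_bij"
proof -
  have "\<exists>f :: dim \<Rightarrow> 10. bij f"
    using card_dim by (intro finite_same_card_bij) (auto intro: card_ge_0_finite)
  then show ?thesis unfolding dim_bij_def by (rule someI_ex)
qed

definition wvec :: "nat \<Rightarrow> 'q vertex \<times> 'q vertex \<Rightarrow> rat ^ 10" where
  "wvec x e = (\<chi> j. of_int (wt x e (inv dim_bij j)))"

definition total :: "nat \<Rightarrow> (nat \<Rightarrow> 'q vertex) \<Rightarrow> dim \<Rightarrow> nat \<Rightarrow> int" where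
  "total x \<pi> d n = (\<Sum>k<n. wt x (\<pi> k, \<pi> (Suc k)) d)"

lemma total_0 [simp]: "total x \<pi> d 0 = 0"
  and total_Suc: "total x \<pi> d (Suc n) = total x \<pi> d n + wt x (\<pi> n, \<pi> (Suc n)) d"
  by (simp_all add: total_def)

definition mean :: "nat \<Rightarrow> (nat \<Rightarrow> 'q vertex) \<Rightarrow> dim \<Rightarrow> ereal" where
  "mean x \<pi> d = liminf (\<lambda>n. ereal (total x \<pi> d n / n))"

lemma LimInfAvg_wvec:
  "LimInfAvg (wvec x) (dim_bij d) \<pi> = mean x \<pi> d"
proof -
  have "prefix_weight (wvec x) \<pi> n $ dim_bij d = of_int (total x \<pi> d n)" for n
    unfolding prefix_weight_def wvec_def total_def sum_component vec_lambda_beta of_int_sum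
      inv_f_f[OF bij_is_inj[OF bij_dim_bij]] ..
  then show ?thesis
    by (simp add: LimInfAvg_def prefix_avg_def of_rat_divide mean_def)
qed

definition atom :: "dim \<Rightarrow> cmp \<Rightarrow> 10 mp_cond" where
  "atom d c = Atom (dim_bij d) c 0"

definition game_cond :: "10 mp_cond" where
  "game_cond =
     Disj (Conj (Conj (Conj (atom (Pos (Cnt False)) GE) (atom (Pos (Cnt True)) GE))
                      (Conj (atom (Pos (Unit False)) GE) (atom (Pos (Unit True)) GE)))
                (Conj (atom Slack GE) (atom Gain GT)))
          (Disj (Disj (atom (Neg (Cnt False)) LT) (atom (Neg (Cnt True)) LT))
                (Disj (atom (Neg (Unit False)) LT) (atom (Neg (Unit True)) LT)))"

lemma all_cnt: "(\<forall>i. P i) \<longleftrightarrow> P (Cnt False) \<and> P (Cnt True) \<and> P (Unit False) \<and> P (Unit True)"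
  using UNIV_cnt by (metis UNIV_I empty_iff insert_iff)

lemma ex_cnt: "(\<exists>i. P i) \<longleftrightarrow> P (Cnt False) \<or> P (Cnt True) \<or> P (Unit False) \<or> P (Unit True)"
  using all_cnt[of "\<lambda>i. \<not> P i"] by blast

lemma satisfies_game_cond:
  "satisfies (wvec x) \<pi> game_cond \<longleftrightarrow>
     ((\<forall>i. mean x \<pi> (Pos i) \<ge> 0) \<and> mean x \<pi> Slack \<ge> 0 \<and> mean x \<pi> Gain > 0)
     \<or> (\<exists>i. mean x \<pi> (Neg i) < 0)"
proof -
  have "satisfies (wvec x) \<pi> (atom d c) \<longleftrightarrow> cmp_holds c (mean x \<pi> d) 0" for d c
    by (simp add: atom_def LimInfAvg_wvec flip: zero_ereal_def)
  then show ?thesis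
    unfolding all_cnt ex_cnt game_cond_def by (simp only: satisfies.simps cmp_holds.simps conj_assoc disj_assoc)
qed

lemma mean_ge_zero_I:
  assumes "\<And>\<epsilon> :: real. \<epsilon> > 0 \<Longrightarrow> eventually (\<lambda>n. real_of_int (total x \<pi> d n) \<ge> - \<epsilon> * n) sequentially"
  shows "mean x \<pi> d \<ge> 0"
proof -
  have "ereal (- \<epsilon>) \<le> mean x \<pi> d" if "\<epsilon> > 0" for \<epsilon> :: real
    unfolding mean_def
  proof (rule Liminf_bounded)
    show "eventually (\<lambda>n. ereal (- \<epsilon>) \<le> ereal (total x \<pi> d n / n)) sequentially"
      using assms[OF that] eventually_gt_at_top[of 0]
      by eventually_elim (simp add: field_simps)
  qed
  then have "ereal 0 \<le> mean x \<pi> d + ereal \<epsilon>" if "\<epsilon> > 0" for \<epsilon> :: real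
    using that by (cases "mean x \<pi> d") force+
  then show ?thesis by (metis ereal_le_epsilon2 zero_ereal_def)
qed

lemma mean_nonneg_I: "(\<And>n. total x \<pi> d n \<ge> 0) \<Longrightarrow> mean x \<pi> d \<ge> 0"
  unfolding mean_def by (rule Liminf_bounded) simp

lemma mean_ge_zero_D:
  fixes \<epsilon> :: real
  assumes "mean x \<pi> d \<ge> 0" "\<epsilon> > 0"
  shows "eventually (\<lambda>n. real_of_int (total x \<pi> d n) \<ge> - \<epsilon> * n) sequentially"
proof -
  have "ereal (- \<epsilon>) < liminf (\<lambda>n. ereal (total x \<pi> d n / n))"
    using assms unfolding mean_def
    by (cases "mean x \<pi> d") (auto simp: mean_def)
  from less_LiminfD[OF this] show ?thesis
    using eventually_gt_at_top[of 0] by eventually_elim (simp add: field_simps)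
qed

lemma mean_pos_I:
  fixes \<delta> :: real
  assumes "\<delta> > 0" "\<And>n. real_of_int (total x \<pi> d n) \<ge> \<delta> * n"
  shows "mean x \<pi> d > 0"
proof -
  have "ereal \<delta> \<le> mean x \<pi> d"
    unfolding mean_def
  proof (rule Liminf_bounded)
    show "eventually (\<lambda>n. ereal \<delta> \<le> ereal (total x \<pi> d n / n)) sequentially"
      using eventually_gt_at_top[of 0]
      by eventually_elim (use assms(2) in \<open>simp add: field_simps\<close>)
  qed
  then show ?thesis using assms(1) by (metis ereal_less(2) less_le_trans)
qed

lemma mean_pos_D:
  assumes "mean x \<pi> d > 0"
  obtains \<delta> :: real where "\<delta> > 0" "eventually (\<lambda>n. real_of_int (total x \<pi> d n) \<ge> \<delta> * n) sequentially"
proof -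
  obtain \<delta> where \<delta>: "0 < ereal \<delta>" "ereal \<delta> < mean x \<pi> d"
    using ereal_dense2[of 0 "mean x \<pi> d"] assms by auto
  have "eventually (\<lambda>n. real_of_int (total x \<pi> d n) \<ge> \<delta> * n) sequentially"
    using less_LiminfD[OF \<delta>(2)[unfolded mean_def]] eventually_gt_at_top[of 0]
    by eventually_elim (simp add: field_simps)
  with \<delta>(1) that show ?thesis by simp
qed

lemma edges_machine_game [simp]: "(u, v) \<in> edges (machine_game T q0 qf) \<longleftrightarrow> edge T q0 qf u v"
  and verts1_machine_game [simp]: "verts1 (machine_game T q0 qf) = vertices1 T q0 qf"
  and verts2_machine_game [simp]: "verts2 (machine_game T q0 qf) = vertices2 T"
  by (simp_all add: machine_game_def)

section \<open>Player 2 defeats every strategy if the machine does not halt\<close>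

text \<open>Once \<tau> is fixed, a rule with memory for player 2 determines the whole play. The
  recursion \<open>X\<close> carries the history, which \<tau> reads, together with the memory
  state, which \<open>act\<close> reads.\<close>

lemma memory_play:
  assumes G: "is_game_graph G" and \<tau>: "is_strategy1 G \<tau>" and v0: "v0 \<in> verts G"
    and act: "\<And>m v. v \<in> verts2 G \<Longrightarrow> (v, act m v) \<in> edges G"
  obtains \<pi> M where "is_play G v0 \<pi>" "consistent1 G \<tau> \<pi>" "M 0 = m0"
    "\<And>n. M (Suc n) = upd (M n) (\<pi> n) (\<pi> (Suc n))"
    "\<And>n. \<pi> n \<in> verts2 G \<Longrightarrow> \<pi> (Suc n) = act (M n) (\<pi> n)"
proof -
  define nxt where "nxt h m = (if last h \<in> verts1 G then \<tau> h else act m (last h))" for h m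
  define X where "X = rec_nat ([v0], m0)
    (\<lambda>_ (h, m). (h @ [nxt h m], upd m (last h) (nxt h m)))"
  define \<pi> where "\<pi> n = last (fst (X n))" for n
  define M where "M n = snd (X n)" for n
  have X0: "X 0 = ([v0], m0)"
    and XS: "X (Suc n) = (fst (X n) @ [nxt (fst (X n)) (M n)], upd (M n) (\<pi> n) (nxt (fst (X n)) (M n)))" for n
    by (simp_all add: X_def \<pi>_def M_def split: prod.split)
  have next_eq: "\<pi> (Suc n) = nxt (fst (X n)) (M n)" for n
    by (simp add: \<pi>_def XS)
  have hist: "fst (X n) = map \<pi> [0..<Suc n]" for n
    by (induction n) (simp_all add: X0 XS next_eq, simp add: \<pi>_def X0)
  have verts: "verts G = verts1 G \<union> verts2 G" "verts1 G \<inter> verts2 G = {}" "edges G \<subseteq> verts G \<times> verts G"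
    using G by (auto simp: is_game_graph_def)
  have nxt: "\<pi> (Suc n) = (if \<pi> n \<in> verts1 G then \<tau> (map \<pi> [0..<Suc n]) else act (M n) (\<pi> n))" for n
    unfolding next_eq nxt_def hist by simp
  have "set (map \<pi> [0..<Suc n]) \<subseteq> verts G \<and> (\<pi> n, \<pi> (Suc n)) \<in> edges G" for n
  proof (induction n)
    case 0
    have "\<pi> 0 = v0" by (simp add: \<pi>_def X0)
    then show ?case
      using v0 verts act[of "\<pi> 0" "M 0"] \<tau>[unfolded is_strategy1_def, rule_format, of "[]" "\<pi> 0"]
      by (auto simp: nxt)
  next
    case (Suc n)
    have in_verts: "\<pi> (Suc n) \<in> verts G" and sub: "set (map \<pi> [0..<Suc n]) \<subseteq> verts G"
      using Suc verts by auto
    have "(\<pi> (Suc n), \<pi> (Suc (Suc n))) \<in> edges G"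
    proof (cases "\<pi> (Suc n) \<in> verts1 G")
      case True
      then show ?thesis
        using \<tau>[unfolded is_strategy1_def, rule_format, OF sub True] by (simp add: nxt[of "Suc n"])
    next
      case False
      then show ?thesis using act in_verts verts by (simp add: nxt[of "Suc n"])
    qed
    with in_verts sub show ?case by simp
  qed
  then have "is_play G v0 \<pi>" by (simp add: is_play_def \<pi>_def X0)
  moreover have "consistent1 G \<tau> \<pi>" by (simp add: consistent1_def nxt)
  moreover have "M 0 = m0" by (simp add: M_def X0)
  moreover have "M (Suc n) = upd (M n) (\<pi> n) (\<pi> (Suc n))" for n
    unfolding next_eq by (simp add: M_def XS)
  moreover have "\<pi> (Suc n) = act (M n) (\<pi> n)" if "\<pi> n \<in> verts2 G" for n
    using that verts by (auto simp: nxt)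
  ultimately show ?thesis by (rule that)
qed

section \<open>The referee: player 2's strategy against a machine that does not halt\<close>

datatype referee = Referee (clock: nat) (tally: "dim \<Rightarrow> int") (base: nat) (steps: nat)

text \<open>Here \<open>b\<close> is both the time at which scaling starts and the cap on the
  counting steps of the round. The power of two offsets the finest tolerance that can occur:
  \<open>tol b * target x b\<close> is 16 times \<open>slop x b\<close>, so even the smallest
  deviation acted upon stands out from the residue of the past.\<close>

definition target :: "nat \<Rightarrow> nat \<Rightarrow> nat" where
  "target x b = 4096 * (x + 2)\<^sup>2 * b * 2 ^ b"

text \<open>No weight exceeds \<open>x + 2\<close> in absolute value, so at time \<open>b\<close>
  the past contributes at most \<open>(x + 2) * b\<close> to any dimension. The remaining factor
  \<open>4 * (x + 2)\<close> covers combinations of such errors, including \<open>x\<close> times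
  the error of the unit.\<close>

definition slop :: "nat \<Rightarrow> nat \<Rightarrow> nat" where
  "slop x b = 4 * (x + 2)\<^sup>2 * b"

definition tol :: "nat \<Rightarrow> real" where
  "tol s = 1 / (64 * 2 ^ s)"

text \<open>Instructions only move weight between the two unit counters, so this sum is constant
  from the end of scaling to the end of the round, however player 1 divides it. It contains the
  residue of earlier rounds and serves as the actual unit of measurement in place of
  \<open>K\<close>.\<close>

definition unit_of :: "referee \<Rightarrow> real" where
  "unit_of m = tally m (Pos (Unit False)) + tally m (Pos (Unit True))"

text \<open>\<open>base\<close> is the time at which the current scaling starts.
  \<open>steps\<close> counts only the accepted claims of \<open>Inc\<close> and \<open>Dec\<close>,
  recognised by the change of the flag: these are the steps that take time proportional to the unit
  and introduce new errors.\<close>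

definition referee_upd :: "nat \<Rightarrow> referee \<Rightarrow> 'q vertex \<Rightarrow> 'q vertex \<Rightarrow> referee" where
  "referee_upd x m u v = Referee (Suc (clock m)) (\<lambda>d. tally m d + wt x (u, v) d)
     (if u = Reset \<and> v = Scale then Suc (clock m) else base m)
     (case u of
        Scale \<Rightarrow> 0
      | Claim t b \<Rightarrow> if v = State (snd (snd t)) (\<not> b) then Suc (steps m) else steps m
      | _ \<Rightarrow> steps m)"

text \<open>After \<open>base m\<close> counting steps the round is abandoned, being long compared
  with the unit: every such step takes at least half a unit of time. A blame stops once
  \<open>Slack\<close> is down to minus a quarter of the tolerated deviation; \<open>Neg i\<close>
  exceeds \<open>Slack\<close> by nearly a full tolerated deviation and is then still
  nonnegative.\<close>

definition referee_act :: "'q \<Rightarrow> nat \<Rightarrow> referee \<Rightarrow> 'q vertex \<Rightarrow> 'q vertex" where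
  "referee_act q0 x m v = (case v of
       Scale \<Rightarrow> if clock m < base m + target x (base m) then Scale else State q0 False
     | Check t b \<Rightarrow>
         if steps m \<ge> base m \<or> (\<exists>i. tally m (Pos i) < - tol (steps m) * unit_of m) then Reset else Loop t b
     | Claim t b \<Rightarrow>
         if steps m \<ge> base m \<or> tally m (Pos (claimed (fst (snd t)) b)) > tol (steps m) * unit_of m
         then Blame (claimed (fst (snd t)) b) else State (snd (snd t)) (flip (fst (snd t)) b)
     | Blame i \<Rightarrow>
         if steps m < base m \<and> tally m Slack > - tol (steps m) * unit_of m / 4 then Blame i else Reset
     | _ \<Rightarrow> Reset)"

lemma referee_act_edge:
  "v \<in> vertices2 T \<Longrightarrow> edge T q0 qf v (referee_act q0 x m v)"
  by (auto simp: vertices2_def referee_act_def intro: edge.intros)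

lemma abs_wt_le: "\<bar>wt x e d\<bar> \<le> x + 2"
proof -
  have "\<bar>effect o1 b k\<bar> \<le> x + 2" for o1 b k by (cases o1) auto
  moreover have "\<bar>scale_vec x d\<bar> \<le> x + 2" for d
  proof (cases d)
    case (Pos k) then show ?thesis by (cases k) auto
  next
    case (Neg k) then show ?thesis by (cases k) auto
  qed auto
  ultimately show ?thesis by (auto simp: wt_def split: vertex.split dim.split)
qed

definition exact :: "nat \<Rightarrow> referee \<Rightarrow> bool" where
  "exact x m \<longleftrightarrow>
     base m \<ge> 1 \<and> steps m \<le> base m \<and> steps m * unit_of m \<le> 2 * clock m \<and>
     \<bar>unit_of m - target x (base m)\<bar> \<le> slop x (base m)"

text \<open>The simulation leaves these quantities alone, because \<open>Loop\<close> changes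
  \<open>Pos\<close> and \<open>Neg\<close> by the same amount and touches neither
  \<open>Slack\<close> nor \<open>Gain\<close>. Hence \<open>Neg i\<close> minus
  \<open>Slack\<close> reproduces counter \<open>i\<close> up to twice \<open>slop\<close>, whatever
  player 1 does.\<close>

definition balanced :: "nat \<Rightarrow> referee \<Rightarrow> bool" where
  "balanced x m \<longleftrightarrow>
     (\<forall>i. \<bar>tally m (Neg i) - tally m (Pos i) - target x (base m)\<bar> \<le> int (slop x (base m))) \<and>
     \<bar>tally m Slack - target x (base m)\<bar> \<le> int (slop x (base m)) \<and>
     tally m Gain \<le> int (target x (base m) + slop x (base m))"

text \<open>\<open>k\<close> counts the traversals of the current loop, \<open>e\<close> is the effect of one traversal.\<close>
definition tracks :: "referee \<Rightarrow> (bool \<Rightarrow> nat) \<Rightarrow> bool \<Rightarrow> (cnt \<Rightarrow> int) \<Rightarrow> nat \<Rightarrow> bool" where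
  "tracks m c b e k \<longleftrightarrow>
     (\<forall>i. \<bar>tally m (Pos (Cnt i)) - real k * e (Cnt i) - c i * unit_of m\<bar> \<le> (1 / 4 - 6 * tol (steps m)) * unit_of m) \<and>
     \<bar>tally m (Pos (Unit (\<not> b))) - real k * e (Unit (\<not> b))\<bar> \<le> 2 * tol (steps m) * unit_of m \<and>
     steps m * unit_of m + 2 * k \<le> 2 * clock m"

text \<open>The witness \<open>c\<close> is a genuine configuration of the machine, shadowed by the
  weights. The sharp lower bound on the counters is the one enforced at \<open>Check\<close>, hence
  the guard \<open>k > 0\<close>: before the first traversal only the quarter unit from
  \<open>tracks\<close> is available. At \<open>Check\<close> itself the bound is
  \<open>- unit_of m / 2\<close>, as player 1 has just moved and player 2 has not yet
  reacted.\<close>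

definition referee_inv :: "'q trans set \<Rightarrow> 'q \<Rightarrow> nat \<Rightarrow> 'q vertex \<Rightarrow> referee \<Rightarrow> bool" where
  "referee_inv T q0 x v m \<longleftrightarrow> (case v of
       Reset \<Rightarrow> True
     | Scale \<Rightarrow> base m \<ge> 1 \<and> base m \<le> clock m \<and> clock m \<le> base m + target x (base m) \<and>
         (\<forall>d. \<bar>tally m d - scale_vec x d * (int (clock m) - int (base m))\<bar> \<le> int ((x + 2) * base m))
     | State q b \<Rightarrow> exact x m \<and> balanced x m \<and>
         (\<exists>c. reaches T q0 (start_counters x) q c \<and> tracks m c b (\<lambda>_. 0) 0)
     | Loop t b \<Rightarrow> exact x m \<and> balanced x m \<and>
         (\<exists>c k. reaches T q0 (start_counters x) (fst t) c \<and> tracks m c b (effect (fst (snd t)) b) k \<and>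
            (k > 0 \<longrightarrow> (\<forall>i. tally m (Pos i) \<ge> - tol (steps m) * unit_of m)))
     | Check t b \<Rightarrow> exact x m \<and> balanced x m \<and>
         (\<forall>i. tally m (Pos i) \<ge> - unit_of m / 2) \<and>
         (\<exists>c k. reaches T q0 (start_counters x) (fst t) c \<and> tracks m c b (effect (fst (snd t)) b) k)
     | Claim t b \<Rightarrow> exact x m \<and> balanced x m \<and>
         (\<exists>c k. reaches T q0 (start_counters x) (fst t) c \<and> tracks m c b (effect (fst (snd t)) b) k \<and>
            (k > 0 \<longrightarrow> (\<forall>i. tally m (Pos i) \<ge> - tol (steps m) * unit_of m)))
     | Blame i \<Rightarrow> exact x m \<and>
         (if steps m < base m
          then tally m (Pos i) > tol (steps m) * unit_of m \<and>
            tally m (Neg i) - tally m Slack \<ge> tally m (Pos i) - 2 * int (slop x (base m)) \<and>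
            tally m Slack \<ge> - tol (steps m) * unit_of m / 4 - 1 \<and>
            tally m Gain + tally m Slack \<le> 2 * int (target x (base m) + slop x (base m))
          else tally m Gain \<le> int (target x (base m) + slop x (base m))))"

text \<open>Nonnegative \<open>Neg i\<close> at all times excludes the second way of winning. The
  bound on \<open>Gain\<close> depends on \<open>base\<close> alone, so a positive gain rate forces
  player 1 to keep opening rounds with ever larger \<open>base\<close>.\<close>

definition referee_gen :: "nat \<Rightarrow> referee \<Rightarrow> bool" where
  "referee_gen x m \<longleftrightarrow> base m \<le> clock m \<and> (\<forall>i. tally m (Neg i) \<ge> 0) \<and>
     (\<forall>d. \<bar>tally m d\<bar> \<le> int ((x + 2) * clock m)) \<and>
     tally m Gain \<le> 4 * int (target x (base m) + slop x (base m))"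

text \<open>The evidence left by a round that player 2 ends: the unit is large compared with the
  gain so far, and either the round was long or one of the constrained dimensions lies below 0 by a
  definite fraction of the unit.\<close>

definition arrival :: "nat \<Rightarrow> referee \<Rightarrow> bool" where
  "arrival x m \<longleftrightarrow> unit_of m \<ge> 1 \<and> steps m * unit_of m \<le> 2 * clock m \<and> tally m Gain \<le> 4 * unit_of m \<and>
     (steps m \<ge> base m \<or> (\<exists>d \<in> insert Slack (range Pos). tally m d \<le> - tol (steps m) * unit_of m / 4))"

lemma tol_pos: "tol s > 0" and tol_le: "tol s \<le> 1 / 64" and tol_Suc: "tol (Suc s) = tol s / 2"
  by (simp_all add: tol_def field_simps)

lemma exactD:
  assumes "exact x m"
  shows "unit_of m \<ge> 1000 * real (slop x (base m))" "slop x (base m) \<ge> 16"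
    "15 * real (slop x (base m)) \<le> tol (steps m) * unit_of m"
    "real (target x (base m)) \<le> unit_of m + real (slop x (base m))"
    "unit_of m \<le> real (target x (base m)) + real (slop x (base m))"
proof -
  let ?M = "real (slop x (base m))"
  have b: "base m \<ge> 1" and s: "steps m \<le> base m" and u: "\<bar>unit_of m - target x (base m)\<bar> \<le> ?M"
    using assms by (auto simp: exact_def)
  have t: "real (target x (base m)) = 1024 * 2 ^ base m * ?M"
    by (simp add: target_def slop_def)
  have p1: "(1::real) \<le> 2 ^ base m" by simp
  have M0: "?M \<ge> 0" by simp
  have "?M * 1 \<le> ?M * 2 ^ base m" by (rule mult_left_mono) simp_all
  then have u1: "unit_of m \<ge> 1023 * 2 ^ base m * ?M" using u t by (simp add: algebra_simps)
  have "1000 * ?M \<le> 1023 * 2 ^ base m * ?M"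
    using \<open>?M * 1 \<le> ?M * 2 ^ base m\<close> M0 by (simp add: algebra_simps)
  with u1 show "unit_of m \<ge> 1000 * ?M" by linarith
  have "1 \<le> base m * 1" using b by simp
  have "4 \<le> (x + 2)\<^sup>2" by (simp add: power2_eq_square)
  with b have "4 * 1 \<le> (x + 2)\<^sup>2 * base m" by (intro mult_mono) auto
  then show "slop x (base m) \<ge> 16" by (simp add: slop_def mult.commute)
  have "(2::real) ^ steps m \<le> 2 ^ base m" using s by (intro power_increasing) auto
  then have "15 * ?M * (64 * 2 ^ steps m) \<le> 15 * ?M * (64 * 2 ^ base m)"
    by (intro mult_left_mono) auto
  also have "\<dots> \<le> 1023 * 2 ^ base m * ?M" by simp
  also have "\<dots> \<le> unit_of m" by (rule u1)
  finally show "15 * ?M \<le> tol (steps m) * unit_of m"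
    by (simp add: tol_def field_simps)
  show "real (target x (base m)) \<le> unit_of m + ?M" "unit_of m \<le> real (target x (base m)) + ?M"
    using u by linarith+
qed

lemma mult_le_slop: "(x + 2) * b \<le> slop x b"
  unfolding slop_def by (intro mult_le_mono le_refl) (simp add: power2_eq_square)

lemma referee_init: "referee_inv T q0 x Reset (Referee 0 (\<lambda>_. 0) 0 0)" "referee_gen x (Referee 0 (\<lambda>_. 0) 0 0)"
  by (auto simp: referee_inv_def referee_gen_def)

lemma referee_sel [simp]:
  "clock (referee_upd x m u v) = Suc (clock m)"
  "tally (referee_upd x m u v) d = tally m d + wt x (u, v) d"
  "base (referee_upd x m u v) = (if u = Reset \<and> v = Scale then Suc (clock m) else base m)"
  "steps (referee_upd x m u v) = (case u of
        Scale \<Rightarrow> 0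
      | Claim t b \<Rightarrow> if v = State (snd (snd t)) (\<not> b) then Suc (steps m) else steps m
      | _ \<Rightarrow> steps m)"
  by (simp_all add: referee_upd_def)

lemma unit_of_upd: "unit_of (referee_upd x m u v) =
  unit_of m + wt x (u, v) (Pos (Unit False)) + wt x (u, v) (Pos (Unit True))"
  by (simp add: unit_of_def)

lemma unit_of_upd_const:
  assumes "edge T q0 qf u v" "u \<noteq> Scale \<or> v \<noteq> Scale"
  shows "unit_of (referee_upd x m u v) = unit_of m"
  using assms
proof (cases rule: edge.cases)
  case (Loop_Check e b)
  then show ?thesis by (cases "fst (snd e)"; cases b) (auto simp: unit_of_upd)
qed (auto simp: unit_of_upd)

lemma balanced_upd:
  assumes "balanced x m" "edge T q0 qf u v" "u \<noteq> Reset" "u \<noteq> Scale" "\<And>i. u \<noteq> Blame i"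
  shows "balanced x (referee_upd x m u v)"
  using assms(2-) assms(1)
  by (cases rule: edge.cases) (auto simp: balanced_def)

text \<open>Passed checks and an accepted claim confine the number \<open>k\<close> of traversals to
  within \<open>3 * tol s\<close> units of one unit. A counter thus acquires the additional error
  \<open>3 * tol s = 6 * (tol s - tol (Suc s))\<close>, and the emptied unit counter is off by at
  most \<open>tol s = 2 * tol (Suc s)\<close>. This is the origin of the constants 6 and 2 in
  \<open>tracks\<close>.\<close>

lemma claim_step:
  assumes ex: "exact x m" and tr: "tracks m c b (effect o1 b) k"
    and nn: "k > 0 \<Longrightarrow> \<forall>i. tally m (Pos i) \<ge> - tol (steps m) * unit_of m"
    and acc: "tally m (Pos (claimed o1 b)) \<le> tol (steps m) * unit_of m"
    and m': "tally m' = tally m" "base m' = base m" "clock m' = Suc (clock m)"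
      "steps m' = (if flip o1 b = b then steps m else Suc (steps m))"
    and lt: "steps m < base m"
  obtains c' where "op_step o1 c c'" "tracks m' c' (flip o1 b) (\<lambda>_. 0) 0" "exact x m'"
proof -
  let ?h = "tol (steps m)" and ?U = "unit_of m"
  have U': "unit_of m' = ?U" by (simp add: unit_of_def m')
  have U0: "?U > 0" using exactD(1,2)[OF ex] by linarith
  have hU: "0 < ?h * ?U" "?h * ?U \<le> ?U / 64"
    using U0 tol_pos[of "steps m"] mult_right_mono[OF tol_le[of "steps m"], of ?U] by auto
  have trC: "\<bar>tally m (Pos (Cnt i)) - real k * effect o1 b (Cnt i) - c i * ?U\<bar> \<le> ?U / 4 - 6 * (?h * ?U)" for i
    using tr by (simp add: tracks_def left_diff_distrib mult.assoc)
  have trU: "\<bar>tally m (Pos (Unit (\<not> b))) - real k * effect o1 b (Unit (\<not> b))\<bar> \<le> 2 * (?h * ?U)"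
    and time: "steps m * ?U + 2 * k \<le> 2 * clock m"
    using tr by (auto simp: tracks_def mult.assoc)
  have Usum: "tally m (Pos (Unit b)) + tally m (Pos (Unit (\<not> b))) = ?U"
    by (cases b) (simp_all add: unit_of_def)
  consider (Count) i e where "o1 = Inc i \<or> o1 = Dec i" "flip o1 b \<noteq> b" "e = (if o1 = Inc i then 1 else -1 :: int)"
    | (Test) i where "o1 = Tst i" | (Nop) "o1 = Nop"
    by (cases o1) auto
  then show ?thesis
  proof cases
    case Test
    \<comment> \<open>The reading is at most 1/64 unit and differs from \<open>c i\<close> units by
      less than a quarter, so \<open>c i\<close> must round to 0.\<close>
    have "c i * ?U \<le> tally m (Pos (Cnt i)) + ?U / 4"
      using trC[of i] hU(1) Test by simp
    also have "\<dots> < 1 * ?U"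
    proof -
      have "tally m (Pos (Cnt i)) \<le> ?h * ?U" using acc Test by simp
      then show ?thesis using hU U0 by linarith
    qed
    finally have "c i = 0" using U0 by (simp add: mult_less_cancel_right)
    then show ?thesis
      using ex tr Test U' m' that[of c]
      by (simp add: exact_def tracks_def)
  next
    case Nop
    then show ?thesis
      using ex tr U' m' that[of c] by (simp add: exact_def tracks_def)
  next
    case Count
    have eff: "effect o1 b (Unit (\<not> b)) = 1" "effect o1 b (Cnt i) = e" "\<And>j. j \<noteq> i \<Longrightarrow> effect o1 b (Cnt j) = 0"
      and cl: "claimed o1 b = Unit b" and fl: "flip o1 b = (\<not> b)"
      using Count by auto
    \<comment> \<open>Little is left in \<open>Unit b\<close>, so nearly the whole unit has passed
      to the other unit counter, one per traversal.\<close>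
    have kl: "real k \<ge> ?U - 3 * (?h * ?U)"
      using acc trU Usum by (simp add: cl eff)
    then have "k > 0" using hU U0 by (cases k) auto
    then have nn': "tally m (Pos i) \<ge> - (?h * ?U)" for i using nn by auto
    have ku: "real k \<le> ?U + 3 * (?h * ?U)"
      using nn'[of "Unit b"] trU Usum by (simp add: eff)
    \<comment> \<open>Taking nearly a unit from an empty counter leaves it below minus three
      quarters of a unit up to the tolerance, far less than \<open>Check\<close> lets pass.\<close>
    have c_pos: "c i > 0" if "o1 = Dec i"
    proof (rule ccontr)
      assume "\<not> c i > 0"
      then show False using trC[of i] nn'[of "Cnt i"] kl hU U0 Count that
        by (simp add: eff)
    qed
    define c' where "c' = c(i := if o1 = Inc i then Suc (c i) else c i - 1)"
    have step: "op_step o1 c c'" using Count c_pos by (auto simp: c'_def)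
    have c'i: "real (c' i) = real (c i) + e" using Count c_pos by (auto simp: c'_def of_nat_diff)
    have "\<bar>tally m (Pos (Cnt j)) - c' j * ?U\<bar> \<le> ?U / 4 - 3 * (?h * ?U)" for j
    proof (cases "j = i")
      case True
      have "e = 1 \<or> e = - 1" using Count by auto
      moreover have "c' i * ?U = c i * ?U + e * ?U" by (simp add: c'i distrib_right)
      ultimately show ?thesis
        using trC[of i] kl ku unfolding True eff(2) by (elim disjE) simp_all
    next
      case False
      then show ?thesis using trC[of j] hU by (simp add: eff c'_def)
    qed
    moreover have "\<bar>tally m (Pos (Unit b))\<bar> \<le> ?h * ?U"
      using nn'[of "Unit b"] acc cl by auto
    \<comment> \<open>This pays for the time bound: \<open>Suc s\<close> units are at most
      \<open>s\<close> units plus \<open>2 * k\<close>.\<close>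
    moreover have "real k \<ge> ?U / 2" using kl hU by linarith
    ultimately have "tracks m' c' (flip o1 b) (\<lambda>_. 0) 0" "exact x m'"
      using ex time lt U' m' fl
      by (auto simp: tracks_def exact_def tol_Suc algebra_simps)
    with step show ?thesis by (rule that)
  qed
qed

lemma tracks_lower:
  assumes ex: "exact x m" and tr: "tracks m c b (\<lambda>_. 0) 0"
  shows "tally m (Pos i) \<ge> - unit_of m / 4"
proof -
  let ?h = "tol (steps m)" and ?U = "unit_of m"
  have U0: "?U > 0" using exactD(1,2)[OF ex] by linarith
  have hU: "0 < ?h * ?U" "?h * ?U \<le> ?U / 64"
    using U0 tol_pos[of "steps m"] mult_right_mono[OF tol_le[of "steps m"], of ?U] by auto
  have trC: "\<bar>tally m (Pos (Cnt i)) - c i * ?U\<bar> \<le> ?U / 4 - 6 * (?h * ?U)" for i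
    using tr by (simp add: tracks_def left_diff_distrib mult.assoc)
  have trU: "\<bar>tally m (Pos (Unit (\<not> b)))\<bar> \<le> 2 * (?h * ?U)"
    using tr by (auto simp: tracks_def mult.assoc)
  have Usum: "tally m (Pos (Unit b)) + tally m (Pos (Unit (\<not> b))) = ?U"
    by (cases b) (simp_all add: unit_of_def)
  have "c i * ?U \<ge> 0" for i using U0 by simp
  then have "tally m (Pos (Cnt i)) \<ge> - ?U / 4" for i
    using trC[of i] hU(1) by (smt (verit) divide_minus_left)
  moreover have "tally m (Pos (Unit b)) \<ge> - ?U / 4" "tally m (Pos (Unit (\<not> b))) \<ge> - ?U / 4"
    using trU Usum hU U0 by linarith+
  ultimately show ?thesis
    by (cases i) (blast, rename_tac b', case_tac "b' = b", simp_all)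
qed

text \<open>Every dimension equals its intended multiple of \<open>K\<close> up to the past
  contribution \<open>?E\<close>. The input counter, however, must be compared with \<open>x\<close>
  times the actual unit, which differs from \<open>K\<close> by up to \<open>2 * ?E\<close>; this
  costs the further \<open>x * (2 * ?E)\<close>.\<close>

lemma start_round:
  assumes inv: "referee_inv T q0 x Scale m" and gen: "referee_gen x m"
    and full: "clock m = base m + target x (base m)"
    and m': "m' = referee_upd x m Scale (State q0 b)" and "\<not> b"
  shows "referee_inv T q0 x (State q0 b) m'"
proof -
  let ?K = "int (target x (base m))" and ?M = "int (slop x (base m))" and ?E = "int ((x + 2) * base m)"
  have b1: "base m \<ge> 1" and dev: "\<And>d. \<bar>tally m d - scale_vec x d * ?K\<bar> \<le> ?E"
    using inv full by (auto simp: referee_inv_def)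
  have ts: "tally m' = tally m" "base m' = base m" "steps m' = 0" "unit_of m' = unit_of m"
    by (auto simp: m' unit_of_upd)
  have E0: "?E \<ge> 0" by simp
  have M: "?M = 4 * (int x + 2) * ?E" by (simp add: slop_def power2_eq_square algebra_simps)
  have "(2 * int x + 5) * ?E \<le> 4 * (int x + 2) * ?E"
    by (rule mult_right_mono) simp_all
  then have EM: "4 * ?E \<le> ?M" "?E + int x * (2 * ?E) \<le> ?M" 
    using E0 mult_nonneg_nonneg[of "int x" ?E] unfolding M by (simp_all add: algebra_simps)
  have U: "unit_of m = of_int (tally m (Pos (Unit False)) + tally m (Pos (Unit True)))"
    by (simp add: unit_of_def)
  have UK: "\<bar>tally m (Pos (Unit False)) + tally m (Pos (Unit True)) - ?K\<bar> \<le> 2 * ?E"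
    using dev[of "Pos (Unit False)"] dev[of "Pos (Unit True)"] by simp
  have ex: "exact x m'"
    unfolding exact_def ts U using b1 UK EM(1) E0 by simp
  have bal: "balanced x m'"
    unfolding balanced_def ts
  proof (intro conjI allI)
    fix i
    show "\<bar>tally m (Neg i) - tally m (Pos i) - ?K\<bar> \<le> ?M"
      using dev[of "Neg i"] dev[of "Pos i"] EM(1) by (simp add: algebra_simps)
    show "\<bar>tally m Slack - ?K\<bar> \<le> ?M" using dev[of Slack] EM(1) E0 by simp
    show "tally m Gain \<le> int (target x (base m) + slop x (base m))"
      using dev[of Gain] EM(1) E0 by simp
  qed
  have half: "real_of_int ?M \<le> (1 / 4 - 6 * tol 0) * unit_of m'" "real_of_int ?M \<le> 2 * tol 0 * unit_of m'"
    using exactD(1)[OF ex] by (simp_all add: ts tol_def)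
  have "\<bar>tally m (Pos (Cnt i)) - int (start_counters x i) * (tally m (Pos (Unit False)) + tally m (Pos (Unit True)))\<bar> \<le> ?M" for i
  proof (cases i)
    case True then show ?thesis using dev[of "Pos (Cnt i)"] EM(1) E0 by (simp add: start_counters_def)
  next
    case False
    define V where "V = tally m (Pos (Unit False)) + tally m (Pos (Unit True))"
    have "\<bar>int x * (V - ?K)\<bar> \<le> int x * (2 * ?E)"
      unfolding abs_mult using UK by (intro mult_mono) (auto simp: V_def)
    moreover have "tally m (Pos (Cnt i)) - int x * V = (tally m (Pos (Cnt i)) - int x * ?K) - int x * (V - ?K)"
      by (simp add: algebra_simps)
    ultimately show ?thesis
      using dev[of "Pos (Cnt i)"] EM(2) False by (simp add: start_counters_def V_def[symmetric])
  qed
  then have "real_of_int \<bar>tally m (Pos (Cnt i)) - int (start_counters x i) * (tally m (Pos (Unit False)) + tally m (Pos (Unit True)))\<bar> \<le> real_of_int ?M" for i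
    by (simp only: of_int_le_iff)
  then have "\<bar>tally m' (Pos (Cnt i)) - start_counters x i * unit_of m'\<bar> \<le> real_of_int ?M" for i
    unfolding ts U by simp
  moreover have "\<bar>tally m' (Pos (Unit True))\<bar> \<le> real_of_int ?M"
    using dev[of "Pos (Unit True)"] EM(1) E0 by (simp add: ts)
  ultimately have "tracks m' (start_counters x) b (\<lambda>_. 0) 0"
    unfolding tracks_def using half \<open>\<not> b\<close> by (auto simp: ts intro: order_trans)
  with ex bal show ?thesis by (auto simp: referee_inv_def intro: reaches.refl)
qed

text \<open>Before a traversal every counter is at least minus a quarter unit, by the last
  \<open>Check\<close> if there was one and by \<open>tracks\<close> otherwise; the traversal
  changes it by at most 1, which is negligible against the unit.\<close>

lemma loop_traversal:
  assumes ex: "exact x m" and tr: "tracks m c b (effect o1 b) k"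
    and nn: "k > 0 \<Longrightarrow> \<forall>i. tally m (Pos i) \<ge> - tol (steps m) * unit_of m"
    and m': "m' = referee_upd x m (Loop (q, o1, q') b) (Check (q, o1, q') b)"
  shows "tracks m' c b (effect o1 b) (Suc k)" "tally m' (Pos i) \<ge> - unit_of m' / 2"
proof -
  have sc: "unit_of m' = unit_of m" unfolding m'
    by (cases o1; cases b) (auto simp: unit_of_upd)
  have ts: "tally m' (Pos i) = tally m (Pos i) + effect o1 b i" "steps m' = steps m" "clock m' = Suc (clock m)" for i
    by (simp_all add: m')
  show "tracks m' c b (effect o1 b) (Suc k)"
    using tr unfolding tracks_def sc ts by (auto simp: algebra_simps)
  have "\<bar>effect o1 b i\<bar> \<le> 1" by (cases o1) auto
  moreover have "unit_of m \<ge> 16" using exactD(1,2)[OF ex] by linarith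
  moreover have "tally m (Pos i) \<ge> - unit_of m / 4"
  proof (cases "k > 0")
    case True
    have "tol (steps m) * unit_of m \<le> unit_of m / 64"
      using mult_right_mono[OF tol_le[of "steps m"], of "unit_of m"] \<open>unit_of m \<ge> 16\<close> by simp
    moreover have "tally m (Pos i) \<ge> - (tol (steps m) * unit_of m)" using nn True by simp
    ultimately show ?thesis using \<open>unit_of m \<ge> 16\<close> by linarith
  next
    case False
    then have "tracks m c b (\<lambda>_. 0) 0" using tr by (simp add: tracks_def)
    from tracks_lower[OF ex this] show ?thesis .
  qed
  ultimately show "tally m' (Pos i) \<ge> - unit_of m' / 2"
    unfolding sc ts by simp
qed

lemma referee_gen_upd:
  assumes "referee_gen x m" "edge T q0 qf u v" "m' = referee_upd x m u v"
    and "\<And>i. tally m' (Neg i) \<ge> 0"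
    and "tally m' Gain \<le> 4 * int (target x (base m') + slop x (base m'))"
  shows "referee_gen x m'"
proof -
  have "\<bar>tally m' d\<bar> \<le> int ((x + 2) * clock m')" for d
  proof -
    have "\<bar>tally m' d\<bar> \<le> \<bar>tally m d\<bar> + \<bar>wt x (u, v) d\<bar>" by (simp add: assms(3))
    also have "\<dots> \<le> int ((x + 2) * clock m) + (int x + 2)"
      using assms(1) abs_wt_le[of x "(u, v)" d] by (intro add_mono) (auto simp: referee_gen_def)
    finally show ?thesis by (simp add: assms(3) algebra_simps)
  qed
  then show ?thesis
    using assms by (auto simp: referee_gen_def)
qed

lemma balanced_gen:
  assumes "exact x m" "balanced x m" "\<And>i. tally m (Pos i) \<ge> - unit_of m / 2"
  shows "tally m (Neg i) \<ge> 0" "tally m Gain \<le> 4 * int (target x (base m) + slop x (base m))"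
proof -
  have "tally m (Pos i) \<ge> - unit_of m / 2" by fact
  moreover have "\<bar>real_of_int (tally m (Neg i)) - real_of_int (tally m (Pos i)) - target x (base m)\<bar> \<le> slop x (base m)"
    using assms(2) unfolding balanced_def
    by (metis (no_types, lifting) of_int_abs of_int_diff of_int_le_iff of_int_of_nat_eq)
  ultimately have "real_of_int (tally m (Neg i)) \<ge> 0"
    using exactD(1,2,5)[OF assms(1)] by linarith
  then show "tally m (Neg i) \<ge> 0" by simp
  show "tally m Gain \<le> 4 * int (target x (base m) + slop x (base m))"
    using assms(2) by (auto simp: balanced_def)
qed

text \<open>That the machine does not accept enters only at the edge from the final state to
  \<open>Reset\<close>, where the invariant would supply an accepting run. All other arrivals at
  \<open>Reset\<close> from elsewhere are decisions of player 2 and carry the evidence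
  \<open>arrival\<close>.\<close>

lemma referee_step:
  assumes inv: "referee_inv T q0 x u m" and gen: "referee_gen x m"
    and edge: "edge T q0 qf u v" and act: "u \<in> vertices2 T \<Longrightarrow> v = referee_act q0 x m u"
    and rej: "\<not> accepts T q0 qf x"
    and m': "m' = referee_upd x m u v"
  shows "referee_inv T q0 x v m' \<and> referee_gen x m' \<and> (u \<noteq> Reset \<and> v = Reset \<longrightarrow> arrival x m')"
proof -
  let ?h = "tol (steps m)" and ?U = "unit_of m"
  note g = referee_gen_upd[OF gen edge m']
  have gN: "tally m (Neg i) \<ge> 0" for i using gen by (auto simp: referee_gen_def)
  from edge show ?thesis
  proof (cases rule: edge.cases)
    case Reset_Reset
    then show ?thesis using gen by (intro conjI g) (auto simp: referee_inv_def m' referee_gen_def)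
  next
    case Reset_Scale
    have "\<bar>tally m' d\<bar> \<le> int ((x + 2) * clock m')" for d
    proof -
      have "\<bar>tally m d\<bar> \<le> int ((x + 2) * clock m)" using gen by (auto simp: referee_gen_def)
      then show ?thesis using Reset_Scale by (auto simp: m' algebra_simps)
    qed
    moreover have "tally m' Gain \<le> 4 * int (target x (base m') + slop x (base m'))"
    proof -
      have "tally m' Gain \<le> int ((x + 2) * clock m')" using calculation[of Gain] by simp
      also have "clock m' = base m'" using Reset_Scale by (simp add: m')
      also have "(x + 2) * base m' \<le> slop x (base m')"
        by (rule mult_le_slop)
      finally show ?thesis by simp
    qed
    ultimately show ?thesis using Reset_Scale gN
      by (intro conjI g) (auto simp: referee_inv_def m')
  next
    case Scale_Scale
    have u2: "u \<in> vertices2 T" using Scale_Scale by (auto simp: vertices2_def)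
    have lt: "clock m < base m + target x (base m)"
      using act[OF u2] Scale_Scale by (auto simp: referee_act_def split: if_splits)
    have dev: "\<bar>tally m d - scale_vec x d * (int (clock m) - int (base m))\<bar> \<le> int ((x + 2) * base m)"
        "base m \<ge> 1" "base m \<le> clock m" for d
      using inv Scale_Scale by (auto simp: referee_inv_def)
    have inv': "referee_inv T q0 x v m'"
      using lt dev Scale_Scale by (auto simp: referee_inv_def m' algebra_simps)
    have "unit_vec x i \<ge> 0" for i by (cases i) auto
    then have N: "tally m' (Neg i) \<ge> 0" for i
      using gN Scale_Scale by (simp add: m')
    have "tally m' Gain \<le> int (clock m') - int (base m') + int ((x + 2) * base m')"
      using dev(1)[of Gain] Scale_Scale by (simp add: m')
    also have "\<dots> \<le> int (target x (base m')) + int (slop x (base m'))"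
      using lt Scale_Scale of_nat_mono[OF mult_le_slop[of x "base m'"], where 'a = int] by (intro add_mono) (simp_all add: m')
    finally have "tally m' Gain \<le> 4 * int (target x (base m') + slop x (base m'))" by simp
    from g[OF N this] inv' Scale_Scale show ?thesis by simp
  next
    case Scale_State
    have u2: "u \<in> vertices2 T" using Scale_State by (auto simp: vertices2_def)
    have "clock m = base m + target x (base m)"
      using act[OF u2] Scale_State inv by (auto simp: referee_act_def referee_inv_def split: if_splits)
    then have "referee_inv T q0 x v m'"
      using start_round[of T q0 x m m' False] inv gen Scale_State m' by auto
    then show ?thesis
      using gen Scale_State by (intro conjI g) (auto simp: m' referee_gen_def)
  next
    case (Blame_Blame i)
    have u2: "u \<in> vertices2 T" using Blame_Blame by (auto simp: vertices2_def)
    have lt: "steps m < base m" "tally m Slack > - ?h * ?U / 4"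
      using act[OF u2] Blame_Blame by (auto simp: referee_act_def split: if_splits)
    have ex: "exact x m" and I: "tally m (Pos i) > ?h * ?U"
        "tally m (Neg i) - tally m Slack \<ge> tally m (Pos i) - 2 * int (slop x (base m))"
        "tally m Gain + tally m Slack \<le> 2 * int (target x (base m) + slop x (base m))"
      using inv Blame_Blame lt by (auto simp: referee_inv_def)
    have sc: "unit_of m' = ?U" using unit_of_upd_const[OF edge] Blame_Blame by (simp add: m')
    have ts: "steps m' = steps m" "base m' = base m" "clock m' = Suc (clock m)"
        "tally m' (Pos j) = tally m (Pos j)" "tally m' (Neg j) = tally m (Neg j) - (if j = i then 1 else 0)"
        "tally m' Slack = tally m Slack - 1" "tally m' Gain = tally m Gain + 1" for j
      using Blame_Blame by (auto simp: m')
    have ex': "exact x m'" using ex by (auto simp: exact_def sc ts)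
    have inv': "referee_inv T q0 x v m'"
      using Blame_Blame lt I ex' by (auto simp: referee_inv_def sc ts)
    have slackl: "tally m' Slack \<ge> - ?h * ?U / 4 - 1" using lt(2) ts by simp
    have "real_of_int (tally m' (Neg i)) \<ge> tally m' Slack + tally m (Pos i) - 2 * int (slop x (base m))"
    proof -
      have "real_of_int (tally m (Neg i)) - tally m Slack \<ge> tally m (Pos i) - 2 * int (slop x (base m))"
        using I(2) by linarith
      then show ?thesis by (simp add: ts)
    qed
    \<comment> \<open>\<open>Slack\<close> is at least \<open>- tol * U / 4 - 1\<close>, the counter
      exceeds \<open>tol * U\<close>, and \<open>tol * U\<close> is at least 15 times
      \<open>slop\<close>.\<close>
    then have "tally m' (Neg i) \<ge> 0"
      using slackl I(1) exactD(2,3)[OF ex] by (simp add: divide_simps)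
    then have N: "tally m' (Neg j) \<ge> 0" for j using gN[of j] by (cases "j = i") (auto simp: ts)
    define z where "z = ?h * ?U"
    \<comment> \<open>A blame keeps \<open>Gain + Slack\<close> constant, so the lower bound on
      \<open>Slack\<close> caps \<open>Gain\<close>.\<close>
    have "real_of_int (tally m' Gain) \<le> 2 * (target x (base m) + slop x (base m)) + z / 4 + 1"
      using I(3) slackl unfolding ts by (simp add: z_def)
    moreover have "z \<le> ?U / 64"
      using mult_right_mono[OF tol_le[of "steps m"], of ?U] exactD(1,2)[OF ex] by (simp add: z_def)
    moreover have "?U / 256 + 1 \<le> 2 * (real (target x (base m)) + real (slop x (base m)))"
      using exactD(5)[OF ex] exactD(1,2)[OF ex] by simp
    ultimately have "real_of_int (tally m' Gain) \<le> 4 * (real (target x (base m')) + real (slop x (base m')))"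
      unfolding ts by simp
    then have "real_of_int (tally m' Gain) \<le> real_of_int (4 * int (target x (base m') + slop x (base m')))"
      by simp
    then have "tally m' Gain \<le> 4 * int (target x (base m') + slop x (base m'))"
      by (simp only: of_int_le_iff)
    from g[OF N this] inv' Blame_Blame show ?thesis by simp
  next
    case (Blame_Reset i)
    have u2: "u \<in> vertices2 T" using Blame_Reset by (auto simp: vertices2_def)
    have ex: "exact x m" using inv Blame_Reset by (auto simp: referee_inv_def)
    have sc: "unit_of m' = ?U" using unit_of_upd_const[OF edge] Blame_Reset by (simp add: m')
    have ts: "steps m' = steps m" "base m' = base m" "clock m' = Suc (clock m)" "tally m' = tally m"
      using Blame_Reset by (auto simp: m')
    have U: "?U \<ge> 1000 * real (slop x (base m))" "slop x (base m) \<ge> 16" using exactD[OF ex] by auto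
    have "arrival x m'"
    proof (cases "steps m < base m")
      case True
      then have "tally m Slack \<le> - ?h * ?U / 4"
        using act[OF u2] Blame_Reset by (auto simp: referee_act_def split: if_splits)
      moreover have "tally m Gain + tally m Slack \<le> 2 * int (target x (base m) + slop x (base m))"
        "tally m Slack \<ge> - ?h * ?U / 4 - 1"
        using inv Blame_Reset True by (auto simp: referee_inv_def)
      moreover have "?h * ?U \<le> ?U / 64"
        using mult_right_mono[OF tol_le[of "steps m"], of ?U] U by simp
      moreover have "real_of_int (tally m Gain + tally m Slack) \<le> real_of_int (2 * int (target x (base m) + slop x (base m)))"
        using calculation(2) by (simp only: of_int_le_iff)
      moreover from this have "real_of_int (tally m Gain) \<le> 2 * (real (target x (base m)) + slop x (base m)) - tally m Slack"
        by simp
      moreover have "- real_of_int (tally m Slack) \<le> ?U / 256 + 1"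
      proof -
        have "- real_of_int (tally m Slack) \<le> (?h * ?U) / 4 + 1" using calculation(3) by simp
        with divide_right_mono[OF calculation(4), of 4] show ?thesis by (simp add: mult.commute)
      qed
      moreover have "real_of_int (tally m Gain) \<le> 4 * ?U"
        using calculation(6,7) U exactD(4)[OF ex] by simp
      ultimately show ?thesis
        using ex U by (auto simp: arrival_def sc ts exact_def)
    next
      case False
      then have "tally m Gain \<le> int (target x (base m) + slop x (base m))"
        using inv Blame_Reset by (auto simp: referee_inv_def)
      then have "real_of_int (tally m Gain) \<le> target x (base m) + slop x (base m)" by linarith
      then show ?thesis using False ex U exactD(4)[OF ex] by (auto simp: arrival_def sc ts exact_def)
    qed
    moreover have "referee_inv T q0 x v m'" using Blame_Reset by (simp add: referee_inv_def)
    moreover have "referee_gen x m'" using gen by (intro g) (auto simp: ts referee_gen_def)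
    ultimately show ?thesis by simp
  next
    case (State_State q b)
    have ex: "exact x m" and bal: "balanced x m" and
      R: "\<exists>c. reaches T q0 (start_counters x) q c \<and> tracks m c b (\<lambda>_. 0) 0"
      using inv State_State by (auto simp: referee_inv_def)
    have sc: "unit_of m' = ?U" using unit_of_upd_const[OF edge] State_State by (simp add: m')
    have ts: "steps m' = steps m" "base m' = base m" "clock m' = Suc (clock m)" "tally m' = tally m"
      using State_State by (auto simp: m')
    have "exact x m'" "balanced x m'" "tracks m c b (\<lambda>_. 0) 0 \<Longrightarrow> tracks m' c b (\<lambda>_. 0) 0" for c
      using ex bal by (auto simp: exact_def balanced_def tracks_def sc ts)
    then have "referee_inv T q0 x v m'" using R State_State by (auto simp: referee_inv_def)
    moreover have "referee_gen x m'" using gen by (intro g) (auto simp: ts referee_gen_def)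
    ultimately show ?thesis using State_State by simp
  next
    case (State_Reset b)
    then show ?thesis using inv rej by (auto simp: referee_inv_def accepts_def)
  next
    case (State_Loop q o1 q' b)
    have ex: "exact x m" and bal: "balanced x m" and
      R: "\<exists>c. reaches T q0 (start_counters x) q c \<and> tracks m c b (\<lambda>_. 0) 0"
      using inv State_Loop by (auto simp: referee_inv_def)
    have sc: "unit_of m' = ?U" using unit_of_upd_const[OF edge] State_Loop by (simp add: m')
    have ts: "steps m' = steps m" "base m' = base m" "clock m' = Suc (clock m)" "tally m' = tally m"
      using State_Loop by (auto simp: m')
    have "exact x m'" "balanced x m'" "tracks m c b (\<lambda>_. 0) 0 \<Longrightarrow> tracks m' c b (effect o1 b) 0" for c
      using ex bal by (auto simp: exact_def balanced_def tracks_def sc ts)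
    then have "referee_inv T q0 x v m'" using R State_Loop by (fastforce simp: referee_inv_def)
    moreover have "referee_gen x m'" using gen by (intro g) (auto simp: ts referee_gen_def)
    ultimately show ?thesis using State_Loop by simp
  next
    case (Loop_Check e b)
    obtain q o1 q' where e: "e = (q, o1, q')" by (cases e)
    obtain c k where ex: "exact x m" and bal: "balanced x m" and
      R: "reaches T q0 (start_counters x) q c" and tr: "tracks m c b (effect o1 b) k" and
      nn: "k > 0 \<longrightarrow> (\<forall>i. tally m (Pos i) \<ge> - ?h * ?U)"
      using inv Loop_Check by (auto simp: referee_inv_def e)
    have sc: "unit_of m' = ?U" using unit_of_upd_const[OF edge] Loop_Check by (simp add: m')
    have ts: "steps m' = steps m" "base m' = base m" "clock m' = Suc (clock m)"
      using Loop_Check by (auto simp: m')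
    have m'': "m' = referee_upd x m (Loop (q, o1, q') b) (Check (q, o1, q') b)"
      using Loop_Check e m' by simp
    note L = loop_traversal[OF ex tr mp[OF nn] m'']
    have ex': "exact x m'" using ex by (auto simp: exact_def sc ts)
    have bal': "balanced x m'" using balanced_upd[OF bal edge] Loop_Check m' by simp
    have "referee_inv T q0 x v m'" using ex' bal' L R Loop_Check by (auto simp: referee_inv_def e)
    moreover have "referee_gen x m'"
      using balanced_gen[OF ex' bal' L(2)] by (intro g) auto
    ultimately show ?thesis using Loop_Check by simp
  next
    case (Loop_Claim e b)
    have ex: "exact x m" and bal: "balanced x m" and
      R: "\<exists>c k. reaches T q0 (start_counters x) (fst e) c \<and> tracks m c b (effect (fst (snd e)) b) k \<and>
            (k > 0 \<longrightarrow> (\<forall>i. tally m (Pos i) \<ge> - ?h * ?U))"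
      using inv Loop_Claim by (auto simp: referee_inv_def)
    have sc: "unit_of m' = ?U" using unit_of_upd_const[OF edge] Loop_Claim by (simp add: m')
    have ts: "steps m' = steps m" "base m' = base m" "clock m' = Suc (clock m)" "tally m' = tally m"
      using Loop_Claim by (auto simp: m')
    have "exact x m'" "balanced x m'" "tracks m c b e1 k \<Longrightarrow> tracks m' c b e1 k" for c k e1
      using ex bal by (auto simp: exact_def balanced_def tracks_def sc ts)
    then have "referee_inv T q0 x v m'" using R Loop_Claim unfolding referee_inv_def
      by (simp add: sc ts) blast
    moreover have "referee_gen x m'" using gen by (intro g) (auto simp: ts referee_gen_def)
    ultimately show ?thesis using Loop_Claim by simp
  next
    case (Check_Loop e b)
    have u2: "u \<in> vertices2 T" using Check_Loop by (force simp: vertices2_def)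
    have ok: "\<forall>i. tally m (Pos i) \<ge> - ?h * ?U"
      using act[OF u2] Check_Loop by (auto simp: referee_act_def not_less split: if_splits)
    have ex: "exact x m" and bal: "balanced x m" and
      R: "\<exists>c k. reaches T q0 (start_counters x) (fst e) c \<and> tracks m c b (effect (fst (snd e)) b) k"
      using inv Check_Loop by (auto simp: referee_inv_def)
    have sc: "unit_of m' = ?U" using unit_of_upd_const[OF edge] Check_Loop by (simp add: m')
    have ts: "steps m' = steps m" "base m' = base m" "clock m' = Suc (clock m)" "tally m' = tally m"
      using Check_Loop by (auto simp: m')
    have "exact x m'" "balanced x m'" "tracks m c b e1 k \<Longrightarrow> tracks m' c b e1 k" for c k e1
      using ex bal by (auto simp: exact_def balanced_def tracks_def sc ts)
    then have "referee_inv T q0 x v m'" using R ok Check_Loop unfolding referee_inv_def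
      by (simp add: sc ts) blast
    moreover have "referee_gen x m'" using gen by (intro g) (auto simp: ts referee_gen_def)
    ultimately show ?thesis using Check_Loop by simp
  next
    case (Check_Reset e b)
    have u2: "u \<in> vertices2 T" using Check_Reset by (force simp: vertices2_def)
    have bad: "steps m \<ge> base m \<or> (\<exists>i. tally m (Pos i) < - ?h * ?U)"
      using act[OF u2] Check_Reset by (auto simp: referee_act_def not_less split: if_splits)
    have ex: "exact x m" and bal: "balanced x m"
      using inv Check_Reset by (auto simp: referee_inv_def)
    have sc: "unit_of m' = ?U" using unit_of_upd_const[OF edge] Check_Reset by (simp add: m')
    have ts: "steps m' = steps m" "base m' = base m" "clock m' = Suc (clock m)" "tally m' = tally m"
      using Check_Reset by (auto simp: m')
    have U: "?U \<ge> 1000 * real (slop x (base m))" "slop x (base m) \<ge> 16" "15 * real (slop x (base m)) \<le> ?h * ?U"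
      using exactD[OF ex] by auto
    have "tally m Gain \<le> int (target x (base m) + slop x (base m))"
      using bal by (auto simp: balanced_def)
    then have "real_of_int (tally m Gain) \<le> target x (base m) + slop x (base m)" by linarith
    moreover have "base m \<le> steps m \<or> (\<exists>d \<in> insert Slack (range Pos). tally m d \<le> - ?h * ?U / 4)"
    proof (rule disjE[OF bad], goal_cases)
      case 2
      then obtain i where "tally m (Pos i) < - ?h * ?U" by blast
      then have "tally m (Pos i) \<le> - ?h * ?U / 4" using U by simp
      then show ?case by blast
    qed simp
    ultimately have "arrival x m'" using ex U exactD(4)[OF ex]
      by (auto simp: arrival_def sc ts exact_def)
    moreover have "referee_inv T q0 x v m'" using Check_Reset by (simp add: referee_inv_def)
    moreover have "referee_gen x m'" using gen by (intro g) (auto simp: ts referee_gen_def)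
    ultimately show ?thesis by simp
  next
    case (Claim_State q o1 q' b)
    have u2: "u \<in> vertices2 T" using Claim_State by (force simp: vertices2_def)
    have acc: "tally m (Pos (claimed o1 b)) \<le> ?h * ?U" and lt: "steps m < base m"
      using act[OF u2] unfolding Claim_State(1,2) referee_act_def by (simp_all add: not_less split: if_splits)
    obtain c k where ex: "exact x m" and bal: "balanced x m" and
      R: "reaches T q0 (start_counters x) q c" and tr: "tracks m c b (effect o1 b) k" and
      nn: "k > 0 \<longrightarrow> (\<forall>i. tally m (Pos i) \<ge> - ?h * ?U)"
      using inv Claim_State by (auto simp: referee_inv_def)
    have ts: "steps m' = (if flip o1 b = b then steps m else Suc (steps m))"
      "base m' = base m" "clock m' = Suc (clock m)" "tally m' = tally m"
      unfolding m' Claim_State(1,2) by (cases o1; simp add: fun_eq_iff)+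
    obtain c' where c': "op_step o1 c c'" "tracks m' c' (flip o1 b) (\<lambda>_. 0) 0" "exact x m'"
      using claim_step[OF ex tr mp[OF nn] acc ts(4,2,3,1) lt] by blast
    have "reaches T q0 (start_counters x) q' c'"
      using R reaches.step[OF Claim_State(3) c'(1) reaches.refl] by (rule reaches_trans)
    moreover have "balanced x m'" using bal by (auto simp: balanced_def ts)
    ultimately have "referee_inv T q0 x v m'" using Claim_State c' by (auto simp: referee_inv_def)
    moreover have "referee_gen x m'" using gen by (intro g) (auto simp: ts referee_gen_def)
    ultimately show ?thesis using Claim_State by simp
  next
    case (Claim_Blame q o1 q' b)
    have u2: "u \<in> vertices2 T" using Claim_Blame by (force simp: vertices2_def)
    have bad: "steps m \<ge> base m \<or> tally m (Pos (claimed o1 b)) > ?h * ?U"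
      using act[OF u2] unfolding Claim_Blame(1,2) referee_act_def by (simp_all add: not_less split: if_splits)
    have ex: "exact x m" and bal: "balanced x m"
      using inv Claim_Blame by (auto simp: referee_inv_def)
    have sc: "unit_of m' = ?U" using unit_of_upd_const[OF edge] Claim_Blame by (simp add: m')
    have ts: "steps m' = steps m" "base m' = base m" "clock m' = Suc (clock m)" "tally m' = tally m"
      using Claim_Blame by (auto simp: m')
    have ex': "exact x m'" using ex by (auto simp: exact_def sc ts)
    have N: "\<bar>tally m (Neg i) - tally m (Pos i) - target x (base m)\<bar> \<le> int (slop x (base m))" for i
      using bal by (auto simp: balanced_def)
    have S: "\<bar>tally m Slack - target x (base m)\<bar> \<le> int (slop x (base m))"
      "tally m Gain \<le> int (target x (base m) + slop x (base m))"
      using bal by (auto simp: balanced_def)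
    have "real_of_int (tally m Slack) \<ge> real (target x (base m)) - slop x (base m)"
      using S(1) by linarith
    then have "tally m Slack \<ge> - ?h * ?U / 4 - 1"
      using exactD(1-3,5)[OF ex] by simp
    then have "referee_inv T q0 x v m'"
      using ex' bad N[of "claimed o1 b"] S Claim_Blame by (auto simp: referee_inv_def sc ts)
    moreover have "referee_gen x m'" using gen by (intro g) (auto simp: ts referee_gen_def)
    ultimately show ?thesis using Claim_Blame by simp
  qed
qed

text \<open>At an arrival at time t with unit U, a gain rate \<delta> and
  \<open>Gain \<le> 4 U\<close> give t \<le> 4 U / \<delta>, so U is at least a fixed fraction of t.
  As a counting step takes at least U / 2, at most 8 / \<delta> of them were made. Once
  \<open>base\<close> exceeds this number the arrival must come with a deviation proportional to U,
  hence to t, and this contradicts a nonnegative limit inferior.\<close>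

lemma referee_wins:
  fixes T :: "'q trans set"
  assumes rej: "\<not> accepts T q0 qf x"
    and play: "\<And>n. edge T q0 qf (\<pi> n) (\<pi> (Suc n))" "\<pi> 0 = Reset"
    and M: "M 0 = Referee 0 (\<lambda>_. 0) 0 0" "\<And>n. M (Suc n) = referee_upd x (M n) (\<pi> n) (\<pi> (Suc n))"
    and act: "\<And>n. \<pi> n \<in> vertices2 T \<Longrightarrow> \<pi> (Suc n) = referee_act q0 x (M n) (\<pi> n)"
  shows "\<not> satisfies (wvec x) \<pi> game_cond"
proof
  assume sat: "satisfies (wvec x) \<pi> game_cond"
  have inv: "referee_inv T q0 x (\<pi> n) (M n) \<and> referee_gen x (M n)" for n
  proof (induction n)
    case 0 show ?case using referee_init M play by simp
  next
    case (Suc n)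
    then show ?case using referee_step[OF _ _ play(1) act rej M(2)] by blast
  qed
  have arr: "arrival x (M (Suc n))" if "\<pi> n \<noteq> Reset" "\<pi> (Suc n) = Reset" for n
    using inv[of n] that referee_step[OF _ _ play(1) act rej M(2)] by blast
  have clock: "clock (M n) = n" for n by (induction n) (simp_all add: M)
  have tally: "tally (M n) d = total x \<pi> d n" for n d
    by (induction n) (simp_all add: M total_Suc)
  have base_le: "base (M n) \<le> base (M (Suc n))" for n
    using inv[of n] by (simp add: M referee_gen_def)
  then have base_mono: "base (M m) \<le> base (M n)" if "m \<le> n" for m n
    using that by (rule lift_Suc_mono_le)
  define H where "H b = 4 * int (target x b + slop x b)" for b
  have H: "total x \<pi> Gain n \<le> H (base (M n))" for n
    using inv[of n] by (simp add: referee_gen_def tally H_def)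
  have "mean x \<pi> (Neg i) \<ge> 0" for i
    using inv by (intro mean_nonneg_I) (auto simp: referee_gen_def tally)
  then have *: "(\<forall>i. mean x \<pi> (Pos i) \<ge> 0) \<and> mean x \<pi> Slack \<ge> 0 \<and> mean x \<pi> Gain > 0"
    using sat unfolding satisfies_game_cond by (auto simp: not_less[symmetric])
  then have mp: "mean x \<pi> d \<ge> 0" if "d \<in> insert Slack (range Pos)" for d
    using that by auto
  from * have mG: "mean x \<pi> Gain > 0" by simp
  obtain \<delta> :: real where \<delta>: "\<delta> > 0" and "eventually (\<lambda>n. total x \<pi> Gain n \<ge> \<delta> * n) sequentially"
    using mean_pos_D[OF mG] .
  then obtain n1 where n1: "\<And>n. n \<ge> n1 \<Longrightarrow> total x \<pi> Gain n \<ge> \<delta> * n"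
    by (auto simp: eventually_sequentially)
  \<comment> \<open>A bounded \<open>base\<close> would bound \<open>Gain\<close>, which grows at
    least like \<delta> n.\<close>
  have unbounded: "\<exists>m\<ge>n. base (M m) > b" for n b
  proof (rule ccontr)
    assume "\<not> ?thesis"
    then have le: "base (M m) \<le> b" if "m \<ge> n" for m using that by (auto simp: not_less)
    define h where "h = Max (H ` {..b})"
    obtain k :: nat where k: "k > \<bar>h\<bar> / \<delta>" using reals_Archimedean2 by blast
    define m where "m = max (max n n1) k"
    have "\<delta> * m \<le> total x \<pi> Gain m" using n1[of m] by (simp add: m_def)
    also have "\<dots> \<le> H (base (M m))" using H by simp
    also have "H (base (M m)) \<le> h" using le[of m] unfolding h_def m_def by (intro Max_ge) auto
    also have "real_of_int h < \<delta> * k" using k \<delta> by (simp add: field_simps)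
    also have "\<dots> \<le> \<delta> * m" using \<delta> by (simp add: m_def)
    finally show False by simp
  qed
  \<comment> \<open>Without a further return, the play either remains at \<open>Reset\<close> or
    leaves it for good, and in both cases \<open>base\<close> settles.\<close>
  have arrivals: "\<exists>m\<ge>n. \<pi> m \<noteq> Reset \<and> \<pi> (Suc m) = Reset" for n
  proof (rule ccontr)
    assume "\<not> ?thesis"
    then have none: "\<pi> m \<noteq> Reset \<Longrightarrow> \<pi> (Suc m) \<noteq> Reset" if "m \<ge> n" for m using that by auto
    have away: "\<pi> m' \<noteq> Reset" if "\<pi> m \<noteq> Reset" "m \<ge> n" "m' \<ge> m" for m m'
      using that(3)
    proof (induction rule: dec_induct)
      case (step k)
      then show ?case using none[of k] that(2) by simp
    qed (rule that(1))
    have stuck: "\<exists>m\<ge>n. \<forall>m'\<ge>m. base (M m') = base (M m)"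
    proof (cases "\<exists>m\<ge>n. \<pi> m \<noteq> Reset")
      case True
      then obtain m where m: "m \<ge> n" "\<pi> m \<noteq> Reset" by blast
      have "base (M m') = base (M m)" if "m' \<ge> m" for m'
        using that by (induction rule: dec_induct) (use away m in \<open>auto simp: M\<close>)
      with m show ?thesis by blast
    next
      case False
      have "base (M m') = base (M n)" if "m' \<ge> n" for m'
        using that
      proof (induction rule: dec_induct)
        case (step k)
        moreover have "\<pi> (Suc k) = Reset" using False step by auto
        ultimately show ?case by (simp add: M)
      qed simp
      then show ?thesis by blast
    qed
    then obtain m where "m \<ge> n" "\<forall>m'\<ge>m. base (M m') = base (M m)" by blast
    moreover obtain m' where "m' \<ge> m" "base (M m') > base (M m)" using unbounded by blast
    ultimately show False by (metis less_irrefl)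
  qed
  define S where "S = nat \<lceil>8 / \<delta>\<rceil>"
  \<comment> \<open>The deviation \<open>tol S * U / 4\<close> with U at least \<delta> t / 4
    amounts to \<open>tol S * \<delta> / 16\<close> per time unit; half of this rate suffices for
    the contradiction.\<close>
  define \<epsilon> where "\<epsilon> = tol S * \<delta> / 32"
  have \<epsilon>: "\<epsilon> > 0" using \<delta> tol_pos by (simp add: \<epsilon>_def)
  have "eventually (\<lambda>n. \<forall>d \<in> insert Slack (range Pos). total x \<pi> d n \<ge> - \<epsilon> * n) sequentially"
    by (intro eventually_ball_finite ballI mean_ge_zero_D mp \<epsilon>) auto
  then obtain n2 where n2: "\<And>n d. n \<ge> n2 \<Longrightarrow> d \<in> insert Slack (range Pos) \<Longrightarrow> total x \<pi> d n \<ge> - \<epsilon> * n"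
    unfolding eventually_sequentially by blast
  obtain n3 where n3: "base (M n3) > S" using unbounded by blast
  obtain m where m: "m \<ge> Max {n1, n2, n3}" "\<pi> m \<noteq> Reset" "\<pi> (Suc m) = Reset"
    using arrivals by blast
  define t where "t = Suc m"
  define U where "U = unit_of (M t)"
  have A: "U \<ge> 1" "steps (M t) * U \<le> 2 * t" "total x \<pi> Gain t \<le> 4 * U"
    "steps (M t) \<ge> base (M t) \<or> (\<exists>d \<in> insert Slack (range Pos). total x \<pi> d t \<le> - tol (steps (M t)) * U / 4)"
    using arr[OF m(2,3)] by (auto simp: arrival_def U_def t_def clock tally)
  have tU: "\<delta> * t \<le> 4 * U" using n1[of t] m A(3) by (simp add: t_def)
  have "\<delta> * (steps (M t) * U) \<le> \<delta> * (2 * t)" using A(2) \<delta> by (intro mult_left_mono) auto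
  also have "\<dots> \<le> 8 * U" using tU by simp
  finally have "\<delta> * steps (M t) \<le> 8" using A(1) by (simp add: mult.assoc[symmetric])
  then have "steps (M t) \<le> 8 / \<delta>" using \<delta> by (simp add: field_simps)
  then have sS: "steps (M t) \<le> S" unfolding S_def by linarith
  have "S < base (M t)" using n3 base_mono[of n3 t] m by (simp add: t_def)
  with A(4) sS obtain d where d: "d \<in> insert Slack (range Pos)"
    "total x \<pi> d t \<le> - tol (steps (M t)) * U / 4" by auto
  have "tol S \<le> tol (steps (M t))"
    using sS by (auto simp: tol_def intro!: divide_left_mono)
  then have "tol S * U \<le> tol (steps (M t)) * U" using A(1) by (intro mult_right_mono) auto
  then have "total x \<pi> d t \<le> - tol S * U / 4" using d(2) by simp
  moreover have "total x \<pi> d t \<ge> - \<epsilon> * t" using n2[of t d] d(1) m by (simp add: t_def)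
  ultimately have "tol S * U / 4 \<le> \<epsilon> * t" by simp
  also have "\<epsilon> * t = tol S * (\<delta> * t) / 32" by (simp add: \<epsilon>_def)
  also have "\<dots> \<le> tol S * (4 * U) / 32" using tU tol_pos[of S] by (intro divide_right_mono mult_left_mono) auto
  finally have "tol S * U \<le> 0" by (simp add: mult.commute)
  then show False using tol_pos[of S] A(1) by (simp add: mult_le_0_iff)
qed

theorem not_player1_wins:
  fixes T :: "'q trans set"
  assumes T: "finite T" and rej: "\<not> accepts T q0 qf x"
  shows "\<not> player1_wins (machine_game T q0 qf) (wvec x) Reset game_cond"
proof
  assume "player1_wins (machine_game T q0 qf) (wvec x) Reset game_cond"
  then obtain \<tau> where \<tau>: "is_strategy1 (machine_game T q0 qf) \<tau>"
    and win: "\<And>\<pi>. is_play (machine_game T q0 qf) Reset \<pi> \<Longrightarrow> consistent1 (machine_game T q0 qf) \<tau> \<pi> \<Longrightarrow>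
      satisfies (wvec x) \<pi> game_cond"
    unfolding player1_wins_def winning_strategy1_def by blast
  have act: "(v, referee_act q0 x m v) \<in> edges (machine_game T q0 qf)"
    if "v \<in> verts2 (machine_game T q0 qf)" for v m
    using that by (simp add: referee_act_edge)
  have v0: "Reset \<in> verts (machine_game T q0 qf)" by (simp add: machine_game_def vertices1_def)
  obtain \<pi> M where *: "is_play (machine_game T q0 qf) Reset \<pi>" "consistent1 (machine_game T q0 qf) \<tau> \<pi>"
    "M 0 = Referee 0 (\<lambda>_. 0) 0 0" "\<And>n. M (Suc n) = referee_upd x (M n) (\<pi> n) (\<pi> (Suc n))"
    "\<And>n. \<pi> n \<in> verts2 (machine_game T q0 qf) \<Longrightarrow> \<pi> (Suc n) = referee_act q0 x (M n) (\<pi> n)"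
    by (rule memory_play[OF is_game_graph_machine_game[OF T] \<tau> v0, where act = "referee_act q0 x"
          and upd = "referee_upd x" and ?m0.0 = "Referee 0 (\<lambda>_. 0) 0 0"]) (use act in blast)+
  have "\<not> satisfies (wvec x) \<pi> game_cond"
    by (rule referee_wins[OF rej, of \<pi> M]) (use * in \<open>auto simp: is_play_def\<close>)
  with win * show False by blast
qed

section \<open>Player 1 wins if the machine halts\<close>

text \<open>A strategy sees nothing but the history, so the memory state is recomputed by folding
  \<open>upd\<close> over its edges. Where the rule proposes a non-edge some successor is chosen,
  which makes \<tau> a strategy for every \<open>act\<close>.\<close>

lemma memory_strategy:
  fixes upd :: "'m \<Rightarrow> 'v \<Rightarrow> 'v \<Rightarrow> 'm"
  assumes G: "is_game_graph G"
  obtains \<tau> where "is_strategy1 G \<tau>"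
    "\<And>\<pi>. consistent1 G \<tau> \<pi> \<Longrightarrow> \<exists>M. M 0 = m0 \<and> (\<forall>n. M (Suc n) = upd (M n) (\<pi> n) (\<pi> (Suc n))) \<and>
        (\<forall>n. \<pi> n \<in> verts1 G \<longrightarrow> (\<pi> n, act (M n) (\<pi> n)) \<in> edges G \<longrightarrow> \<pi> (Suc n) = act (M n) (\<pi> n))"
proof -
  define mem where "mem h = fold (\<lambda>(u, v) m. upd m u v) (zip h (tl h)) m0" for h
  define \<tau> where "\<tau> h = (if (last h, act (mem h) (last h)) \<in> edges G then act (mem h) (last h)
     else (SOME u. (last h, u) \<in> edges G))" for h
  have "is_strategy1 G \<tau>"
    unfolding is_strategy1_def
  proof (intro allI impI)
    fix h v assume "v \<in> verts1 G"
    then have "\<exists>u. (v, u) \<in> edges G" using G by (auto simp: is_game_graph_def)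
    then show "(v, \<tau> (h @ [v])) \<in> edges G" by (auto simp: \<tau>_def intro: someI_ex)
  qed
  moreover have "\<exists>M. M 0 = m0 \<and> (\<forall>n. M (Suc n) = upd (M n) (\<pi> n) (\<pi> (Suc n))) \<and>
        (\<forall>n. \<pi> n \<in> verts1 G \<longrightarrow> (\<pi> n, act (M n) (\<pi> n)) \<in> edges G \<longrightarrow> \<pi> (Suc n) = act (M n) (\<pi> n))"
    if con: "consistent1 G \<tau> \<pi>" for \<pi>
  proof (intro exI[of _ "\<lambda>n. mem (map \<pi> [0..<Suc n])"] conjI allI impI)
    have zip: "zip (map \<pi> [0..<Suc n]) (tl (map \<pi> [0..<Suc n])) = map (\<lambda>k. (\<pi> k, \<pi> (Suc k))) [0..<n]" for n
      by (rule nth_equalityI) (auto simp: nth_tl simp del: upt_Suc)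
    show "mem (map \<pi> [0..<Suc 0]) = m0" by (simp add: mem_def)
    show "mem (map \<pi> [0..<Suc (Suc n)]) = upd (mem (map \<pi> [0..<Suc n])) (\<pi> n) (\<pi> (Suc n))" for n
      unfolding mem_def zip by simp
    show "\<pi> (Suc n) = act (mem (map \<pi> [0..<Suc n])) (\<pi> n)"
      if "\<pi> n \<in> verts1 G" "(\<pi> n, act (mem (map \<pi> [0..<Suc n])) (\<pi> n)) \<in> edges G" for n
      using that con by (simp add: consistent1_def \<tau>_def)
  qed
  ultimately show ?thesis by (rule that)
qed

fun run :: "'q trans set \<Rightarrow> 'q \<Rightarrow> 'q \<Rightarrow> (bool \<Rightarrow> nat) \<Rightarrow> 'q trans list \<Rightarrow> bool" where
  "run T qf q c [] \<longleftrightarrow> q = qf"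
| "run T qf q c (t # ts) \<longleftrightarrow> t \<in> T \<and> fst t = q \<and>
     (\<exists>c'. op_step (fst (snd t)) c c' \<and> run T qf (snd (snd t)) c' ts)"

lemma reaches_imp_run: "reaches T q c qf c' \<Longrightarrow> \<exists>ts. run T qf q c ts"
proof (induction rule: reaches.induct)
  case (refl q c)
  have "run T q q c []" by simp
  then show ?case by blast
next
  case (step q o1 q' c c' q'' c'')
  then obtain ts where "run T q'' q' c' ts" by blast
  with step have "run T q'' q c ((q, o1, q') # ts)" by auto
  then show ?case by blast
qed

section \<open>The pilot: player 1's strategy along a halting run\<close>

datatype 'q pilot =
  Pilot (elapsed: nat) (account: "dim \<Rightarrow> int") (unit_size: nat) (todo: "'q trans list") (laps: nat)

definition pilot_upd ::
    "'q trans list \<Rightarrow> nat \<Rightarrow> 'q pilot \<Rightarrow> 'q vertex \<Rightarrow> 'q vertex \<Rightarrow> 'q pilot" where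
  "pilot_upd ts0 x m u v = Pilot (Suc (elapsed m)) (\<lambda>d. account m d + wt x (u, v) d)
     (if v = Scale then if u = Scale then Suc (unit_size m) else 0 else unit_size m)
     (case u of Scale \<Rightarrow> ts0 | Claim t b \<Rightarrow> tl (todo m) | _ \<Rightarrow> todo m)
     (case u of State q b \<Rightarrow> 0 | Loop t b \<Rightarrow> (if v = Check t b then Suc (laps m) else laps m) | _ \<Rightarrow> laps m)"

text \<open>At \<open>Reset\<close>, \<open>Slack\<close> is raised not only to 0 but to every
  \<open>Neg i\<close>, so that residues of earlier rounds cannot spoil the comparison of
  \<open>Neg i\<close> and \<open>Slack\<close> in the next one. The condition on
  \<open>flip\<close> singles out \<open>Inc\<close> and \<open>Dec\<close>, the instructions that
  need traversals.\<close>

definition pilot_act :: "'q pilot \<Rightarrow> 'q vertex \<Rightarrow> 'q vertex" where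
  "pilot_act m v = (case v of
       Reset \<Rightarrow> if account m Slack < 0 \<or> (\<exists>i. account m (Neg i) > account m Slack) then Reset else Scale
     | State q b \<Rightarrow> (case todo m of [] \<Rightarrow> Reset | t # _ \<Rightarrow> Loop t b)
     | Loop t b \<Rightarrow> if laps m < unit_size m \<and> flip (fst (snd t)) b \<noteq> b then Check t b else Claim t b
     | _ \<Rightarrow> Reset)"

lemma pilot_sel [simp]:
  "elapsed (pilot_upd ts0 x m u v) = Suc (elapsed m)"
  "account (pilot_upd ts0 x m u v) d = account m d + wt x (u, v) d"
  "unit_size (pilot_upd ts0 x m u v) = (if v = Scale then if u = Scale then Suc (unit_size m) else 0 else unit_size m)"
  "todo (pilot_upd ts0 x m u v) = (case u of Scale \<Rightarrow> ts0 | Claim t b \<Rightarrow> tl (todo m) | _ \<Rightarrow> todo m)"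
  "laps (pilot_upd ts0 x m u v) =
     (case u of State q b \<Rightarrow> 0 | Loop t b \<Rightarrow> (if v = Check t b then Suc (laps m) else laps m) | _ \<Rightarrow> laps m)"
  by (simp_all add: pilot_upd_def)

text \<open>The counter contents that player 1 intends, in units of the current scale.\<close>
fun level :: "(bool \<Rightarrow> nat) \<Rightarrow> bool \<Rightarrow> nat \<Rightarrow> cnt \<Rightarrow> int" where
  "level c b K (Cnt i) = int (c i * K)"
| "level c b K (Unit b') = (if b' = b then int K else 0)"

text \<open>\<open>Slack\<close> may become negative only in the company of some
  \<open>Neg i\<close> that is no larger: either that dimension wins the game, or it keeps
  \<open>Slack\<close> from having a negative limit inferior.\<close>

definition safe :: "'q pilot \<Rightarrow> bool" where
  "safe m \<longleftrightarrow> (\<forall>i. account m (Pos i) \<ge> 0) \<and> (account m Slack \<ge> 0 \<or> (\<exists>i. account m Slack \<ge> account m (Neg i)))"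

text \<open>The last two conditions also charge the ticks that the loop at \<open>Reset\<close>
  still needs, at one unit of \<open>Slack\<close> each, until \<open>Slack\<close> is nonnegative
  and no \<open>Neg i\<close> exceeds it. \<open>e\<close> reserves time for edges without
  gain.\<close>

definition paid :: "nat \<Rightarrow> int \<Rightarrow> 'q pilot \<Rightarrow> bool" where
  "paid C e m \<longleftrightarrow> int (elapsed m) + e \<le> int C * account m Gain \<and>
     int (elapsed m) + e - account m Slack \<le> int C * account m Gain \<and>
     (\<forall>i. int (elapsed m) + e + account m (Neg i) - account m Slack \<le> int C * account m Gain)"

text \<open>One-sided bounds suffice: player 1 never removes the residues of earlier rounds, and a
  surplus in \<open>Pos\<close> or a deficit in \<open>Neg\<close> does him no harm.\<close>

definition covers :: "'q pilot \<Rightarrow> (cnt \<Rightarrow> int) \<Rightarrow> bool" where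
  "covers m l \<longleftrightarrow> account m Slack \<ge> 0 \<and>
     (\<forall>i. l i \<ge> 0 \<and> account m (Pos i) \<ge> l i \<and> account m (Neg i) \<le> account m Slack + l i)"

text \<open>With \<open>n\<close> the input plus the length of the run, a round takes at most
  \<open>K + 2\<close> ticks and \<open>2 * K + 4\<close> more per transition, and the refill of
  \<open>Slack\<close> caused by its counters at most \<open>(n + 2) * K\<close>. Scaling earns
  \<open>1 + K\<close>, so the factor 10 is generous.\<close>

definition cost :: "nat \<Rightarrow> nat" where
  "cost n = 10 * (n + 2)"

text \<open>The time of a simulation is charged to the gain collected while scaling; \<open>e\<close> is the time
  already spent on the current transition.\<close>
definition budget :: "nat \<Rightarrow> 'q trans list \<Rightarrow> 'q pilot \<Rightarrow> nat \<Rightarrow> bool" where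
  "budget x ts0 m e \<longleftrightarrow>
     int (elapsed m) + int (length (todo m) * (2 * unit_size m + 4)) \<le>
       int (cost (x + length ts0)) * (account m Gain - 1 - int (unit_size m)) +
       int (unit_size m + 2 + length ts0 * (2 * unit_size m + 4)) + int e"

definition pilot_inv :: "'q trans set \<Rightarrow> 'q \<Rightarrow> nat \<Rightarrow> 'q trans list \<Rightarrow> 'q vertex \<Rightarrow> 'q pilot \<Rightarrow> bool" where
  "pilot_inv T qf x ts0 v m \<longleftrightarrow> (case v of
       Reset \<Rightarrow> safe m \<and> paid (cost (x + length ts0)) 0 m
     | Blame i \<Rightarrow> safe m \<and> account m Slack \<ge> account m (Neg i) \<and> paid (cost (x + length ts0)) 1 m
     | Scale \<Rightarrow> covers m (level (start_counters x) False (unit_size m)) \<and>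
         int (elapsed m) \<le> int (cost (x + length ts0)) * (account m Gain - 1 - int (unit_size m)) + int (unit_size m) + 1
     | State q b \<Rightarrow> (\<exists>c. run T qf q c (todo m) \<and> (\<forall>i. c i + length (todo m) \<le> x + length ts0) \<and>
         covers m (level c b (unit_size m)) \<and> budget x ts0 m 0)
     | Loop t b \<Rightarrow> todo m \<noteq> [] \<and> t = hd (todo m) \<and> laps m \<le> unit_size m \<and> (flip (fst (snd t)) b = b \<longrightarrow> laps m = 0) \<and>
         (\<exists>c. run T qf (fst t) c (todo m) \<and> (\<forall>i. c i + length (todo m) \<le> x + length ts0) \<and>
           covers m (\<lambda>j. level c b (unit_size m) j + int (laps m) * effect (fst (snd t)) b j) \<and> budget x ts0 m (1 + 2 * laps m))
     | Check t b \<Rightarrow> todo m \<noteq> [] \<and> t = hd (todo m) \<and> laps m \<le> unit_size m \<and> (flip (fst (snd t)) b = b \<longrightarrow> laps m = 0) \<and>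
         (\<exists>c. run T qf (fst t) c (todo m) \<and> (\<forall>i. c i + length (todo m) \<le> x + length ts0) \<and>
           covers m (\<lambda>j. level c b (unit_size m) j + int (laps m) * effect (fst (snd t)) b j) \<and> budget x ts0 m (2 * laps m))
     | Claim t b \<Rightarrow> todo m \<noteq> [] \<and> t = hd (todo m) \<and> laps m \<le> unit_size m \<and>
         (if flip (fst (snd t)) b = b then laps m = 0 else laps m = unit_size m) \<and>
         (\<exists>c. run T qf (fst t) c (todo m) \<and> (\<forall>i. c i + length (todo m) \<le> x + length ts0) \<and>
           covers m (\<lambda>j. level c b (unit_size m) j + int (laps m) * effect (fst (snd t)) b j) \<and> budget x ts0 m (2 + 2 * laps m)))"

lemma covers_safe: "covers m l \<Longrightarrow> safe m"
  unfolding covers_def safe_def by (meson order_trans)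

lemma level_le:
  assumes "\<forall>i. c i + n \<le> y"
  shows "level c b K j \<le> int ((y + 1) * K)"
proof (cases j)
  case (Cnt i)
  have "c i * K \<le> (y + 1) * K" using assms[rule_format, of i] by (intro mult_le_mono) auto
  then have "int (c i * K) \<le> int ((y + 1) * K)" by (rule of_nat_mono)
  then show ?thesis using Cnt by simp
qed (simp add: algebra_simps)

text \<open>Player 2 may break off a round while its counters are full. \<open>l i\<close> bounds
  the excess of \<open>Neg i\<close> over \<open>Slack\<close> at that moment, hence the refill; the
  gain \<open>1 + K\<close> of the round, times \<open>cost\<close>, covers the simulation, this
  refill and one reserved tick.\<close>

lemma budget_paid:
  assumes "covers m l" "\<And>i. l i \<le> int ((x + length ts0 + 2) * unit_size m)"
    "budget x ts0 m (2 * unit_size m + 4)"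
  shows "paid (cost (x + length ts0)) 1 m"
proof -
  define n K G where "n = int (length ts0)" and "K = int (unit_size m)" and "G = account m Gain"
  define C where "C = int (cost (x + length ts0))"
  have pos: "n \<ge> 0" "K \<ge> 0" "n * K \<ge> 0" "int x * K \<ge> 0" by (simp_all add: n_def K_def)
  have C: "C = 10 * (int x + n + 2)" by (simp add: C_def cost_def n_def)
  have "int (elapsed m) \<le> C * (G - 1 - K) + (K + 2 + n * (2 * K + 4)) + (2 * K + 4)"
    using assms(3) of_nat_0_le_iff[of "length (todo m) * (2 * unit_size m + 4)", where 'a = int]
    unfolding budget_def C_def n_def K_def G_def by (simp only: of_nat_add of_nat_mult of_nat_numeral)
  moreover have "C * (G - 1 - K) + (K + 2 + n * (2 * K + 4)) + (2 * K + 4) + 1 + (int x + n + 2) * K \<le> C * G"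
    unfolding C using pos by (simp add: algebra_simps)
  ultimately have t: "int (elapsed m) + 1 + (int x + n + 2) * K \<le> C * G" by linarith
  moreover have "(int x + n + 2) * K \<ge> 0" using pos by simp
  moreover have "l i \<le> (int x + n + 2) * K" for i
    using assms(2)[of i] by (simp add: n_def K_def algebra_simps)
  ultimately show ?thesis
    using assms(1) unfolding paid_def covers_def C_def[symmetric] G_def[symmetric] by (smt (verit))
qed

lemma paid_mono: "paid C 1 m \<Longrightarrow> paid C 0 m"
  unfolding paid_def by (smt (verit))

text \<open>Whatever decreases starts with at least \<open>K\<close>: the current unit counter by
  definition, and the counter of a \<open>Dec\<close> because the step is enabled.\<close>

lemma level_effect_nonneg:
  assumes "op_step o1 c c'" "k \<le> K"
  shows "level c b K j + int k * effect o1 b j \<ge> 0"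
proof -
  have dec: "int k \<le> int (c i) * int K" if "o1 = Dec i" for i
  proof -
    have "1 * k \<le> c i * K" using assms that by (intro mult_le_mono) auto
    then show ?thesis by (simp flip: of_nat_mult)
  qed
  show ?thesis
    using assms dec by (cases o1; cases j) auto
qed

lemma level_step:
  assumes "op_step o1 c c'"
  shows "level c' (flip o1 b) K j = level c b K j + int (if flip o1 b = b then 0 else K) * effect o1 b j"
proof -
  have dec: "int (c i - Suc 0) * int K = int (c i) * int K - int K" if "o1 = Dec i" for i
    using assms that by (simp add: of_nat_diff left_diff_distrib)
  show ?thesis
    using assms dec by (cases o1; cases j) (auto simp: algebra_simps)
qed

text \<open>Truthful claims concern counters of level 0. By \<open>covers\<close>, a blame then
  starts with \<open>Neg i \<le> Slack\<close>, and both fall together.\<close>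

lemma level_claimed:
  assumes "op_step o1 c c'"
  shows "level c b K (claimed o1 b) + int (if flip o1 b = b then 0 else K) * effect o1 b (claimed o1 b) = 0"
  using assms by (cases o1) auto

lemma covers_cong: "account m' = account m \<Longrightarrow> covers m' l = covers m l"
  by (simp add: covers_def)

lemma pilot_step:
  assumes inv: "pilot_inv T qf x ts0 u m" and edge: "edge T q0 qf u v"
    and act: "u \<in> vertices1 T q0 qf \<Longrightarrow> edge T q0 qf u (pilot_act m u) \<Longrightarrow> v = pilot_act m u"
    and run0: "run T qf q0 (start_counters x) ts0"
    and m': "m' = pilot_upd ts0 x m u v"
  shows "pilot_inv T qf x ts0 v m'"
proof -
  let ?C = "cost (x + length ts0)" and ?y = "x + length ts0"
  have C2: "int ?C \<ge> 2" by (simp add: cost_def)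
  have bound: "level c b (unit_size m) i + int (laps m) * effect o1 b i \<le> int ((?y + 2) * unit_size m)"
    if "\<forall>i. c i + n \<le> ?y" "laps m \<le> unit_size m" for c n b i o1
  proof -
    have "effect o1 b i \<le> 1" by (cases o1) auto
    then have "int (laps m) * effect o1 b i \<le> int (laps m) * 1"
      by (intro mult_left_mono) auto
    with that(2) have "int (laps m) * effect o1 b i \<le> int (unit_size m)" by simp
    then show ?thesis using level_le[OF that(1), of b "unit_size m" i] by (simp add: algebra_simps)
  qed
  from edge show ?thesis
  proof (cases rule: edge.cases)
    case Reset_Reset
    have u1: "u \<in> vertices1 T q0 qf" using Reset_Reset by (simp add: vertices1_def)
    have "account m Slack < 0 \<or> (\<exists>i. account m (Neg i) > account m Slack)"
    proof -
      have "edge T q0 qf u (pilot_act m u)"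
        using Reset_Reset by (auto simp: pilot_act_def intro: edge.intros)
      from act[OF u1 this] show ?thesis
        using Reset_Reset by (auto simp: pilot_act_def split: if_splits)
    qed
    moreover have I: "safe m" "paid ?C 0 m" using inv Reset_Reset by (auto simp: pilot_inv_def)
    \<comment> \<open>The time bound of \<open>paid\<close> leaves no room for another tick; the
      strict excess of \<open>Neg i\<close> over \<open>Slack\<close>, or below a negative
      \<open>Slack\<close>, supplies it.\<close>
    moreover have "int (elapsed m) + 1 \<le> int ?C * account m Gain" if "account m (Neg i) > account m Slack" for i
    proof -
      have "int (elapsed m) + 0 + account m (Neg i) - account m Slack \<le> int ?C * account m Gain"
        using I(2) by (simp add: paid_def)
      with that show ?thesis by linarith
    qed
    moreover have "int (elapsed m) + 1 \<le> int ?C * account m Gain" if "account m Slack < 0"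
      using I(2) that unfolding paid_def by linarith
    ultimately have "int (elapsed m) + 1 \<le> int ?C * account m Gain" by blast
    then have "paid ?C 0 m'" using I(2) Reset_Reset by (auto simp: paid_def m' add_diff_eq)
    moreover have "safe m'"
    proof -
      have "account m' (Pos i) = account m (Pos i)" "account m' (Neg i) = account m (Neg i)"
        "account m' Slack = account m Slack + 1" for i
        using Reset_Reset by (simp_all add: m')
      then show ?thesis using I(1) unfolding safe_def
        by (metis add_increasing2 zero_le_one order_trans less_add_one less_imp_le)
    qed
    ultimately show ?thesis using Reset_Reset by (simp add: pilot_inv_def)
  next
    case Reset_Scale
    have u1: "u \<in> vertices1 T q0 qf" using Reset_Scale by (simp add: vertices1_def)
    have *: "account m Slack \<ge> 0" "\<And>i. account m (Neg i) \<le> account m Slack"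
    proof -
      have "edge T q0 qf u (pilot_act m u)"
        using Reset_Scale by (auto simp: pilot_act_def intro: edge.intros)
      from act[OF u1 this] show "account m Slack \<ge> 0" "\<And>i. account m (Neg i) \<le> account m Slack"
        using Reset_Scale by (auto simp: pilot_act_def not_less split: if_splits)
    qed
    have I: "safe m" "paid ?C 0 m" using inv Reset_Scale by (auto simp: pilot_inv_def)
    have "level c b 0 i = 0" for c b i by (cases i) auto
    with * I show ?thesis
      using Reset_Scale by (auto simp: pilot_inv_def m' covers_def safe_def paid_def)
  next
    case Scale_Scale
    have I: "covers m (level (start_counters x) False (unit_size m))"
      "int (elapsed m) \<le> int ?C * (account m Gain - 1 - int (unit_size m)) + int (unit_size m) + 1"
      using inv Scale_Scale by (auto simp: pilot_inv_def)
    have lv: "level (start_counters x) False (Suc K) i = level (start_counters x) False K i + unit_vec x i" for K i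
      by (cases i) (auto simp: start_counters_def)
    have "unit_vec x i \<ge> 0" for i by (cases i) auto
    then show ?thesis
      using I Scale_Scale by (simp add: pilot_inv_def m' covers_def lv algebra_simps)
  next
    case Scale_State
    have I: "covers m (level (start_counters x) False (unit_size m))"
      "int (elapsed m) \<le> int ?C * (account m Gain - 1 - int (unit_size m)) + int (unit_size m) + 1"
      using inv Scale_State by (auto simp: pilot_inv_def)
    have "account m' = account m" using Scale_State by (auto simp: m')
    then have "covers m' (level (start_counters x) False (unit_size m'))"
      using I(1) Scale_State covers_cong[of m' m] by (simp add: m')
    moreover have "\<forall>i. start_counters x i + length ts0 \<le> ?y" by (simp add: start_counters_def)
    ultimately show ?thesis
      using run0 I(2) Scale_State by (auto simp: pilot_inv_def m' budget_def intro!: exI[of _ "start_counters x"])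
  next
    case (Blame_Blame i)
    have I: "safe m" "account m Slack \<ge> account m (Neg i)" "paid ?C 1 m"
      using inv Blame_Blame by (auto simp: pilot_inv_def)
    \<comment> \<open>A blame costs one tick now and one later to restore \<open>Slack\<close>,
      against one unit of gain worth \<open>?C \<ge> 2\<close>.\<close>
    have "int ?C * (account m Gain + 1) \<ge> int ?C * account m Gain + 2" using C2 by (simp add: algebra_simps)
    moreover have "int (elapsed m) + 1 + account m (Neg j) - account m Slack \<le> int ?C * account m Gain" for j
      using I(3) by (simp add: paid_def)
    then have "account m (Neg j) \<le> int ?C * account m Gain - int (elapsed m) - 1 + account m Slack" for j
      by (simp add: algebra_simps)
    ultimately have "paid ?C 1 m'" using I(3) Blame_Blame unfolding paid_def
      by (simp add: m') (smt (verit))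
    moreover have "safe m'" using I(1,2) Blame_Blame by (auto simp: safe_def m')
    ultimately show ?thesis using I(2) Blame_Blame by (simp add: pilot_inv_def m')
  next
    case (Blame_Reset i)
    have I: "safe m" "account m Slack \<ge> account m (Neg i)" "paid ?C 1 m"
      using inv Blame_Reset by (auto simp: pilot_inv_def)
    have tl: "account m' = account m" using Blame_Reset by (auto simp: m')
    have "paid ?C 0 m'" using I(3) tl Blame_Reset by (auto simp: paid_def m' add_ac)
    moreover have "safe m'" using I(1) tl by (simp add: safe_def)
    ultimately show ?thesis using Blame_Reset by (simp add: pilot_inv_def)
  next
    case (State_State q b)
    have u1: "u \<in> vertices1 T q0 qf" using State_State by (auto simp: vertices1_def)
    obtain c where "run T qf q c (todo m)" using inv State_State by (auto simp: pilot_inv_def)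
    \<comment> \<open>If transitions are left, the next one is an edge; if none is left, the state
      is \<open>qf\<close> and leads to \<open>Reset\<close>. So the loop at \<open>State\<close> is
      never taken.\<close>
    then have "edge T q0 qf u (pilot_act m u)"
      using State_State by (cases "todo m") (auto simp: pilot_act_def intro: edge.intros)
    from act[OF u1 this] show ?thesis
      using State_State by (simp add: pilot_act_def split: list.splits)
  next
    case (State_Reset b)
    obtain c where c: "\<forall>i. c i + length (todo m) \<le> ?y" "covers m (level c b (unit_size m))" "budget x ts0 m 0"
      using inv State_Reset by (auto simp: pilot_inv_def)
    have tl: "account m' = account m" using State_Reset by (auto simp: m')
    have cov: "covers m' (level c b (unit_size m))" using c(2) covers_cong[OF tl] by simp
    have "budget x ts0 m' (2 * unit_size m' + 4)"
      using c(3) State_Reset by (auto simp: budget_def m')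
    moreover have "level c b (unit_size m) i \<le> int ((?y + 2) * unit_size m')" for i
      using level_le[OF c(1), of b "unit_size m" i] State_Reset by (simp add: m' algebra_simps)
    ultimately have "paid ?C 1 m'" using budget_paid[OF cov] State_Reset by (simp add: m')
    then show ?thesis using paid_mono covers_safe[OF cov] State_Reset by (simp add: pilot_inv_def)
  next
    case (State_Loop q o1 q' b)
    have u1: "u \<in> vertices1 T q0 qf" 
    proof -
      have "q \<in> states T q0 qf" using State_Loop(3) by (force simp: states_def)
      then have "State q b \<in> case_prod State ` (states T q0 qf \<times> UNIV)" by force
      then show ?thesis using State_Loop(1) by (simp add: vertices1_def)
    qed
    obtain c where c: "run T qf q c (todo m)" "\<forall>i. c i + length (todo m) \<le> ?y"
        "covers m (level c b (unit_size m))" "budget x ts0 m 0"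
      using inv State_Loop by (auto simp: pilot_inv_def)
    have "edge T q0 qf u (pilot_act m u)"
      using c(1) State_Loop by (cases "todo m") (auto simp: pilot_act_def intro: edge.intros)
    from act[OF u1 this] have v: "todo m \<noteq> []" "hd (todo m) = (q, o1, q')"
      using State_Loop by (auto simp: pilot_act_def split: list.splits)
    have "account m' = account m" using State_Loop by (auto simp: m')
    then have "covers m' (level c b (unit_size m))" using c(3) covers_cong by blast
    then show ?thesis using c(1,2,4) v State_Loop
      by (auto simp: pilot_inv_def m' budget_def intro!: exI[of _ c])
  next
    case (Loop_Check e b)
    have u1: "u \<in> vertices1 T q0 qf" using Loop_Check by (force simp: vertices1_def)
    have "edge T q0 qf u (pilot_act m u)"
      using Loop_Check by (auto simp: pilot_act_def intro: edge.intros)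
    from act[OF u1 this] have v: "laps m < unit_size m" "flip (fst (snd e)) b \<noteq> b"
      using Loop_Check by (auto simp: pilot_act_def split: if_splits)
    obtain c where c: "todo m \<noteq> []" "e = hd (todo m)" "run T qf (fst e) c (todo m)" "\<forall>i. c i + length (todo m) \<le> ?y"
        "covers m (\<lambda>j. level c b (unit_size m) j + int (laps m) * effect (fst (snd e)) b j)" "budget x ts0 m (1 + 2 * laps m)"
      using inv Loop_Check by (auto simp: pilot_inv_def)
    obtain c' where step: "op_step (fst (snd e)) c c'" using c(1-3) by (cases "todo m") auto
    have "covers m' (\<lambda>j. level c b (unit_size m) j + int (Suc (laps m)) * effect (fst (snd e)) b j)"
      using c(5) level_effect_nonneg[OF step, of "Suc (laps m)" "unit_size m" b] v(1) Loop_Check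
      by (auto simp: covers_def m' algebra_simps)
    moreover have "budget x ts0 m' (2 * Suc (laps m))"
      using c(6) Loop_Check by (simp add: budget_def m')
    ultimately show ?thesis using c(1-4) v Loop_Check
      unfolding pilot_inv_def by (auto simp: m' intro!: exI[of _ c])
  next
    case (Loop_Claim e b)
    have u1: "u \<in> vertices1 T q0 qf" using Loop_Claim by (force simp: vertices1_def)
    have "edge T q0 qf u (pilot_act m u)"
      using Loop_Claim by (auto simp: pilot_act_def intro: edge.intros)
    from act[OF u1 this] have v: "laps m \<ge> unit_size m \<or> flip (fst (snd e)) b = b"
      using Loop_Claim by (auto simp: pilot_act_def split: if_splits)
    obtain c where c: "todo m \<noteq> []" "e = hd (todo m)" "run T qf (fst e) c (todo m)" "\<forall>i. c i + length (todo m) \<le> ?y"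
        "covers m (\<lambda>j. level c b (unit_size m) j + int (laps m) * effect (fst (snd e)) b j)" "budget x ts0 m (1 + 2 * laps m)"
        "laps m \<le> unit_size m" "flip (fst (snd e)) b = b \<longrightarrow> laps m = 0"
      using inv Loop_Claim by (auto simp: pilot_inv_def)
    have "account m' = account m" using Loop_Claim by (auto simp: m')
    then have "covers m' (\<lambda>j. level c b (unit_size m) j + int (laps m) * effect (fst (snd e)) b j)"
      using c(5) covers_cong by blast
    moreover have "budget x ts0 m' (2 + 2 * laps m)"
      using c(6) Loop_Claim by (simp add: budget_def m')
    ultimately show ?thesis using c(1-4,7,8) v Loop_Claim
      unfolding pilot_inv_def by (auto simp: m' intro!: exI[of _ c])
  next
    case (Check_Loop e b)
    obtain c where c: "todo m \<noteq> []" "e = hd (todo m)" "run T qf (fst e) c (todo m)" "\<forall>i. c i + length (todo m) \<le> ?y"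
        "covers m (\<lambda>j. level c b (unit_size m) j + int (laps m) * effect (fst (snd e)) b j)" "budget x ts0 m (2 * laps m)"
        "laps m \<le> unit_size m" "flip (fst (snd e)) b = b \<longrightarrow> laps m = 0"
      using inv Check_Loop by (auto simp: pilot_inv_def)
    have "account m' = account m" using Check_Loop by (auto simp: m')
    then have "covers m' (\<lambda>j. level c b (unit_size m) j + int (laps m) * effect (fst (snd e)) b j)"
      using c(5) covers_cong by blast
    moreover have "budget x ts0 m' (1 + 2 * laps m)"
      using c(6) Check_Loop by (simp add: budget_def m')
    ultimately show ?thesis using c(1-4,7,8) Check_Loop
      unfolding pilot_inv_def by (auto simp: m' intro!: exI[of _ c])
  next
    case (Check_Reset e b)
    obtain c where c: "\<forall>i. c i + length (todo m) \<le> ?y"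
        "covers m (\<lambda>j. level c b (unit_size m) j + int (laps m) * effect (fst (snd e)) b j)" "budget x ts0 m (2 * laps m)"
        "laps m \<le> unit_size m"
      using inv Check_Reset by (auto simp: pilot_inv_def)
    have tl: "account m' = account m" using Check_Reset by (auto simp: m')
    have cov: "covers m' (\<lambda>j. level c b (unit_size m) j + int (laps m) * effect (fst (snd e)) b j)"
      using c(2) covers_cong[OF tl] by simp
    have "budget x ts0 m' (2 * unit_size m' + 4)"
      using c(3,4) Check_Reset by (auto simp: budget_def m')
    then have "paid ?C 1 m'" using budget_paid[OF cov] bound[OF c(1,4)] Check_Reset by (simp add: m')
    then show ?thesis using paid_mono covers_safe[OF cov] Check_Reset by (simp add: pilot_inv_def)
  next
    case (Claim_State q o1 q' b)
    obtain c where c: "todo m \<noteq> []" "(q, o1, q') = hd (todo m)" "run T qf q c (todo m)" "\<forall>i. c i + length (todo m) \<le> ?y"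
        "covers m (\<lambda>j. level c b (unit_size m) j + int (laps m) * effect o1 b j)" "budget x ts0 m (2 + 2 * laps m)"
        "laps m \<le> unit_size m" "laps m = (if flip o1 b = b then 0 else unit_size m)"
      using inv Claim_State by (auto simp: pilot_inv_def split: if_splits)
    obtain ts where ts: "todo m = (q, o1, q') # ts" using c(1,2) by (cases "todo m") auto
    obtain c' where step: "op_step o1 c c'" "run T qf q' c' ts" using c(3) ts by auto
    have tl: "account m' = account m" using Claim_State by (auto simp: m')
    have "c' i \<le> Suc (c i)" for i using step(1) by (cases o1) auto
    moreover have "Suc (c i) + length ts \<le> ?y" for i using c(4)[rule_format, of i] ts by simp
    ultimately have "\<forall>i. c' i + length ts \<le> ?y" by (meson add_le_mono1 order_trans)
    moreover have "covers m' (level c' (flip o1 b) (unit_size m))"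
      using c(5) covers_cong[OF tl] unfolding c(8) level_step[OF step(1), symmetric] by simp
    moreover have "budget x ts0 m' 0"
      using c(6,7) ts Claim_State by (simp add: budget_def m' algebra_simps)
    ultimately show ?thesis using step(2) ts Claim_State by (auto simp: pilot_inv_def m')
  next
    case (Claim_Blame q o1 q' b)
    obtain c where c: "todo m \<noteq> []" "(q, o1, q') = hd (todo m)" "run T qf q c (todo m)" "\<forall>i. c i + length (todo m) \<le> ?y"
        "covers m (\<lambda>j. level c b (unit_size m) j + int (laps m) * effect o1 b j)" "budget x ts0 m (2 + 2 * laps m)"
        "laps m \<le> unit_size m" "laps m = (if flip o1 b = b then 0 else unit_size m)"
      using inv Claim_Blame by (auto simp: pilot_inv_def split: if_splits)
    obtain c' where step: "op_step o1 c c'" using c(1-3) by (cases "todo m") auto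
    have tl: "account m' = account m" using Claim_Blame by (auto simp: m')
    have cov: "covers m' (\<lambda>j. level c b (unit_size m) j + int (laps m) * effect o1 b j)"
      using c(5) covers_cong[OF tl] by simp
    have ms: "length (todo m') \<le> length (todo m)" "unit_size m' = unit_size m" "elapsed m' = Suc (elapsed m)"
      using Claim_Blame by (simp_all add: m')
    have "length (todo m') * (2 * unit_size m + 4) \<le> length (todo m) * (2 * unit_size m + 4)"
      using ms(1) by (rule mult_le_mono1)
    then have "int (length (todo m') * (2 * unit_size m + 4)) \<le> int (length (todo m) * (2 * unit_size m + 4))"
      by (rule of_nat_mono)
    then have "budget x ts0 m' (2 * unit_size m' + 4)"
      using c(6,7) unfolding budget_def ms(2,3) tl by linarith
    then have "paid ?C 1 m'" using budget_paid[OF cov] bound[OF c(4,7)] Claim_Blame by (simp add: m')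
    moreover have "account m' (Neg (claimed o1 b)) \<le> account m' Slack"
    proof -
      have "level c b (unit_size m) (claimed o1 b) + int (laps m) * effect o1 b (claimed o1 b) = 0"
        unfolding c(8) by (rule level_claimed[OF step])
      with cov show ?thesis unfolding covers_def by (metis add.right_neutral)
    qed
    ultimately show ?thesis using paid_mono covers_safe[OF cov] Claim_Blame by (simp add: pilot_inv_def)
  qed
qed

lemma pilot_inv_safe:
  assumes "pilot_inv T qf x ts0 v m"
  shows "safe m" "int (elapsed m) \<le> int (cost (x + length ts0)) * account m Gain"
proof -
  have sim: "safe m \<and> int (elapsed m) \<le> int (cost (x + length ts0)) * account m Gain"
    if "\<forall>i. c i + n \<le> x + length ts0" "covers m (\<lambda>j. level c b (unit_size m) j + int (laps m) * effect o1 b j)"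
      "budget x ts0 m e" "e \<le> 2 * unit_size m + 4" for c n b o1 e
  proof -
    have "int (elapsed m) \<le>
       int (cost (x + length ts0)) * (account m Gain - 1 - int (unit_size m)) +
       int (unit_size m + 2 + length ts0 * (2 * unit_size m + 4)) + int (2 * unit_size m + 4)"
      using that(3,4) of_nat_0_le_iff[of "length (todo m) * (2 * unit_size m + 4)", where 'a = int]
      unfolding budget_def by linarith
    moreover have "int (unit_size m + 2 + length ts0 * (2 * unit_size m + 4)) + int (2 * unit_size m + 4) \<le>
        int (cost (x + length ts0)) * (1 + int (unit_size m))"
      by (simp add: cost_def algebra_simps)
    ultimately have "int (elapsed m) \<le> int (cost (x + length ts0)) * account m Gain"
      by (simp add: algebra_simps)
    with covers_safe[OF that(2)] show ?thesis by simp
  qed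
  have "safe m \<and> int (elapsed m) \<le> int (cost (x + length ts0)) * account m Gain"
  proof (cases v)
    case Reset then show ?thesis using assms by (simp add: pilot_inv_def paid_def)
  next
    case Scale
    then have "covers m (level (start_counters x) False (unit_size m))"
      "int (elapsed m) \<le> int (cost (x + length ts0)) * (account m Gain - 1 - int (unit_size m)) + int (unit_size m) + 1"
      using assms by (auto simp: pilot_inv_def)
    moreover have "int (unit_size m) + 1 \<le> int (cost (x + length ts0)) * (1 + int (unit_size m))"
      by (simp add: cost_def algebra_simps)
    ultimately show ?thesis using covers_safe by (auto simp: algebra_simps)
  next
    case (Blame i) then show ?thesis using assms by (simp add: pilot_inv_def paid_def)
  next
    case (State q b)
    then obtain c where "\<forall>i. c i + length (todo m) \<le> x + length ts0" "covers m (level c b (unit_size m))" "budget x ts0 m 0"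
      using assms by (auto simp: pilot_inv_def)
    then show ?thesis using sim[of c "length (todo m)" b Nop 0] by simp
  next
    case (Loop t b)
    then obtain c where "\<forall>i. c i + length (todo m) \<le> x + length ts0" "budget x ts0 m (1 + 2 * laps m)" "laps m \<le> unit_size m"
      "covers m (\<lambda>j. level c b (unit_size m) j + int (laps m) * effect (fst (snd t)) b j)"
      using assms by (auto simp: pilot_inv_def)
    then show ?thesis using sim[of c "length (todo m)" b "fst (snd t)"] by simp
  next
    case (Check t b)
    then obtain c where "\<forall>i. c i + length (todo m) \<le> x + length ts0" "budget x ts0 m (2 * laps m)" "laps m \<le> unit_size m"
      "covers m (\<lambda>j. level c b (unit_size m) j + int (laps m) * effect (fst (snd t)) b j)"
      using assms by (auto simp: pilot_inv_def)
    then show ?thesis using sim[of c "length (todo m)" b "fst (snd t)"] by simp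
  next
    case (Claim t b)
    then obtain c where "\<forall>i. c i + length (todo m) \<le> x + length ts0" "budget x ts0 m (2 + 2 * laps m)" "laps m \<le> unit_size m"
      "covers m (\<lambda>j. level c b (unit_size m) j + int (laps m) * effect (fst (snd t)) b j)"
      using assms by (auto simp: pilot_inv_def)
    then show ?thesis using sim[of c "length (todo m)" b "fst (snd t)"] by simp
  qed
  then show "safe m" "int (elapsed m) \<le> int (cost (x + length ts0)) * account m Gain" by auto
qed

lemma pilot_wins:
  fixes T :: "'q trans set"
  assumes run0: "run T qf q0 (start_counters x) ts0"
    and play: "\<And>n. edge T q0 qf (\<pi> n) (\<pi> (Suc n))" "\<pi> 0 = Reset"
    and M: "M 0 = Pilot 0 (\<lambda>_. 0) 0 [] 0" "\<And>n. M (Suc n) = pilot_upd ts0 x (M n) (\<pi> n) (\<pi> (Suc n))"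
    and act: "\<And>n. \<pi> n \<in> vertices1 T q0 qf \<Longrightarrow> edge T q0 qf (\<pi> n) (pilot_act (M n) (\<pi> n)) \<Longrightarrow>
      \<pi> (Suc n) = pilot_act (M n) (\<pi> n)"
  shows "satisfies (wvec x) \<pi> game_cond"
proof -
  define C where "C = cost (x + length ts0)"
  have inv: "pilot_inv T qf x ts0 (\<pi> n) (M n)" for n
  proof (induction n)
    case 0 show ?case using play M by (simp add: pilot_inv_def safe_def paid_def)
  next
    case (Suc n)
    then show ?case using pilot_step[OF _ play(1) act run0 M(2)] by blast
  qed
  have elapsed: "elapsed (M n) = n" for n by (induction n) (simp_all add: M)
  have account: "account (M n) d = total x \<pi> d n" for n d
    by (induction n) (simp_all add: M total_Suc)
  have safe: "total x \<pi> (Pos i) n \<ge> 0"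
    "total x \<pi> Slack n \<ge> 0 \<or> (\<exists>i. total x \<pi> Slack n \<ge> total x \<pi> (Neg i) n)" for i n
    using pilot_inv_safe(1)[OF inv[of n]] by (auto simp: safe_def account)
  have gain: "int n \<le> int C * total x \<pi> Gain n" for n
    using pilot_inv_safe(2)[OF inv[of n]] by (simp add: account elapsed C_def)
  show ?thesis
  proof (cases "\<exists>i. mean x \<pi> (Neg i) < 0")
    case True then show ?thesis by (simp add: satisfies_game_cond)
  next
    case False
    have "mean x \<pi> (Pos i) \<ge> 0" for i using safe(1) by (rule mean_nonneg_I)
    moreover have "mean x \<pi> Slack \<ge> 0"
    proof (rule mean_ge_zero_I)
      fix \<epsilon> :: real assume \<epsilon>: "\<epsilon> > 0"
      \<comment> \<open>Which \<open>Neg i\<close> lies below a negative \<open>Slack\<close> may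
        vary with \<open>n\<close>; as there are finitely many, one bound holds for all of
        them.\<close>
      have "eventually (\<lambda>n. \<forall>i \<in> UNIV. total x \<pi> (Neg i) n \<ge> - \<epsilon> * n) sequentially"
        by (intro eventually_ball_finite ballI mean_ge_zero_D) (use False \<epsilon> in \<open>auto simp: not_less\<close>)
      then show "eventually (\<lambda>n. total x \<pi> Slack n \<ge> - \<epsilon> * n) sequentially"
      proof eventually_elim
        case (elim n)
        have "- \<epsilon> * n \<le> 0" using \<epsilon> by simp
        then show ?case using elim safe(2)[of n] by (smt (verit) UNIV_I of_int_0_le_iff of_int_le_iff)
      qed
    qed
    moreover have "mean x \<pi> Gain > 0"
    proof (rule mean_pos_I)
      show "1 / real C > 0" by (simp add: C_def cost_def)
      show "real_of_int (total x \<pi> Gain n) \<ge> 1 / real C * n" for n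
      proof -
        have "real_of_int (int n) \<le> real_of_int (int C * total x \<pi> Gain n)"
          using gain by (simp only: of_int_le_iff)
        then show ?thesis by (simp add: C_def cost_def field_simps)
      qed
    qed
    ultimately show ?thesis by (simp add: satisfies_game_cond)
  qed
qed

theorem player1_wins_machine_game:
  fixes T :: "'q trans set"
  assumes T: "finite T" and acc: "accepts T q0 qf x"
  shows "player1_wins (machine_game T q0 qf) (wvec x) Reset game_cond"
proof -
  obtain c where "reaches T q0 (start_counters x) qf c"
    using acc unfolding accepts_def by blast
  from reaches_imp_run[OF this] obtain ts0 where run0: "run T qf q0 (start_counters x) ts0" ..
  obtain \<tau> where \<tau>: "is_strategy1 (machine_game T q0 qf) \<tau>"
    and mem: "\<And>\<pi>. consistent1 (machine_game T q0 qf) \<tau> \<pi> \<Longrightarrow>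
      \<exists>M. M 0 = Pilot 0 (\<lambda>_. 0) 0 [] 0 \<and> (\<forall>n. M (Suc n) = pilot_upd ts0 x (M n) (\<pi> n) (\<pi> (Suc n))) \<and>
        (\<forall>n. \<pi> n \<in> verts1 (machine_game T q0 qf) \<longrightarrow> (\<pi> n, pilot_act (M n) (\<pi> n)) \<in> edges (machine_game T q0 qf) \<longrightarrow>
          \<pi> (Suc n) = pilot_act (M n) (\<pi> n))"
    by (rule memory_strategy[OF is_game_graph_machine_game[OF T], where upd = "pilot_upd ts0 x" and act = pilot_act
          and ?m0.0 = "Pilot 0 (\<lambda>_. 0) 0 [] 0"]) blast
  have "satisfies (wvec x) \<pi> game_cond"
    if play: "is_play (machine_game T q0 qf) Reset \<pi>" and con: "consistent1 (machine_game T q0 qf) \<tau> \<pi>" for \<pi>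
  proof -
    obtain M where M: "M 0 = Pilot 0 (\<lambda>_. 0) 0 [] 0" "\<forall>n. M (Suc n) = pilot_upd ts0 x (M n) (\<pi> n) (\<pi> (Suc n))"
      "\<forall>n. \<pi> n \<in> verts1 (machine_game T q0 qf) \<longrightarrow> (\<pi> n, pilot_act (M n) (\<pi> n)) \<in> edges (machine_game T q0 qf) \<longrightarrow>
          \<pi> (Suc n) = pilot_act (M n) (\<pi> n)"
      using mem[OF con] by blast
    show ?thesis
      by (rule pilot_wins[OF run0, of \<pi> M]) (use play M in \<open>auto simp: is_play_def\<close>)
  qed
  with \<tau> show ?thesis unfolding player1_wins_def winning_strategy1_def by blast
qed

section \<open>Compiling recursive functions to two-counter machines\<close>

text \<open>Regular programs, read as relations on register contents. Guessing in \<open>Alt\<close>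
  and \<open>Star\<close> is harmless since only the existence of a run matters; wrong guesses die
  at a \<open>Dec\<close> or \<open>Tst\<close>.\<close>

datatype 'r prog = Op "'r op" | Seq "'r prog" "'r prog" | Alt "'r prog" "'r prog" | Star "'r prog"

primrec sem :: "'r prog \<Rightarrow> ('r \<Rightarrow> nat) rel" where
  "sem (Op o1) = {(s, s'). op_step o1 s s'}"
| "sem (Seq p q) = sem p O sem q"
| "sem (Alt p q) = sem p \<union> sem q"
| "sem (Star p) = (sem p)\<^sup>*"

lemma in_sem_Seq: "(s, t) \<in> sem (Seq p q) \<longleftrightarrow> (\<exists>u. (s, u) \<in> sem p \<and> (u, t) \<in> sem q)"
  by auto

text \<open>A machine state is the list of programs still to be run, and the empty list is the
  halting state.\<close>

fun succs :: "'r prog list \<Rightarrow> ('r op \<times> 'r prog list) set" where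
  "succs [] = {}"
| "succs (Op o1 # ks) = {(o1, ks)}"
| "succs (Seq p q # ks) = {(Nop, p # q # ks)}"
| "succs (Alt p q # ks) = {(Nop, p # ks), (Nop, q # ks)}"
| "succs (Star p # ks) = {(Nop, ks), (Nop, p # Star p # ks)}"

text \<open>The lists that occur while \<open>p\<close> runs in front of \<open>ks\<close>. There
  are finitely many, because an iteration of \<open>Star p\<close> returns to the very list
  \<open>Star p # ks\<close>.\<close>

primrec conts :: "'r prog \<Rightarrow> 'r prog list \<Rightarrow> 'r prog list set" where
  "conts (Op o1) ks = {Op o1 # ks}"
| "conts (Seq p q) ks = insert (Seq p q # ks) (conts p (q # ks) \<union> conts q ks)"
| "conts (Alt p q) ks = insert (Alt p q # ks) (conts p ks \<union> conts q ks)"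
| "conts (Star p) ks = insert (Star p # ks) (conts p (Star p # ks))"

definition prog_trans :: "bool prog \<Rightarrow> bool prog list trans set" where
  "prog_trans p = {(q, t). q \<in> conts p [] \<and> t \<in> succs q}"

lemma finite_prog_trans: "finite (prog_trans p)"
proof -
  have "finite (conts p ks)" for ks :: "bool prog list" by (induction p arbitrary: ks) auto
  moreover have "finite (succs ks)" for ks :: "bool prog list" by (cases ks rule: succs.cases) auto
  moreover have "prog_trans p = Sigma (conts p []) succs" by (auto simp: prog_trans_def)
  ultimately show ?thesis by auto
qed

lemma reaches_sem:
  assumes "(c, c') \<in> sem p" "\<And>q t. q \<in> conts p ks \<Longrightarrow> t \<in> succs q \<Longrightarrow> (q, t) \<in> T"
  shows "reaches T (p # ks) c ks c'"
  using assms
proof (induction p arbitrary: ks c c')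
  case (Op o1)
  then show ?case by (intro reaches.step[OF _ _ reaches.refl]) auto
next
  case (Seq p q)
  obtain d where d: "(c, d) \<in> sem p" "(d, c') \<in> sem q" using Seq.prems(1) by auto
  have "reaches T (p # q # ks) c (q # ks) d" "reaches T (q # ks) d ks c'"
    using Seq.IH d Seq.prems(2) by auto
  then have "reaches T (p # q # ks) c ks c'" by (rule reaches_trans)
  then show ?case by (rule reaches.step[rotated 2]) (auto intro: Seq.prems(2))
next
  case (Alt p q)
  then consider "(c, c') \<in> sem p" | "(c, c') \<in> sem q" by auto
  then show ?case
  proof cases
    case 1
    then have "reaches T (p # ks) c ks c'" using Alt by auto
    then show ?thesis by (rule reaches.step[rotated 2]) (auto intro: Alt.prems(2))
  next
    case 2
    then have "reaches T (q # ks) c ks c'" using Alt by auto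
    then show ?thesis by (rule reaches.step[rotated 2]) (auto intro: Alt.prems(2))
  qed
next
  case (Star p)
  from Star.prems(1) have "(c, c') \<in> (sem p)\<^sup>*" by simp
  then show ?case
  proof (induction rule: converse_rtrancl_induct)
    case base
    show ?case by (rule reaches.step[OF _ _ reaches.refl]) (auto intro: Star.prems(2))
  next
    case (step c d)
    have "reaches T (p # Star p # ks) c (Star p # ks) d"
      using Star.IH step.hyps(1) Star.prems(2) by auto
    then have "reaches T (p # Star p # ks) c ks c'" using step.IH by (rule reaches_trans)
    then show ?case by (rule reaches.step[rotated 2]) (auto intro: Star.prems(2))
  qed
qed

text \<open>The induction passes through arbitrary lists of pending programs, whence the composed
  relation in place of a single \<open>sem p\<close>.\<close>

lemma sem_reaches:
  assumes "reaches T ks c ks' c'" "ks' = []" "\<And>q t. (q, t) \<in> T \<Longrightarrow> t \<in> succs q"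
  shows "(c, c') \<in> foldr (\<lambda>p r. sem p O r) ks Id"
  using assms
proof (induction rule: reaches.induct)
  case (step q o1 q' c d q'' c'')
  then have "(o1, q') \<in> succs q" "(d, c'') \<in> foldr (\<lambda>p r. sem p O r) q' Id" by auto
  note s = this \<open>op_step o1 c d\<close>
  show ?case
  proof (cases q rule: succs.cases)
    case (5 p ks)
    then consider "d = c" "q' = ks" | "d = c" "q' = p # Star p # ks" using s by auto
    then show ?thesis
    proof cases
      case 1
      with s(2) 5 show ?thesis by auto
    next
      case 2
      then obtain e f where "(c, e) \<in> sem p" "(e, f) \<in> (sem p)\<^sup>*" "(f, c'') \<in> foldr (\<lambda>p r. sem p O r) ks Id"
        using s(2) by auto
      then show ?thesis using 5 by (auto intro: converse_rtrancl_into_rtrancl)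
    qed
  qed (use s in auto)
qed simp

lemma accepts_prog_trans:
  "accepts (prog_trans p) [p] [] x \<longleftrightarrow> (\<exists>c. (start_counters x, c) \<in> sem p)"
proof -
  have "reaches (prog_trans p) [p] (start_counters x) [] c" if "(start_counters x, c) \<in> sem p" for c
    using that by (rule reaches_sem) (simp add: prog_trans_def)
  moreover have "(start_counters x, c) \<in> sem p" if "reaches (prog_trans p) [p] (start_counters x) [] c" for c
    using sem_reaches[OF that] by (simp add: prog_trans_def)
  ultimately have "reaches (prog_trans p) [p] (start_counters x) [] c \<longleftrightarrow> (start_counters x, c) \<in> sem p" for c
    by blast
  then show ?thesis by (simp add: accepts_def)
qed

section \<open>Building blocks of counter programs\<close>

primrec pow :: "nat \<Rightarrow> 'r prog \<Rightarrow> 'r prog" where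
  "pow 0 p = Op Nop"
| "pow (Suc n) p = Seq p (pow n p)"

definition transfer :: "'r \<Rightarrow> nat \<Rightarrow> 'r \<Rightarrow> nat \<Rightarrow> 'r prog" where
  "transfer i a j b = Star (Seq (pow a (Op (Dec i))) (pow b (Op (Inc j))))"

definition drain :: "'r \<Rightarrow> nat \<Rightarrow> 'r \<Rightarrow> nat \<Rightarrow> 'r prog" where
  "drain i a j b = Seq (transfer i a j b) (Op (Tst i))"

definition fail :: "'r \<Rightarrow> 'r prog" where
  "fail r = Seq (Op (Inc r)) (Op (Tst r))"

lemma sem_fail [simp]: "sem (fail r) = {}"
  by (auto simp: fail_def)

lemma sem_pow_Dec: "(s, s') \<in> sem (pow n (Op (Dec i))) \<longleftrightarrow> n \<le> s i \<and> s' = s(i := s i - n)"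
  by (induction n arbitrary: s) (auto simp: relcomp_unfold)

lemma sem_pow_Inc: "(s, s') \<in> sem (pow n (Op (Inc i))) \<longleftrightarrow> s' = s(i := s i + n)"
  by (induction n arbitrary: s) (auto simp: relcomp_unfold)

lemma sem_transfer:
  assumes "i \<noteq> j"
  shows "(s, s') \<in> sem (transfer i a j b) \<longleftrightarrow>
    (\<exists>k. a * k \<le> s i \<and> s' = s(i := s i - a * k, j := s j + b * k))" (is "?L \<longleftrightarrow> ?R")
proof -
  let ?body = "Seq (pow a (Op (Dec i))) (pow b (Op (Inc j)))"
  have body: "(t, t') \<in> sem ?body \<longleftrightarrow> a \<le> t i \<and> t' = t(i := t i - a, j := t j + b)" for t t'
    using assms by (auto simp: relcomp_unfold sem_pow_Dec sem_pow_Inc)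
  show ?thesis
  proof
    assume ?L
    then have "(s, s') \<in> (sem ?body)\<^sup>*" by (simp add: transfer_def)
    then show ?R
    proof (induction rule: rtrancl_induct)
      case base show ?case by (intro exI[of _ 0]) auto
    next
      case (step t t')
      then obtain k where k: "a * k \<le> s i" "t = s(i := s i - a * k, j := s j + b * k)" by blast
      with step(2) assms have "a * Suc k \<le> s i" "t' = s(i := s i - a * Suc k, j := s j + b * Suc k)"
        unfolding body by (auto simp: fun_eq_iff)
      then show ?case by blast
    qed
  next
    assume ?R
    then obtain k where "a * k \<le> s i" "s' = s(i := s i - a * k, j := s j + b * k)" by blast
    then have "(s, s') \<in> (sem ?body)\<^sup>*"
    proof (induction k arbitrary: s')
      case (Suc k)
      let ?t = "s(i := s i - a * k, j := s j + b * k)"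
      have "(s, ?t) \<in> (sem ?body)\<^sup>*" using Suc.prems(1) by (intro Suc.IH) auto
      moreover have "(?t, s') \<in> sem ?body" unfolding body using Suc.prems assms by (auto simp: fun_eq_iff)
      ultimately show ?case by (rule rtrancl_into_rtrancl)
    qed simp
    then show ?L by (simp add: transfer_def)
  qed
qed

lemma sem_drain:
  assumes "i \<noteq> j"
  shows "(s, s') \<in> sem (drain i a j b) \<longleftrightarrow> (\<exists>k. s i = a * k \<and> s' = s(i := 0, j := s j + b * k))"
  using assms unfolding drain_def sem.simps relcomp_unfold
  by (auto simp: sem_transfer)

fun alts :: "'r \<Rightarrow> 'r prog list \<Rightarrow> 'r prog" where
  "alts r [] = fail r"
| "alts r (p # ps) = Alt p (alts r ps)"

lemma sem_alts: "sem (alts r ps) = (\<Union>p\<in>set ps. sem p)"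
  by (induction ps) auto

section \<open>Goedel numbering: all registers in one counter\<close>

definition nth_prime :: "nat \<Rightarrow> nat" where
  "nth_prime = enumerate {p. prime p}"

lemma prime_nth_prime: "prime (nth_prime r)"
  using enumerate_in_set[OF primes_infinite, of r] by (simp add: nth_prime_def)

lemma nth_prime_eq_iff [simp]: "nth_prime r = nth_prime r' \<longleftrightarrow> r = r'"
  using strict_mono_enumerate[OF primes_infinite] by (simp add: nth_prime_def strict_mono_eq)

definition goedel :: "nat \<Rightarrow> (nat \<Rightarrow> nat) \<Rightarrow> nat" where
  "goedel m s = (\<Prod>r<m. nth_prime r ^ s r)"

lemma goedel_upd_Suc:
  assumes "r < m" shows "goedel m (s(r := Suc (s r))) = nth_prime r * goedel m s"
proof -
  have "goedel m (s(r := Suc (s r))) = nth_prime r ^ Suc (s r) * (\<Prod>r'\<in>{..<m} - {r}. nth_prime r' ^ s r')"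
    using assms unfolding goedel_def by (subst prod.remove[of _ r]) auto
  moreover have "goedel m s = nth_prime r ^ s r * (\<Prod>r'\<in>{..<m} - {r}. nth_prime r' ^ s r')"
    using assms unfolding goedel_def by (subst prod.remove[of _ r]) auto
  ultimately show ?thesis by simp
qed

lemma nth_prime_dvd_goedel:
  assumes "r < m" shows "nth_prime r dvd goedel m s \<longleftrightarrow> s r > 0"
proof
  assume "nth_prime r dvd goedel m s"
  then have "\<exists>r'\<in>{..<m}. nth_prime r dvd nth_prime r' ^ s r'"
    unfolding goedel_def using prime_nth_prime by (subst (asm) prime_dvd_prod_iff) auto
  then obtain r' where "r' < m" "nth_prime r dvd nth_prime r' ^ s r'" by auto
  then have dv: "nth_prime r dvd nth_prime r'" "s r' > 0"
    using prime_dvd_power[OF prime_nth_prime] not_prime_unit[of "nth_prime r"] prime_nth_prime[of r]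
    by (auto intro!: gr0I)
  then have "r = r'" using primes_dvd_imp_eq[OF prime_nth_prime prime_nth_prime] by simp
  with dv show "s r > 0" by simp
next
  assume "s r > 0"
  then have "(s(r := s r - 1))(r := Suc ((s(r := s r - 1)) r)) = s" by (simp add: fun_eq_iff)
  then show "nth_prime r dvd goedel m s" using goedel_upd_Suc[OF assms, of "s(r := s r - 1)"] by simp
qed

definition two :: "nat \<Rightarrow> nat \<Rightarrow> bool \<Rightarrow> nat" where
  "two a b i = (if i then b else a)"

lemma two_simps [simp]:
  "two a b False = a" "two a b True = b"
  "(two a b)(False := c) = two c b" "(two a b)(True := c) = two a c"
  by (auto simp: two_def fun_eq_iff)

lemma start_counters_two: "start_counters x = two x 0"
  by (auto simp: start_counters_def two_def fun_eq_iff)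

definition remainder :: "nat \<Rightarrow> bool prog" where
  "remainder p = alts True (map (\<lambda>n. Seq (pow n (Op (Dec False))) (Seq (pow n (Op (Inc True))) (Op (Tst False))))
     [1..<p])"

lemma sem_remainder:
  "(two a b, c) \<in> sem (remainder p) \<longleftrightarrow> a \<in> {1..<p} \<and> c = two 0 (b + a)"
  by (auto simp: remainder_def sem_alts relcomp_unfold sem_pow_Dec sem_pow_Inc)

text \<open>Counter \<open>False\<close> holds the Goedel number, counter \<open>True\<close> is
  scratch and empty between operations. A register is 0 iff its prime does not divide the number;
  this is certified by guessing a quotient and a nonzero remainder below the prime, and the pieces
  collected in \<open>True\<close> restore the number.\<close>

fun goedel_op :: "nat op \<Rightarrow> bool prog" where
  "goedel_op (Inc r) = Seq (drain False 1 True (nth_prime r)) (drain True 1 False 1)"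
| "goedel_op (Dec r) = Seq (drain False (nth_prime r) True 1) (drain True 1 False 1)"
| "goedel_op (Tst r) =
     Seq (transfer False (nth_prime r) True (nth_prime r))
      (Seq (remainder (nth_prime r)) (drain True 1 False 1))"
| "goedel_op Nop = Op Nop"

fun op_regs :: "'r op \<Rightarrow> 'r set" where
  "op_regs (Inc r) = {r}" | "op_regs (Dec r) = {r}" | "op_regs (Tst r) = {r}" | "op_regs Nop = {}"

lemma sem_goedel_op:
  assumes "op_regs o1 \<subseteq> {..<m}"
  shows "(two (goedel m s) 0, c) \<in> sem (goedel_op o1) \<longleftrightarrow>
    (\<exists>s'. op_step o1 s s' \<and> c = two (goedel m s') 0)"
proof (cases o1)
  case (Inc r)
  then show ?thesis using assms goedel_upd_Suc[of r m s]
    by (auto simp: relcomp_unfold sem_drain)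
next
  case (Dec r)
  have "(two (goedel m s) 0, c) \<in> sem (goedel_op o1) \<longleftrightarrow>
    (\<exists>k. goedel m s = nth_prime r * k \<and> c = two k 0)"
    using Dec by (auto simp: relcomp_unfold sem_drain)
  also have "\<dots> \<longleftrightarrow> s r > 0 \<and> c = two (goedel m (s(r := s r - 1))) 0"
  proof (cases "s r > 0")
    case True
    then have "(s(r := s r - 1))(r := Suc ((s(r := s r - 1)) r)) = s" by (simp add: fun_eq_iff)
    then have "goedel m s = nth_prime r * goedel m (s(r := s r - 1))"
      using goedel_upd_Suc[of r m "s(r := s r - 1)"] assms Dec by auto
    then show ?thesis using True prime_gt_0_nat[OF prime_nth_prime, of r] by auto
  next
    case False
    then show ?thesis using nth_prime_dvd_goedel[of r m s] assms Dec by auto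
  qed
  finally show ?thesis using Dec by auto
next
  case (Tst r)
  let ?N = "goedel m s" and ?p = "nth_prime r"
  have "(two ?N 0, c) \<in> sem (goedel_op o1) \<longleftrightarrow>
    (\<exists>k n. ?p * k \<le> ?N \<and> n \<in> {1..<?p} \<and> ?N - ?p * k = n \<and> c = two (?p * k + n) 0)"
    unfolding Tst goedel_op.simps sem.simps(2) relcomp_unfold
    by (auto simp: sem_drain sem_transfer sem_remainder)
  also have "\<dots> \<longleftrightarrow> \<not> ?p dvd ?N \<and> c = two ?N 0"
  proof
    assume "\<exists>k n. ?p * k \<le> ?N \<and> n \<in> {1..<?p} \<and> ?N - ?p * k = n \<and> c = two (?p * k + n) 0"
    then obtain k where k: "?p * k \<le> ?N" "?N - ?p * k \<in> {1..<?p}" "c = two (?p * k + (?N - ?p * k)) 0"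
      by blast
    moreover obtain n where "n = ?N - ?p * k" by blast
    ultimately have "n \<in> {1..<?p}" "?N = ?p * k + n" "c = two (?p * k + n) 0" by auto
    then show "\<not> ?p dvd ?N \<and> c = two ?N 0"
      by (auto simp: dvd_add_right_iff dest: dvd_imp_le)
  next
    assume "\<not> ?p dvd ?N \<and> c = two ?N 0"
    then show "\<exists>k n. ?p * k \<le> ?N \<and> n \<in> {1..<?p} \<and> ?N - ?p * k = n \<and> c = two (?p * k + n) 0"
      using prime_gt_0_nat[OF prime_nth_prime, of r]
      by (intro exI[of _ "?N div ?p"] exI[of _ "?N mod ?p"])
        (auto simp: dvd_eq_mod_eq_0 minus_mult_div_eq_mod)
  qed
  finally show ?thesis using nth_prime_dvd_goedel[of r m s] assms Tst by auto
next
  case Nop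
  then show ?thesis by auto
qed

primrec goedel_prog :: "nat prog \<Rightarrow> bool prog" where
  "goedel_prog (Op o1) = goedel_op o1"
| "goedel_prog (Seq p q) = Seq (goedel_prog p) (goedel_prog q)"
| "goedel_prog (Alt p q) = Alt (goedel_prog p) (goedel_prog q)"
| "goedel_prog (Star p) = Star (goedel_prog p)"

primrec prog_regs :: "'r prog \<Rightarrow> 'r set" where
  "prog_regs (Op o1) = op_regs o1"
| "prog_regs (Seq p q) = prog_regs p \<union> prog_regs q"
| "prog_regs (Alt p q) = prog_regs p \<union> prog_regs q"
| "prog_regs (Star p) = prog_regs p"

lemma finite_prog_regs: "finite (prog_regs p)"
proof (induction p)
  case (Op o1) then show ?case by (cases o1) auto
qed auto

lemma sem_goedel_prog:
  assumes "prog_regs p \<subseteq> {..<m}"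
  shows "(two (goedel m s) 0, c) \<in> sem (goedel_prog p) \<longleftrightarrow>
    (\<exists>s'. (s, s') \<in> sem p \<and> c = two (goedel m s') 0)"
  using assms
proof (induction p arbitrary: s c)
  case (Op o1)
  then show ?case using sem_goedel_op by simp
next
  case (Seq p q)
  then show ?case by (auto simp: relcomp_unfold) blast+
next
  case (Alt p q)
  then show ?case by auto
next
  case (Star p)
  have IH: "(two (goedel m s) 0, c) \<in> sem (goedel_prog p) \<longleftrightarrow>
    (\<exists>s'. (s, s') \<in> sem p \<and> c = two (goedel m s') 0)" for s c
    using Star by simp
  show ?case
  proof
    assume "(two (goedel m s) 0, c) \<in> sem (goedel_prog (Star p))"
    then have "(two (goedel m s) 0, c) \<in> (sem (goedel_prog p))\<^sup>*" by simp
    then have "\<exists>s'. (s, s') \<in> (sem p)\<^sup>* \<and> c = two (goedel m s') 0"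
    proof (induction rule: rtrancl_induct)
      case (step d e)
      then show ?case using IH by (blast intro: rtrancl_into_rtrancl)
    qed blast
    then show "\<exists>s'. (s, s') \<in> sem (Star p) \<and> c = two (goedel m s') 0" by simp
  next
    assume "\<exists>s'. (s, s') \<in> sem (Star p) \<and> c = two (goedel m s') 0"
    then obtain s' where "(s, s') \<in> (sem p)\<^sup>*" "c = two (goedel m s') 0" by auto
    from this(1) have "(two (goedel m s) 0, two (goedel m s') 0) \<in> (sem (goedel_prog p))\<^sup>*"
    proof (induction rule: rtrancl_induct)
      case (step t u)
      then show ?case using IH by (blast intro: rtrancl_into_rtrancl)
    qed simp
    then show "(two (goedel m s) 0, c) \<in> sem (goedel_prog (Star p))"
      using \<open>c = _\<close> by simp
  qed
qed

definition clear :: "'r \<Rightarrow> 'r prog" where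
  "clear r = Seq (Star (Op (Dec r))) (Op (Tst r))"

lemma sem_clear: "(s, s') \<in> sem (clear r) \<longleftrightarrow> s' = s(r := 0)"
proof -
  have "(s, t) \<in> (sem (Op (Dec r)))\<^sup>* \<longleftrightarrow> (\<exists>k\<le>s r. t = s(r := k))" for t
  proof
    assume "(s, t) \<in> (sem (Op (Dec r)))\<^sup>*"
    then show "\<exists>k\<le>s r. t = s(r := k)"
    proof (induction rule: rtrancl_induct)
      case base show ?case by (intro exI[of _ "s r"]) auto
    next
      case (step t u)
      then obtain k where "k \<le> s r" "t = s(r := k)" by blast
      with step(2) show ?case by (intro exI[of _ "k - 1"]) auto
    qed
  next
    assume "\<exists>k\<le>s r. t = s(r := k)"
    then obtain k where "k \<le> s r" "t = s(r := k)" by blast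
    then show "(s, t) \<in> (sem (Op (Dec r)))\<^sup>*"
    proof (induction arbitrary: t rule: inc_induct)
      case base then show ?case by simp
    next
      case (step k)
      have "(s, s(r := Suc k)) \<in> (sem (Op (Dec r)))\<^sup>*" by (intro step.IH) simp
      moreover have "(s(r := Suc k), t) \<in> sem (Op (Dec r))" using step.prems step.hyps by (simp add: fun_eq_iff)
      ultimately show ?case by (rule rtrancl_into_rtrancl)
    qed
  qed
  then show ?thesis by (auto simp: clear_def relcomp_unfold)
qed

definition copy :: "'r \<Rightarrow> 'r \<Rightarrow> 'r \<Rightarrow> 'r prog" where
  "copy i j k = Seq (Seq (Star (Seq (Op (Dec i)) (Seq (Op (Inc j)) (Op (Inc k))))) (Op (Tst i))) (drain k 1 i 1)"

lemma sem_copy: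
  assumes "distinct [i, j, k]" "s k = 0"
  shows "(s, s') \<in> sem (copy i j k) \<longleftrightarrow> s' = s(j := s j + s i)"
proof -
  let ?body = "Seq (Op (Dec i)) (Seq (Op (Inc j)) (Op (Inc k)))"
  have body: "(t, t') \<in> sem ?body \<longleftrightarrow> t i > 0 \<and> t' = t(i := t i - 1, j := Suc (t j), k := Suc (t k))" for t t'
    using assms(1) by (auto simp: relcomp_unfold)
  have star: "(s, t) \<in> (sem ?body)\<^sup>* \<longleftrightarrow> (\<exists>n\<le>s i. t = s(i := s i - n, j := s j + n, k := n))" for t
  proof
    assume "(s, t) \<in> (sem ?body)\<^sup>*"
    then show "\<exists>n\<le>s i. t = s(i := s i - n, j := s j + n, k := n)"
    proof (induction rule: rtrancl_induct)
      case base show ?case by (intro exI[of _ 0]) (use assms in \<open>auto simp: fun_eq_iff\<close>)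
    next
      case (step t u)
      then obtain n where n: "n \<le> s i" "t = s(i := s i - n, j := s j + n, k := n)" by blast
      with step(2) assms have "Suc n \<le> s i" "u = s(i := s i - Suc n, j := s j + Suc n, k := Suc n)"
        unfolding body by (auto simp: fun_eq_iff)
      then show ?case by blast
    qed
  next
    assume "\<exists>n\<le>s i. t = s(i := s i - n, j := s j + n, k := n)"
    then obtain n where "n \<le> s i" "t = s(i := s i - n, j := s j + n, k := n)" by blast
    then show "(s, t) \<in> (sem ?body)\<^sup>*"
    proof (induction n arbitrary: t)
      case 0
      then have "t = s" using assms by (auto simp: fun_eq_iff)
      then show ?case by simp
    next
      case (Suc n)
      let ?t = "s(i := s i - n, j := s j + n, k := n)"
      have "(s, ?t) \<in> (sem ?body)\<^sup>*" using Suc.prems(1) by (intro Suc.IH) auto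
      moreover have "(?t, t) \<in> sem ?body" unfolding body using Suc.prems assms by (auto simp: fun_eq_iff)
      ultimately show ?case by (rule rtrancl_into_rtrancl)
    qed
  qed
  have "(s, t) \<in> sem (Seq (Star ?body) (Op (Tst i))) \<longleftrightarrow>
      (\<exists>n\<le>s i. t = s(i := s i - n, j := s j + n, k := n)) \<and> t i = 0" for t
    unfolding in_sem_Seq[of _ _ "Star ?body"] sem.simps(4) star by auto
  moreover have "(\<exists>n\<le>s i. t = s(i := s i - n, j := s j + n, k := n)) \<and> t i = 0 \<longleftrightarrow>
      t = s(i := 0, j := s j + s i, k := s i)" for t
    using assms(1) by (auto intro!: exI[of _ "s i"])
  ultimately have "(s, t) \<in> sem (Seq (Star ?body) (Op (Tst i))) \<longleftrightarrow> t = s(i := 0, j := s j + s i, k := s i)" for t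
    by blast
  then have "(s, s') \<in> sem (copy i j k) \<longleftrightarrow> (s(i := 0, j := s j + s i, k := s i), s') \<in> sem (drain k 1 i 1)"
    unfolding copy_def in_sem_Seq[of _ _ _ "drain k 1 i 1"] by simp
  also have "\<dots> \<longleftrightarrow> s' = s(j := s j + s i)"
    using assms by (auto simp: sem_drain fun_eq_iff)
  finally show ?thesis .
qed

section \<open>Register programs for recursive functions\<close>

definition clean :: "nat \<Rightarrow> (nat \<Rightarrow> nat) \<Rightarrow> bool" where
  "clean k s \<longleftrightarrow> (\<forall>r\<ge>k. s r = 0)"

text \<open>Apart from \<open>out\<close> all registers are restored, so the registers from
  \<open>k\<close> on are empty scratch space before and after, and programs can be nested freely.
  Undefinedness of \<open>f\<close> appears as the absence of a terminating run.\<close>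

definition adds_to :: "recf \<Rightarrow> nat list \<Rightarrow> nat \<Rightarrow> nat \<Rightarrow> nat prog \<Rightarrow> bool" where
  "adds_to f args out k p \<longleftrightarrow> (\<forall>s s'. clean k s \<longrightarrow>
     ((s, s') \<in> sem p \<longleftrightarrow> (\<exists>y. rec_eval f (map s args) y \<and> s' = s(out := s out + y))))"

definition compilable :: "recf \<Rightarrow> bool" where
  "compilable f \<longleftrightarrow> (\<forall>args out k. set args \<subseteq> {..<k} \<longrightarrow> out < k \<longrightarrow> out \<notin> set args \<longrightarrow>
     (\<exists>p. adds_to f args out k p))"

lemma compilableD:
  assumes "compilable f" "set args \<subseteq> {..<k}" "out < k" "out \<notin> set args"
  obtains p where "adds_to f args out k p"
  using assms unfolding compilable_def by blast

lemma rec_eval_Zero: "rec_eval Zero xs y \<longleftrightarrow> y = 0"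
  by (auto elim: rec_eval_ZeroE intro: rec_eval.zero)

lemma rec_eval_Succ: "rec_eval Succ xs y \<longleftrightarrow> (\<exists>x. xs = [x] \<and> y = Suc x)"
  by (auto elim: rec_eval_SuccE intro: rec_eval.succ)

lemma rec_eval_Proj: "rec_eval (Proj i) xs y \<longleftrightarrow> i < length xs \<and> y = xs ! i"
  by (auto elim: rec_eval_ProjE intro: rec_eval.proj)

lemma rec_eval_Comp:
  "rec_eval (Comp f gs) xs z \<longleftrightarrow> (\<exists>ys. list_all2 (\<lambda>g y. rec_eval g xs y) gs ys \<and> rec_eval f ys z)"
  by (auto elim!: rec_eval_CompE intro: rec_eval.comp simp: list_all2_conv_all_nth) (metis rec_eval.comp)

lemma rec_eval_PrimRec_0: "rec_eval (PrimRec f g) (0 # xs) y \<longleftrightarrow> rec_eval f xs y"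
  by (auto elim: rec_eval_PrimRec_0E intro: rec_eval.prim_0)

lemma rec_eval_PrimRec_Suc: "rec_eval (PrimRec f g) (Suc n # xs) z \<longleftrightarrow>
    (\<exists>y. rec_eval (PrimRec f g) (n # xs) y \<and> rec_eval g (n # y # xs) z)"
  by (auto elim: rec_eval_PrimRec_SucE intro: rec_eval.prim_Suc)

lemma rec_eval_PrimRec_Nil: "\<not> rec_eval (PrimRec f g) [] y"
  by (auto elim: rec_eval.cases)

lemma rec_eval_Mu: "rec_eval (Mu f) xs n \<longleftrightarrow>
    rec_eval f (n # xs) 0 \<and> (\<forall>m<n. \<exists>y. rec_eval f (m # xs) (Suc y))"
  by (auto elim: rec_eval_MuE intro: rec_eval.mu)

lemma compilable_Zero: "compilable Zero"
proof -
  have "adds_to Zero args out k (Op Nop)" for args out k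
    by (simp add: adds_to_def rec_eval_Zero)
  then show ?thesis by (auto simp: compilable_def)
qed

lemma adds_to_fail:
  assumes "\<And>s y. \<not> rec_eval f (map s args) y"
  shows "adds_to f args out k (fail 0)"
  using assms by (simp add: adds_to_def)

lemma compilable_Succ: "compilable Succ"
  unfolding compilable_def
proof (intro allI impI)
  fix args :: "nat list" and out k
  assume *: "set args \<subseteq> {..<k}" "out < k" "out \<notin> set args"
  show "\<exists>p. adds_to Succ args out k p"
  proof (cases "\<exists>a. args = [a]")
    case True
    then obtain a where a: "args = [a]" by blast
    have "adds_to Succ args out k (Seq (Op (Inc out)) (copy a out k))"
      unfolding adds_to_def
    proof (intro allI impI)
      fix s s' assume s: "clean k s"
      let ?t = "s(out := Suc (s out))"
      have "(?t, s') \<in> sem (copy a out k) \<longleftrightarrow> s' = ?t(out := ?t out + ?t a)"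
        using * a s by (intro sem_copy) (auto simp: clean_def)
      then show "(s, s') \<in> sem (Seq (Op (Inc out)) (copy a out k)) \<longleftrightarrow>
          (\<exists>y. rec_eval Succ (map s args) y \<and> s' = s(out := s out + y))"
        using * a by (simp add: relcomp_unfold rec_eval_Succ)
    qed
    then show ?thesis by blast
  next
    case False
    then show ?thesis by (intro exI[of _ "fail 0"] adds_to_fail) (auto simp: rec_eval_Succ map_eq_Cons_conv)
  qed
qed

lemma compilable_Proj: "compilable (Proj i)"
  unfolding compilable_def
proof (intro allI impI)
  fix args :: "nat list" and out k
  assume *: "set args \<subseteq> {..<k}" "out < k" "out \<notin> set args"
  show "\<exists>p. adds_to (Proj i) args out k p"
  proof (cases "i < length args")
    case True
    then have "args ! i \<in> set args" by simp
    have "adds_to (Proj i) args out k (copy (args ! i) out k)"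
      unfolding adds_to_def
    proof (intro allI impI)
      fix s s' assume s: "clean k s"
      have "(s, s') \<in> sem (copy (args ! i) out k) \<longleftrightarrow> s' = s(out := s out + s (args ! i))"
        using * s \<open>args ! i \<in> set args\<close> by (intro sem_copy) (auto simp: clean_def)
      then show "(s, s') \<in> sem (copy (args ! i) out k) \<longleftrightarrow>
          (\<exists>y. rec_eval (Proj i) (map s args) y \<and> s' = s(out := s out + y))"
        using True by (simp add: rec_eval_Proj)
    qed
    then show ?thesis by blast
  next
    case False
    then show ?thesis by (intro exI[of _ "fail 0"] adds_to_fail) (auto simp: rec_eval_Proj)
  qed
qed

definition store :: "nat \<Rightarrow> nat list \<Rightarrow> (nat \<Rightarrow> nat) \<Rightarrow> nat \<Rightarrow> nat" where
  "store j ys s r = (if j \<le> r \<and> r < j + length ys then ys ! (r - j) else s r)"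

text \<open>The values go to consecutive registers from \<open>j\<close> on: once the head has
  filled register \<open>j\<close>, the remaining programs treat it as occupied and work above
  it.\<close>

lemma compile_list:
  assumes "\<And>g. g \<in> set gs \<Longrightarrow> compilable g" "set args \<subseteq> {..<j}"
  shows "\<exists>p. \<forall>s s'. clean j s \<longrightarrow> ((s, s') \<in> sem p \<longleftrightarrow>
    (\<exists>ys. list_all2 (\<lambda>g y. rec_eval g (map s args) y) gs ys \<and> s' = store j ys s))"
  using assms
proof (induction gs arbitrary: j)
  case Nil
  have "store j [] s = s" for s by (auto simp: store_def fun_eq_iff)
  then show ?case by (intro exI[of _ "Op Nop"]) simp
next
  case (Cons g gs)
  have "set args \<subseteq> {..<Suc j}" using Cons.prems(2) by auto
  with Cons obtain p where p: "\<And>s s'. clean (Suc j) s \<Longrightarrow> (s, s') \<in> sem p \<longleftrightarrow>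
    (\<exists>ys. list_all2 (\<lambda>g y. rec_eval g (map s args) y) gs ys \<and> s' = store (Suc j) ys s)"
    by (metis list.set_intros(2))
  obtain q where q: "adds_to g args j (Suc j) q"
    by (rule compilableD[of g args "Suc j" j]) (use Cons.prems in auto)
  have "(s, s') \<in> sem (Seq q p) \<longleftrightarrow>
    (\<exists>ys. list_all2 (\<lambda>g y. rec_eval g (map s args) y) (g # gs) ys \<and> s' = store j ys s)" if s: "clean j s" for s s'
  proof -
    have cl: "clean (Suc j) s" "s j = 0" using s by (auto simp: clean_def)
    have cl': "clean (Suc j) (s(j := y))" for y using s by (auto simp: clean_def)
    have mp: "map (s(j := y)) args = map s args" for y using Cons.prems(2) by auto
    have st: "store (Suc j) ys (s(j := y)) = store j (y # ys) s" for y ys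
      by (auto simp: store_def fun_eq_iff nth_Cons' Suc_le_eq) 
    have "(s, s') \<in> sem (Seq q p) \<longleftrightarrow> (\<exists>y. rec_eval g (map s args) y \<and> (s(j := y), s') \<in> sem p)"
      using q cl by (auto simp: adds_to_def relcomp_unfold)
    also have "\<dots> \<longleftrightarrow> (\<exists>y ys. rec_eval g (map s args) y \<and>
        list_all2 (\<lambda>g y. rec_eval g (map s args) y) gs ys \<and> s' = store j (y # ys) s)"
      unfolding p[OF cl'] mp st by blast
    also have "\<dots> \<longleftrightarrow> (\<exists>ys. list_all2 (\<lambda>g y. rec_eval g (map s args) y) (g # gs) ys \<and> s' = store j ys s)"
    proof (intro iffI; elim exE conjE)
      fix y ys
      assume "rec_eval g (map s args) y" "list_all2 (\<lambda>g y. rec_eval g (map s args) y) gs ys" "s' = store j (y # ys) s"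
      then show "\<exists>ys. list_all2 (\<lambda>g y. rec_eval g (map s args) y) (g # gs) ys \<and> s' = store j ys s"
        by (intro exI[of _ "y # ys"]) simp
    next
      fix zs assume "list_all2 (\<lambda>g y. rec_eval g (map s args) y) (g # gs) zs" "s' = store j zs s"
      then show "\<exists>y ys. rec_eval g (map s args) y \<and>
          list_all2 (\<lambda>g y. rec_eval g (map s args) y) gs ys \<and> s' = store j (y # ys) s"
        by (cases zs) auto
    qed
    finally show ?thesis .
  qed
  then show ?case by blast
qed

lemma sem_clears: "(s, s') \<in> sem (foldr (\<lambda>r. Seq (clear r)) rs (Op Nop)) \<longleftrightarrow>
    s' = (\<lambda>r. if r \<in> set rs then 0 else s r)"
proof (induction rs arbitrary: s)
  case (Cons a rs)
  have "(\<lambda>r. if r \<in> set rs then 0 else (s(a := 0)) r) = (\<lambda>r. if r \<in> set (a # rs) then 0 else s r)"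
    by (auto simp: fun_eq_iff)
  then show ?case unfolding foldr.simps comp_apply in_sem_Seq sem_clear Cons.IH by simp
qed simp

lemma compilable_Comp:
  assumes f: "compilable f" and gs: "\<And>g. g \<in> set gs \<Longrightarrow> compilable g"
  shows "compilable (Comp f gs)"
  unfolding compilable_def
proof (intro allI impI)
  fix args :: "nat list" and out k
  assume *: "set args \<subseteq> {..<k}" "out < k" "out \<notin> set args"
  let ?n = "length gs" and ?rs = "[k..<k + length gs]"
  obtain p where p: "\<And>s s'. clean k s \<Longrightarrow> (s, s') \<in> sem p \<longleftrightarrow>
    (\<exists>ys. list_all2 (\<lambda>g y. rec_eval g (map s args) y) gs ys \<and> s' = store k ys s)"
    using compile_list[OF gs *(1)] by blast
  obtain q where q: "adds_to f ?rs out (k + ?n) q"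
    by (rule compilableD[OF f, of ?rs "k + ?n" out]) (use * in auto)
  let ?c = "foldr (\<lambda>r. Seq (clear r)) ?rs (Op Nop)"
  have "adds_to (Comp f gs) args out k (Seq p (Seq q ?c))"
    unfolding adds_to_def
  proof (intro allI impI)
    fix s s' assume s: "clean k s"
    have sub: "(store k ys s, s') \<in> sem (Seq q ?c) \<longleftrightarrow> (\<exists>y. rec_eval f ys y \<and> s' = s(out := s out + y))"
      if "length ys = ?n" for ys
    proof -
      have "clean (k + ?n) (store k ys s)" using s that by (auto simp: clean_def store_def)
      moreover have "map (store k ys s) ?rs = ys" using that by (auto simp: store_def intro: nth_equalityI)
      ultimately have "(store k ys s, t) \<in> sem q \<longleftrightarrow>
          (\<exists>y. rec_eval f ys y \<and> t = (store k ys s)(out := store k ys s out + y))" for t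
        using q by (simp add: adds_to_def)
      moreover have "(\<lambda>r. if r \<in> set ?rs then 0 else ((store k ys s)(out := store k ys s out + y)) r) =
          s(out := s out + y)" for y
        using s *(2) that by (auto simp: store_def clean_def fun_eq_iff)
      ultimately show ?thesis unfolding in_sem_Seq[of _ _ q] sem_clears by auto
    qed
    have "(s, s') \<in> sem (Seq p (Seq q ?c)) \<longleftrightarrow>
        (\<exists>ys. list_all2 (\<lambda>g y. rec_eval g (map s args) y) gs ys \<and> (store k ys s, s') \<in> sem (Seq q ?c))"
      unfolding in_sem_Seq[of _ _ p] using p[OF s] by auto
    also have "\<dots> \<longleftrightarrow> (\<exists>y. rec_eval (Comp f gs) (map s args) y \<and> s' = s(out := s out + y))"
      unfolding rec_eval_Comp using sub list_all2_lengthD by fastforce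
    finally show "(s, s') \<in> sem (Seq p (Seq q ?c)) \<longleftrightarrow>
        (\<exists>y. rec_eval (Comp f gs) (map s args) y \<and> s' = s(out := s out + y))" .
  qed
  then show "\<exists>p. adds_to (Comp f gs) args out k p" by blast
qed

lemma in_sem_drain1: "i \<noteq> j \<Longrightarrow> (s, t) \<in> sem (drain i 1 j 1) \<longleftrightarrow> t = s(i := 0, j := s j + s i)"
  by (auto simp: sem_drain)

lemma compilable_PrimRec:
  assumes f: "compilable f" and g: "compilable g"
  shows "compilable (PrimRec f g)"
  unfolding compilable_def
proof (intro allI impI)
  fix args :: "nat list" and out k
  assume *: "set args \<subseteq> {..<k}" "out < k" "out \<notin> set args"
  show "\<exists>p. adds_to (PrimRec f g) args out k p"
  proof (cases args)
    case Nil
    then show ?thesis by (intro exI[of _ "fail 0"] adds_to_fail) (simp add: rec_eval_PrimRec_Nil)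
  next
    case (Cons a as)
    have a: "a < k" "a \<noteq> out" and as: "set as \<subseteq> {..<k}" using * Cons by auto
    \<comment> \<open>\<open>?i\<close> counts upwards because it is an argument of
      \<open>g\<close>; \<open>?m\<close> counts the remaining passes downwards because a machine
      can only test for 0.\<close>
    let ?i = k and ?m = "k + 1" and ?acc = "k + 2" and ?nw = "k + 3"
    obtain pf where pf: "adds_to f as ?acc (k + 4) pf"
      by (rule compilableD[OF f, of as "k + 4" ?acc]) (use as in auto)
    obtain pg where pg: "adds_to g (?i # ?acc # as) ?nw (k + 4) pg"
      by (rule compilableD[OF g, of "?i # ?acc # as" "k + 4" ?nw]) (use as in auto)
    define body where "body = Seq (Op (Dec ?m)) (Seq pg (Seq (clear ?acc) (Seq (drain ?nw 1 ?acc 1) (Op (Inc ?i)))))"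
    define exit where "exit = Seq (Op (Tst ?m)) (Seq (drain ?acc 1 out 1) (clear ?i))"
    define p where "p = Seq (copy a ?m (k + 4)) (Seq pf (Seq (Star body) exit))"
    have "adds_to (PrimRec f g) args out k p"
      unfolding adds_to_def
    proof (intro allI impI)
      fix s s' assume s: "clean k s"
      define n xs where "n = s a" and "xs = map s as"
      define St where "St j y v = s(?i := j, ?m := n - j, ?acc := y, ?nw := v)" for j y v
      have s0: "s r = 0" if "r \<ge> k" for r using s that by (simp add: clean_def)
      have cl: "clean (k + 4) (St j y v)" for j y v using s by (simp add: clean_def St_def)
      have mp: "map (St j y v) as = xs" for j y v using as by (auto simp: St_def xs_def)
      have St_sel: "St j y v ?i = j" "St j y v ?m = n - j" "St j y v ?acc = y" "St j y v ?nw = v" for j y v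
        by (auto simp: St_def)
      have init: "(s, t) \<in> sem (copy a ?m (k + 4)) \<longleftrightarrow> t = St 0 0 0" for t
        using a s0 by (subst sem_copy) (auto simp: St_def n_def fun_eq_iff)
      have base: "(St 0 0 0, t) \<in> sem pf \<longleftrightarrow> (\<exists>y. rec_eval f xs y \<and> t = St 0 y 0)" for t
      proof -
        have "(St 0 0 0)(?acc := St 0 0 0 ?acc + y) = St 0 y 0" for y by (auto simp: St_def fun_eq_iff)
        then show ?thesis using pf cl[of 0 0 0] by (simp add: adds_to_def mp)
      qed
      have loop: "(St j y 0, t) \<in> sem body \<longleftrightarrow> j < n \<and> (\<exists>z. rec_eval g (j # y # xs) z \<and> t = St (Suc j) z 0)"
        for j y t
      proof -
        let ?u = "(St j y 0)(?m := n - Suc j)"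
        have "clean (k + 4) ?u" using cl by (simp add: clean_def)
        then have "(?u, u) \<in> sem pg \<longleftrightarrow> (\<exists>z. rec_eval g (map ?u (?i # ?acc # as)) z \<and> u = ?u(?nw := ?u ?nw + z))" for u
          using pg by (simp add: adds_to_def)
        moreover have "map ?u (?i # ?acc # as) = j # y # xs" using as by (auto simp: St_def xs_def)
        moreover have "?u ?nw = 0" by (simp add: St_def)
        ultimately have pg': "(?u, u) \<in> sem pg \<longleftrightarrow> (\<exists>z. rec_eval g (j # y # xs) z \<and> u = ?u(?nw := z))" for u
          by simp
        have tail: "(?u(?nw := z), t) \<in> sem (Seq (clear ?acc) (Seq (drain ?nw 1 ?acc 1) (Op (Inc ?i)))) \<longleftrightarrow> t = St (Suc j) z 0" for z
        proof -
          let ?w = "?u(?nw := z, ?acc := 0)"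
          let ?w' = "?w(?nw := 0, ?acc := ?w ?acc + ?w ?nw)"
          have "?w'(?i := Suc (?w' ?i)) = St (Suc j) z 0" by (auto simp: St_def fun_eq_iff)
          moreover have "?nw \<noteq> ?acc" by simp
          ultimately show ?thesis
            by (simp only: in_sem_Seq sem_clear in_sem_drain1[OF \<open>?nw \<noteq> ?acc\<close>] sem.simps(1) mem_Collect_eq
                prod.case op_step.simps simp_thms)
        qed
        have "(St j y 0, u) \<in> sem (Op (Dec ?m)) \<longleftrightarrow> j < n \<and> u = ?u" for u
          unfolding sem.simps(1) mem_Collect_eq prod.case op_step.simps St_sel by auto
        moreover have "(?u, t) \<in> sem (Seq pg (Seq (clear ?acc) (Seq (drain ?nw 1 ?acc 1) (Op (Inc ?i))))) \<longleftrightarrow>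
            (\<exists>z. rec_eval g (j # y # xs) z \<and> t = St (Suc j) z 0)"
          unfolding in_sem_Seq[of _ _ pg] pg' tail[symmetric] by blast
        ultimately show ?thesis
          by (simp only: body_def in_sem_Seq[of _ _ "Op (Dec ?m)"] simp_thms conj_assoc ex_simps)
      qed
      have star: "(St 0 y0 0, t) \<in> (sem body)\<^sup>* \<longleftrightarrow>
          (\<exists>j\<le>n. \<exists>y. rec_eval (PrimRec f g) (j # xs) y \<and> t = St j y 0)" if y0: "rec_eval f xs y0" for y0 t
      proof
        assume "(St 0 y0 0, t) \<in> (sem body)\<^sup>*"
        then show "\<exists>j\<le>n. \<exists>y. rec_eval (PrimRec f g) (j # xs) y \<and> t = St j y 0"
        proof (induction rule: rtrancl_induct)
          case base
          then show ?case using y0 rec_eval_PrimRec_0 by blast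
        next
          case (step t u)
          then obtain j y where j: "j \<le> n" "rec_eval (PrimRec f g) (j # xs) y" "t = St j y 0" by blast
          with step(2) loop obtain z where "j < n" "rec_eval g (j # y # xs) z" "u = St (Suc j) z 0" by blast
          with j show ?case using rec_eval_PrimRec_Suc Suc_leI by blast
        qed
      next
        assume "\<exists>j\<le>n. \<exists>y. rec_eval (PrimRec f g) (j # xs) y \<and> t = St j y 0"
        then obtain j y where "j \<le> n" "rec_eval (PrimRec f g) (j # xs) y" "t = St j y 0" by blast
        then show "(St 0 y0 0, t) \<in> (sem body)\<^sup>*"
        proof (induction j arbitrary: y t)
          case 0
          then have "y = y0" using y0 rec_eval_deterministic unfolding rec_eval_PrimRec_0 by blast
          then show ?case using 0 by simp
        next
          case (Suc j)
          then obtain x where x: "rec_eval (PrimRec f g) (j # xs) x" "rec_eval g (j # x # xs) y"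
            unfolding rec_eval_PrimRec_Suc by blast
          then have "(St 0 y0 0, St j x 0) \<in> (sem body)\<^sup>*" using Suc by simp
          moreover have "(St j x 0, t) \<in> sem body" using loop x Suc.prems by auto
          ultimately show ?case by (rule rtrancl_into_rtrancl)
        qed
      qed
      have exit: "(St j y 0, t) \<in> sem exit \<longleftrightarrow> n \<le> j \<and> t = s(out := s out + y)" if "j \<le> n" for j y t
      proof -
        have "((St j y 0)(?acc := 0, out := St j y 0 out + St j y 0 ?acc))(?i := 0) = s(out := s out + y)" if "j = n"
          using *(2) s0 that by (auto simp: St_def fun_eq_iff)
        moreover have "?acc \<noteq> out" using *(2) by simp
        ultimately show ?thesis
          unfolding exit_def in_sem_Seq sem_clear in_sem_drain1[OF \<open>?acc \<noteq> out\<close>] sem.simps(1) mem_Collect_eq prod.case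
            op_step.simps St_sel(2)
          using that by auto
      qed
      have "(s, s') \<in> sem p \<longleftrightarrow> (\<exists>y0. rec_eval f xs y0 \<and> (\<exists>t. (St 0 y0 0, t) \<in> (sem body)\<^sup>* \<and> (t, s') \<in> sem exit))"
        unfolding p_def in_sem_Seq[of _ _ "copy a ?m (k + 4)"] in_sem_Seq[of _ _ pf] in_sem_Seq[of _ _ "Star body"]
          sem.simps(4)[of body] init simp_thms base by blast
      also have "\<dots> \<longleftrightarrow> (\<exists>y0. rec_eval f xs y0) \<and>
          (\<exists>y. rec_eval (PrimRec f g) (n # xs) y \<and> s' = s(out := s out + y))"
        using star exit by (metis (no_types, lifting) le_antisym le_refl)
      also have "\<dots> \<longleftrightarrow> (\<exists>y. rec_eval (PrimRec f g) (n # xs) y \<and> s' = s(out := s out + y))"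
      proof -
        \<comment> \<open>Every run of the program passes through \<open>pf\<close>, so this value
          must exist; the recursion for any \<open>n\<close> descends to it.\<close>
        have "\<exists>y0. rec_eval f xs y0" if "rec_eval (PrimRec f g) (n # xs) y" for y
          using that by (induction n arbitrary: y) (auto simp: rec_eval_PrimRec_0 rec_eval_PrimRec_Suc)
        then show ?thesis by blast
      qed
      finally show "(s, s') \<in> sem p \<longleftrightarrow>
          (\<exists>y. rec_eval (PrimRec f g) (map s args) y \<and> s' = s(out := s out + y))"
        by (simp add: Cons n_def xs_def)
    qed
    then show ?thesis by blast
  qed
qed

lemma compilable_Mu:
  assumes f: "compilable f"
  shows "compilable (Mu f)"
  unfolding compilable_def
proof (intro allI impI)
  fix args :: "nat list" and out k
  assume *: "set args \<subseteq> {..<k}" "out < k" "out \<notin> set args"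
  let ?i = k and ?v = "k + 1"
  obtain pf where pf: "adds_to f (?i # args) ?v (k + 2) pf"
    by (rule compilableD[OF f, of "?i # args" "k + 2" ?v]) (use * in auto)
  \<comment> \<open>The decrement of \<open>?v\<close> is the guard that the last value was nonzero.
    Together with the test in \<open>exit\<close>, the search is forced to stop exactly at the first
    zero.\<close>
  define body where "body = Seq (Op (Dec ?v)) (Seq (clear ?v) (Seq (Op (Inc ?i)) pf))"
  define exit where "exit = Seq (Op (Tst ?v)) (drain ?i 1 out 1)"
  define p where "p = Seq pf (Seq (Star body) exit)"
  have "adds_to (Mu f) args out k p"
    unfolding adds_to_def
  proof (intro allI impI)
    fix s s' assume s: "clean k s"
    define xs where "xs = map s args"
    define St where "St j v = s(?i := j, ?v := v)" for j v
    have s0: "s r = 0" if "r \<ge> k" for r using s that by (simp add: clean_def)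
    have cl: "clean (k + 2) (St j v)" for j v using s by (simp add: clean_def St_def)
    have pf': "(St j 0, t) \<in> sem pf \<longleftrightarrow> (\<exists>v. rec_eval f (j # xs) v \<and> t = St j v)" for j t
    proof -
      have "(St j 0)(?v := St j 0 ?v + v) = St j v" for v by (auto simp: St_def fun_eq_iff)
      moreover have "map (St j 0) (?i # args) = j # xs" using *(1) by (auto simp: St_def xs_def)
      ultimately show ?thesis using pf cl[of j 0] by (simp add: adds_to_def)
    qed
    have s_St: "s = St 0 0" using s0 by (auto simp: St_def fun_eq_iff)
    have loop: "(St j v, t) \<in> sem body \<longleftrightarrow> v > 0 \<and> (\<exists>w. rec_eval f (Suc j # xs) w \<and> t = St (Suc j) w)" for j v t
    proof -
      have "(St j v, u) \<in> sem (Op (Dec ?v)) \<longleftrightarrow> v > 0 \<and> u = St j (v - 1)" for u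
        by (auto simp: St_def)
      moreover have "(St j w)(?v := 0) = St j 0" for w by (simp add: St_def)
      moreover have "(St j 0, u) \<in> sem (Op (Inc ?i)) \<longleftrightarrow> u = St (Suc j) 0" for u
      proof -
        have "(St j 0)(?i := Suc (St j 0 ?i)) = St (Suc j) 0" by (auto simp: St_def fun_eq_iff)
        then show ?thesis by simp
      qed
      ultimately show ?thesis
        by (simp only: body_def in_sem_Seq sem_clear pf' simp_thms ex_simps conj_assoc)
    qed
    have star: "(St 0 v0, t) \<in> (sem body)\<^sup>* \<longleftrightarrow>
        (\<exists>j v. rec_eval f (j # xs) v \<and> (\<forall>m<j. \<exists>y. rec_eval f (m # xs) (Suc y)) \<and> t = St j v)"
      if v0: "rec_eval f (0 # xs) v0" for v0 t
    proof
      assume "(St 0 v0, t) \<in> (sem body)\<^sup>*"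
      then show "\<exists>j v. rec_eval f (j # xs) v \<and> (\<forall>m<j. \<exists>y. rec_eval f (m # xs) (Suc y)) \<and> t = St j v"
      proof (induction rule: rtrancl_induct)
        case base
        then show ?case using v0 by blast
      next
        case (step t u)
        then obtain j v where j: "rec_eval f (j # xs) v" "\<forall>m<j. \<exists>y. rec_eval f (m # xs) (Suc y)" "t = St j v" by blast
        with step(2) loop obtain w where w: "v > 0" "rec_eval f (Suc j # xs) w" "u = St (Suc j) w" by blast
        have "\<exists>y. rec_eval f (m # xs) (Suc y)" if "m < Suc j" for m
          using that j w(1) by (cases "m = j") (auto simp: gr0_conv_Suc)
        with w show ?case by blast
      qed
    next
      assume "\<exists>j v. rec_eval f (j # xs) v \<and> (\<forall>m<j. \<exists>y. rec_eval f (m # xs) (Suc y)) \<and> t = St j v"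
      then obtain j v where "rec_eval f (j # xs) v" "\<forall>m<j. \<exists>y. rec_eval f (m # xs) (Suc y)" "t = St j v" by blast
      then show "(St 0 v0, t) \<in> (sem body)\<^sup>*"
      proof (induction j arbitrary: v t)
        case 0
        then have "v = v0" using v0 rec_eval_deterministic by blast
        then show ?case using 0 by simp
      next
        case (Suc j)
        then obtain y where y: "rec_eval f (j # xs) (Suc y)" by blast
        then have "(St 0 v0, St j (Suc y)) \<in> (sem body)\<^sup>*" using Suc by simp
        moreover have "(St j (Suc y), t) \<in> sem body" using loop Suc.prems by auto
        ultimately show ?case by (rule rtrancl_into_rtrancl)
      qed
    qed
    have exit: "(St j v, t) \<in> sem exit \<longleftrightarrow> v = 0 \<and> t = s(out := s out + j)" for j v t
    proof -
      have "(St j 0)(?i := 0, out := St j 0 out + St j 0 ?i) = s(out := s out + j)"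
        using *(2) s0 by (auto simp: St_def fun_eq_iff)
      moreover have "St j v ?v = v" by (simp add: St_def)
      moreover have "?i \<noteq> out" using *(2) by simp
      ultimately show ?thesis
        unfolding exit_def in_sem_Seq in_sem_drain1[OF \<open>?i \<noteq> out\<close>] sem.simps(1) mem_Collect_eq prod.case op_step.simps
        by auto
    qed
    have init: "(s, t) \<in> sem pf \<longleftrightarrow> (\<exists>v. rec_eval f (0 # xs) v \<and> t = St 0 v)" for t
      using pf'[of 0 t] unfolding s_St[symmetric] .
    have "(s, s') \<in> sem p \<longleftrightarrow> (\<exists>v0. rec_eval f (0 # xs) v0 \<and> (\<exists>t. (St 0 v0, t) \<in> (sem body)\<^sup>* \<and> (t, s') \<in> sem exit))"
      unfolding p_def in_sem_Seq[of _ _ pf] in_sem_Seq[of _ _ "Star body"] sem.simps(4)[of body] init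
      by blast
    also have "\<dots> \<longleftrightarrow> (\<exists>v0. rec_eval f (0 # xs) v0) \<and>
        (\<exists>j. rec_eval (Mu f) xs j \<and> s' = s(out := s out + j))"
    proof (intro iffI; elim exE conjE)
      fix v0 t assume v0: "rec_eval f (0 # xs) v0" and t: "(St 0 v0, t) \<in> (sem body)\<^sup>*" "(t, s') \<in> sem exit"
      then obtain j v where j: "rec_eval f (j # xs) v" "\<forall>m<j. \<exists>y. rec_eval f (m # xs) (Suc y)" "t = St j v"
        using star[OF v0] by blast
      with t(2) exit have "v = 0" "s' = s(out := s out + j)" by auto
      with j v0 show "(\<exists>v0. rec_eval f (0 # xs) v0) \<and> (\<exists>j. rec_eval (Mu f) xs j \<and> s' = s(out := s out + j))"
        unfolding rec_eval_Mu by blast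
    next
      fix v0 j assume v0: "rec_eval f (0 # xs) v0" and j: "rec_eval (Mu f) xs j" "s' = s(out := s out + j)"
      from j(1) have "(St 0 v0, St j 0) \<in> (sem body)\<^sup>*" using star[OF v0] unfolding rec_eval_Mu by blast
      moreover have "(St j 0, s') \<in> sem exit" using exit j(2) by simp
      ultimately show "\<exists>v0. rec_eval f (0 # xs) v0 \<and> (\<exists>t. (St 0 v0, t) \<in> (sem body)\<^sup>* \<and> (t, s') \<in> sem exit)"
        using v0 by blast
    qed
    also have "\<dots> \<longleftrightarrow> (\<exists>j. rec_eval (Mu f) xs j \<and> s' = s(out := s out + j))"
    proof -
      have "\<exists>v0. rec_eval f (0 # xs) v0" if "rec_eval (Mu f) xs j" for j
        using that unfolding rec_eval_Mu by (cases j) auto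
      then show ?thesis by blast
    qed
    finally show "(s, s') \<in> sem p \<longleftrightarrow>
        (\<exists>y. rec_eval (Mu f) (map s args) y \<and> s' = s(out := s out + y))"
      by (simp add: xs_def)
  qed
  then show "\<exists>p. adds_to (Mu f) args out k p" by blast
qed

lemma compilable: "compilable f"
proof (induction f)
  case (Comp f gs)
  then show ?case by (intro compilable_Comp) auto
qed (auto intro: compilable_Zero compilable_Succ compilable_Proj compilable_PrimRec compilable_Mu)

text \<open>The input number is the Goedel number of the registers loaded with the arguments, all
  others being 0, so the arguments need no unpacking and several of them fit into the single input
  of a two-counter machine.\<close>

theorem rec_eval_machine:
  obtains T :: "bool prog list trans set" and q0 where "finite T"
    "\<And>xs. length xs = n \<Longrightarrow>
      accepts T q0 [] (\<Prod>r<n. nth_prime r ^ (xs ! r)) \<longleftrightarrow> (\<exists>y. rec_eval f xs y)"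
proof -
  obtain p where p: "adds_to f [0..<n] n (Suc n) p"
    by (rule compilableD[OF compilable, of "[0..<n]" "Suc n" n]) auto
  obtain m0 where m0: "prog_regs p \<subseteq> {..<m0}"
    using finite_nat_bounded[OF finite_prog_regs] by blast
  define m where "m = max m0 n"
  have m: "prog_regs p \<subseteq> {..<m}" "n \<le> m" using m0 by (auto simp: m_def)
  show ?thesis
  proof (rule that[of "prog_trans (goedel_prog p)" "[goedel_prog p]"])
    show "finite (prog_trans (goedel_prog p))" by (rule finite_prog_trans)
    fix xs :: "nat list" assume n: "length xs = n"
    define s where "s r = (if r < n then xs ! r else 0)" for r
    have "goedel m s = (\<Prod>r<n. nth_prime r ^ (xs ! r))"
      unfolding goedel_def using m(2) by (intro prod.mono_neutral_cong_right) (auto simp: s_def)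
    moreover have "clean (Suc n) s" by (simp add: clean_def s_def)
    moreover have "map s [0..<n] = xs" using n by (auto simp: s_def intro: nth_equalityI)
    ultimately show "accepts (prog_trans (goedel_prog p)) [goedel_prog p] [] (\<Prod>r<n. nth_prime r ^ (xs ! r)) \<longleftrightarrow>
        (\<exists>y. rec_eval f xs y)"
      using p sem_goedel_prog[OF m(1), of s]
      by (auto simp: accepts_prog_trans adds_to_def start_counters_two)
  qed
qed

section \<open>Game instances and the diagonal argument\<close>

lemma satisfies_cong:
  assumes "\<And>k. w' (\<pi>' k, \<pi>' (Suc k)) = w (\<pi> k, \<pi> (Suc k))"
  shows "satisfies w' \<pi>' \<phi> \<longleftrightarrow> satisfies w \<pi> \<phi>"
proof (induction \<phi>)
  case (Atom i c \<nu>)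
  have "prefix_avg w' i \<pi>' = prefix_avg w i \<pi>"
    by (simp add: prefix_avg_def prefix_weight_def assms fun_eq_iff)
  then show ?case by (simp add: LimInfAvg_def)
qed simp_all

lemma player1_wins_rename:
  fixes enc :: "'u \<Rightarrow> 'v"
  assumes inj: "inj enc" and G: "is_game_graph G" and v0: "v0 \<in> verts G"
    and verts1: "verts1 G' = enc ` verts1 G" and verts: "verts G' = enc ` verts G"
    and edges: "edges G' = map_prod enc enc ` edges G"
    and w: "\<And>u v. (u, v) \<in> edges G \<Longrightarrow> w' (enc u, enc v) = w (u, v)"
  shows "player1_wins G' w' (enc v0) \<phi> \<longleftrightarrow> player1_wins G w v0 \<phi>"
proof -
  define dec where "dec = inv enc"
  have de [simp]: "dec (enc u) = u" for u using inj by (simp add: dec_def)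
  have e_iff [simp]: "(enc u, enc v) \<in> edges G' \<longleftrightarrow> (u, v) \<in> edges G" for u v
    using inj by (auto simp: edges dest: injD)
  have v1_iff [simp]: "enc u \<in> verts1 G' \<longleftrightarrow> u \<in> verts1 G" for u
    using inj by (simp add: verts1 inj_image_mem_iff)
  have ed: "enc (dec v) = v" if "(u, v) \<in> edges G'" for u v
    using that by (auto simp: edges)
  have de_o: "map dec (map enc h) = h" for h by (induction h) auto
  have sub: "edges G \<subseteq> verts G \<times> verts G" using G by (simp add: is_game_graph_def)
  have in_verts: "\<pi> k \<in> verts G" if "is_play G v0 \<pi>" for \<pi> k
    using that v0 sub by (cases k) (auto simp: is_play_def)
  show ?thesis
  proof
    assume "player1_wins G' w' (enc v0) \<phi>"
    then obtain \<tau>' where \<tau>': "is_strategy1 G' \<tau>'"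
      and win: "\<And>\<pi>. is_play G' (enc v0) \<pi> \<Longrightarrow> consistent1 G' \<tau>' \<pi> \<Longrightarrow> satisfies w' \<pi> \<phi>"
      unfolding player1_wins_def winning_strategy1_def by blast
    define \<tau> where "\<tau> h = dec (\<tau>' (map enc h))" for h
    have \<tau>'_edge: "(enc v, \<tau>' (map enc h @ [enc v])) \<in> edges G'" if "set h \<subseteq> verts G" "v \<in> verts1 G" for h v
      using \<tau>'[unfolded is_strategy1_def, rule_format, of "map enc h" "enc v"] that by (auto simp: verts)
    have "is_strategy1 G \<tau>"
      unfolding is_strategy1_def
    proof (intro allI impI)
      fix h v assume hv: "set h \<subseteq> verts G" "v \<in> verts1 G"
      have "(enc v, enc (dec (\<tau>' (map enc h @ [enc v])))) \<in> edges G'"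
        using \<tau>'_edge[OF hv] ed[OF \<tau>'_edge[OF hv]] by simp
      then show "(v, \<tau> (h @ [v])) \<in> edges G" by (simp add: \<tau>_def)
    qed
    moreover have "satisfies w \<pi> \<phi>" if p: "is_play G v0 \<pi>" and c: "consistent1 G \<tau> \<pi>" for \<pi>
    proof -
      have "is_play G' (enc v0) (enc \<circ> \<pi>)" using p by (simp add: is_play_def)
      moreover have "consistent1 G' \<tau>' (enc \<circ> \<pi>)"
        unfolding consistent1_def
      proof (intro allI impI)
        fix k assume "(enc \<circ> \<pi>) k \<in> verts1 G'"
        then have k: "\<pi> k \<in> verts1 G" by simp
        have h: "set (map \<pi> [0..<k]) \<subseteq> verts G" using in_verts[OF p] by auto
        have "enc (\<pi> (Suc k)) = enc (dec (\<tau>' (map enc (map \<pi> [0..<k]) @ [enc (\<pi> k)])))"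
          using c k by (simp add: consistent1_def \<tau>_def)
        also have "\<dots> = \<tau>' (map enc (map \<pi> [0..<k]) @ [enc (\<pi> k)])" using ed[OF \<tau>'_edge[OF h k]] .
        finally show "(enc \<circ> \<pi>) (Suc k) = \<tau>' (map (enc \<circ> \<pi>) [0..<Suc k])" by simp
      qed
      ultimately have "satisfies w' (enc \<circ> \<pi>) \<phi>" by (rule win)
      also have "satisfies w' (enc \<circ> \<pi>) \<phi> \<longleftrightarrow> satisfies w \<pi> \<phi>"
        by (rule satisfies_cong) (use p w in \<open>simp add: is_play_def\<close>)
      finally show ?thesis .
    qed
    ultimately show "player1_wins G w v0 \<phi>" unfolding player1_wins_def winning_strategy1_def by blast
  next
    assume "player1_wins G w v0 \<phi>"
    then obtain \<tau> where \<tau>: "is_strategy1 G \<tau>"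
      and win: "\<And>\<pi>. is_play G v0 \<pi> \<Longrightarrow> consistent1 G \<tau> \<pi> \<Longrightarrow> satisfies w \<pi> \<phi>"
      unfolding player1_wins_def winning_strategy1_def by blast
    define \<tau>' where "\<tau>' h = enc (\<tau> (map dec h))" for h
    have "is_strategy1 G' \<tau>'"
      unfolding is_strategy1_def
    proof (intro allI impI)
      fix h v assume hv: "set h \<subseteq> verts G'" "v \<in> verts1 G'"
      then obtain u where u: "v = enc u" "u \<in> verts1 G" by (auto simp: verts1)
      have "set (map dec h) \<subseteq> verts G" using hv(1) by (auto simp: verts)
      then have "(u, \<tau> (map dec h @ [u])) \<in> edges G" using \<tau> u(2) by (simp add: is_strategy1_def)
      then show "(v, \<tau>' (h @ [v])) \<in> edges G'" by (simp add: \<tau>'_def u(1))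
    qed
    moreover have "satisfies w' \<pi>' \<phi>" if p: "is_play G' (enc v0) \<pi>'" and c: "consistent1 G' \<tau>' \<pi>'" for \<pi>'
    proof -
      define \<pi> where "\<pi> = dec \<circ> \<pi>'"
      have "enc (dec (\<pi>' k)) = \<pi>' k" for k
        using p ed by (cases k) (auto simp: is_play_def)
      then have \<pi>': "\<pi>' k = enc (\<pi> k)" for k by (simp add: \<pi>_def)
      have play: "is_play G v0 \<pi>"
        using p inj unfolding is_play_def \<pi>' by (auto dest: injD)
      moreover have "consistent1 G \<tau> \<pi>"
        unfolding consistent1_def
      proof (intro allI impI)
        fix k assume "\<pi> k \<in> verts1 G"
        then have "enc (\<pi> (Suc k)) = enc (\<tau> (map dec (map \<pi>' [0..<Suc k])))"
          using c unfolding consistent1_def \<tau>'_def by (metis \<pi>' v1_iff)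
        moreover have "map dec (map \<pi>' [0..<Suc k]) = map \<pi> [0..<Suc k]" by (simp add: \<pi>_def)
        ultimately show "\<pi> (Suc k) = \<tau> (map \<pi> [0..<Suc k])" using inj by (metis injD)
      qed
      ultimately have "satisfies w \<pi> \<phi>" by (rule win)
      moreover have "satisfies w' \<pi>' \<phi> \<longleftrightarrow> satisfies w \<pi> \<phi>"
        by (rule satisfies_cong) (use play w in \<open>simp add: is_play_def \<pi>'\<close>)
      ultimately show ?thesis by simp
    qed
    ultimately show "player1_wins G' w' (enc v0) \<phi>" unfolding player1_wins_def winning_strategy1_def by blast
  qed
qed

instance op :: (countable) countable by countable_datatype
instance prog :: (countable) countable by countable_datatype
instance cnt :: countable by countable_datatype
instance vertex :: (countable) countable by countable_datatype

text \<open>The loop at \<open>Scale\<close> heads the arc list because its weight is the only part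
  that depends on \<open>x\<close>: the rest of the list then has a constant code, which is simply
  paired with the code of the head.\<close>

definition machine_instance ::
    "'q::countable vertex list \<Rightarrow> 'q vertex list \<Rightarrow> ('q vertex \<times> 'q vertex) list \<Rightarrow> nat \<Rightarrow> mp_instance" where
  "machine_instance l1 l2 es x =
     \<lparr>vlist1 = map to_nat l1, vlist2 = map to_nat l2,
      arcs = map (\<lambda>(u, v). ((to_nat u, to_nat v), wvec x (u, v))) ((Scale, Scale) # es),
      init = to_nat (Reset :: 'q vertex), cond = game_cond\<rparr>"

lemma machine_instance_correct:
  fixes T :: "'q::countable trans set"
  assumes T: "finite T" and l: "set l1 = vertices1 T q0 qf" "set l2 = vertices2 T"
    and es: "distinct ((Scale, Scale) # es)" "set ((Scale, Scale) # es) = {(u, v). edge T q0 qf u v}"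
  shows "valid_instance (machine_instance l1 l2 es x)"
    "instance_wins (machine_instance l1 l2 es x) \<longleftrightarrow> accepts T q0 qf x"
proof -
  let ?I = "machine_instance l1 l2 es x" and ?G = "machine_game T q0 qf"
  let ?e = "to_nat :: 'q vertex \<Rightarrow> nat"
  let ?es = "(Scale, Scale) # es"
  have inj: "inj ?e" by simp
  have fst_arcs: "map fst (arcs ?I) = map (map_prod ?e ?e) ?es"
    by (auto simp: machine_instance_def)
  have G: "is_game_graph ?G" using T by (rule is_game_graph_machine_game)
  have gI: "verts1 (graph_of ?I) = ?e ` verts1 ?G" "verts2 (graph_of ?I) = ?e ` verts2 ?G"
    "verts (graph_of ?I) = ?e ` verts ?G" "edges (graph_of ?I) = map_prod ?e ?e ` edges ?G"
    unfolding graph_of_def game_graph.simps fst_arcs set_map es(2)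
    by (auto simp: machine_instance_def machine_game_def l)
  have dist: "distinct (map fst (arcs ?I))"
    unfolding fst_arcs distinct_map using es(1) by (auto intro: map_prod_inj_on[OF inj inj, THEN inj_on_subset] simp del: distinct.simps)
  have Reset: "Reset \<in> verts ?G" by (simp add: machine_game_def vertices1_def)
  have "is_game_graph (graph_of ?I)"
  proof -
    have "\<exists>u. (v, u) \<in> edges (graph_of ?I)" if "v \<in> verts (graph_of ?I)" for v
    proof -
      from that obtain v' where v': "v = ?e v'" "v' \<in> verts ?G" unfolding gI by (rule imageE)
      then obtain u where "(v', u) \<in> edges ?G" using G by (auto simp: is_game_graph_def)
      then show ?thesis unfolding gI v' by (intro exI[of _ "?e u"] image_eqI[of _ _ "(v', u)"]) auto
    qed
    moreover have "edges (graph_of ?I) \<subseteq> verts (graph_of ?I) \<times> verts (graph_of ?I)"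
      unfolding gI using G by (force simp: is_game_graph_def)
    moreover have "finite (verts (graph_of ?I))" unfolding gI using G by (simp add: is_game_graph_def)
    moreover have "verts1 (graph_of ?I) \<union> verts2 (graph_of ?I) = verts (graph_of ?I)"
      unfolding gI image_Un[symmetric] using G by (simp add: is_game_graph_def)
    moreover have "verts1 (graph_of ?I) \<inter> verts2 (graph_of ?I) = {}"
      unfolding gI image_Int[OF inj, symmetric] using G by (simp add: is_game_graph_def)
    ultimately show ?thesis by (simp add: is_game_graph_def)
  qed
  moreover have "init ?I \<in> verts (graph_of ?I)"
    unfolding gI using Reset by (auto simp: machine_instance_def)
  ultimately show "valid_instance ?I" using dist by (simp add: valid_instance_def)
  have w: "weight_of ?I (?e u, ?e v) = wvec x (u, v)" if "(u, v) \<in> edges ?G" for u v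
  proof -
    have "(u, v) \<in> set ?es" using that es(2) by simp
    then have "((?e u, ?e v), wvec x (u, v)) \<in> set (arcs ?I)"
      unfolding machine_instance_def mp_instance.simps set_map by force
    then show ?thesis using dist by (simp add: weight_of_def)
  qed
  have "instance_wins ?I \<longleftrightarrow> player1_wins ?G (wvec x) Reset game_cond"
    using player1_wins_rename[where G = ?G and G' = "graph_of ?I" and enc = ?e and w = "wvec x" and w' = "weight_of ?I",
        OF inj G Reset gI(1,3,4) w, of game_cond]
    by (simp add: instance_wins_def machine_instance_def)
  then show "instance_wins ?I \<longleftrightarrow> accepts T q0 qf x"
    using player1_wins_machine_game[OF T] not_player1_wins[OF T] by blast
qed

section \<open>Computing the code of an instance from its constant parts\<close>

definition computable :: "nat \<Rightarrow> (nat list \<Rightarrow> nat) \<Rightarrow> bool" where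
  "computable n g \<longleftrightarrow> (\<exists>f. \<forall>xs. length xs = n \<longrightarrow> rec_eval f xs (g xs))"

lemma computable_const: "computable n (\<lambda>_. c)"
proof (induction c)
  case 0 show ?case unfolding computable_def by (intro exI[of _ Zero]) (simp add: rec_eval_Zero)
next
  case (Suc c)
  then obtain f where f: "\<And>xs. length xs = n \<Longrightarrow> rec_eval f xs c" by (auto simp: computable_def)
  have "rec_eval (Comp Succ [f]) xs (Suc c)" if "length xs = n" for xs
    unfolding rec_eval_Comp using f[OF that] by (intro exI[of _ "[c]"]) (simp add: rec_eval_Succ)
  then show ?case by (auto simp: computable_def)
qed

lemma computable_nth: "i < n \<Longrightarrow> computable n (\<lambda>xs. xs ! i)"
  unfolding computable_def by (intro exI[of _ "Proj i"]) (simp add: rec_eval_Proj)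

lemma computable_comp:
  assumes h: "computable (length gs) h" and gs: "\<forall>g\<in>set gs. computable n g"
  shows "computable n (\<lambda>xs. h (map (\<lambda>g. g xs) gs))"
proof -
  obtain f where f: "\<And>xs. length xs = length gs \<Longrightarrow> rec_eval f xs (h xs)"
    using h by (auto simp: computable_def)
  define F where "F g = (SOME f. \<forall>xs. length xs = n \<longrightarrow> rec_eval f xs (g xs))" for g
  have F: "rec_eval (F g) xs (g xs)" if "g \<in> set gs" "length xs = n" for g xs
  proof -
    have "\<exists>f. \<forall>xs. length xs = n \<longrightarrow> rec_eval f xs (g xs)" using gs that(1) by (simp add: computable_def)
    from someI_ex[OF this] show ?thesis using that(2) by (simp add: F_def)
  qed
  have "rec_eval (Comp f (map F gs)) xs (h (map (\<lambda>g. g xs) gs))" if "length xs = n" for xs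
    unfolding rec_eval_Comp
    by (intro exI[of _ "map (\<lambda>g. g xs) gs"]) (auto simp: list_all2_conv_all_nth F f that)
  then show ?thesis by (auto simp: computable_def)
qed

lemma computable_comp1:
  assumes "computable 1 (\<lambda>xs. h (xs ! 0))" "computable n g"
  shows "computable n (\<lambda>xs. h (g xs))"
  using computable_comp[of "[g]" "\<lambda>xs. h (xs ! 0)" n] assms by simp

lemma computable_comp2:
  assumes "computable 2 (\<lambda>xs. h (xs ! 0) (xs ! 1))" "computable n g1" "computable n g2"
  shows "computable n (\<lambda>xs. h (g1 xs) (g2 xs))"
  using computable_comp[of "[g1, g2]" "\<lambda>xs. h (xs ! 0) (xs ! 1)" n] assms by (simp add: numeral_2_eq_2)

lemma computable_primrec:
  assumes "computable n f" "computable (Suc (Suc n)) g"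
    and "\<And>ys. h 0 ys = f ys" "\<And>k ys. h (Suc k) ys = g (k # h k ys # ys)"
  shows "computable (Suc n) (\<lambda>xs. h (hd xs) (tl xs))"
proof -
  obtain f' where f': "\<And>xs. length xs = n \<Longrightarrow> rec_eval f' xs (f xs)"
    using assms(1) by (auto simp: computable_def)
  obtain g' where g': "\<And>xs. length xs = Suc (Suc n) \<Longrightarrow> rec_eval g' xs (g xs)"
    using assms(2) by (auto simp: computable_def)
  have "rec_eval (PrimRec f' g') (k # ys) (h k ys)" if "length ys = n" for k ys
  proof (induction k)
    case 0 then show ?case using f' that assms(3) by (simp add: rec_eval_PrimRec_0)
  next
    case (Suc k)
    then show ?case using g'[of "k # h k ys # ys"] that assms(4) rec_eval_PrimRec_Suc by auto
  qed
  then have "rec_eval (PrimRec f' g') xs (h (hd xs) (tl xs))" if "length xs = Suc n" for xs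
    using that by (cases xs) auto
  then show ?thesis by (auto simp: computable_def)
qed

lemma computable_cong:
  assumes "computable n g" "\<And>xs. length xs = n \<Longrightarrow> g xs = g' xs"
  shows "computable n g'"
  using assms unfolding computable_def by metis

lemma computable_Suc:
  assumes "computable n g" shows "computable n (\<lambda>xs. Suc (g xs))"
proof (rule computable_comp1[OF _ assms])
  show "computable 1 (\<lambda>xs. Suc (xs ! 0))"
    unfolding computable_def by (intro exI[of _ Succ]) (auto simp: rec_eval_Succ length_Suc_conv)
qed

lemma computable_add:
  assumes "computable n g1" "computable n g2" shows "computable n (\<lambda>xs. g1 xs + g2 xs)"
proof (rule computable_comp2[OF _ assms])
  have "computable (Suc 1) (\<lambda>xs. (\<lambda>k ys. k + ys ! 0) (hd xs) (tl xs))"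
    by (rule computable_primrec[where f = "\<lambda>ys. ys ! 0" and g = "\<lambda>ys. Suc (ys ! 1)"])
      (auto intro!: computable_Suc computable_nth)
  then have "computable 2 (\<lambda>xs. (\<lambda>k ys. k + ys ! 0) (hd xs) (tl xs))" by (simp only: Suc_1)
  then show "computable 2 (\<lambda>xs. xs ! 0 + xs ! 1)"
    by (rule computable_cong) (auto simp: length_Suc_conv numeral_2_eq_2)
qed

lemma computable_mult:
  assumes "computable n g1" "computable n g2" shows "computable n (\<lambda>xs. g1 xs * g2 xs)"
proof (rule computable_comp2[OF _ assms])
  have "computable (Suc 1) (\<lambda>xs. (\<lambda>k ys. k * ys ! 0) (hd xs) (tl xs))"
    by (rule computable_primrec[where f = "\<lambda>ys. 0" and g = "\<lambda>ys. ys ! 2 + ys ! 1"])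
      (auto intro!: computable_add computable_nth computable_const)
  then have "computable 2 (\<lambda>xs. (\<lambda>k ys. k * ys ! 0) (hd xs) (tl xs))" by (simp only: Suc_1)
  then show "computable 2 (\<lambda>xs. xs ! 0 * xs ! 1)"
    by (rule computable_cong) (auto simp: length_Suc_conv numeral_2_eq_2)
qed

lemma computable_power:
  assumes "computable n g" shows "computable n (\<lambda>xs. p ^ g xs)"
proof (rule computable_comp1[OF _ assms])
  have "computable (Suc 0) (\<lambda>xs. (\<lambda>k ys. p ^ k) (hd xs) (tl xs))"
    by (rule computable_primrec[where f = "\<lambda>ys. 1" and g = "\<lambda>ys. p * ys ! 1"])
      (auto intro!: computable_mult computable_nth computable_const)
  then show "computable 1 (\<lambda>xs. p ^ (xs ! 0))"
    unfolding One_nat_def by (rule computable_cong) (auto simp: length_Suc_conv)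
qed

lemma computable_prod_encode:
  assumes "computable n g1" "computable n g2" shows "computable n (\<lambda>xs. prod_encode (g1 xs, g2 xs))"
proof -
  have "computable (Suc 0) (\<lambda>xs. (\<lambda>k ys. triangle k) (hd xs) (tl xs))"
    by (rule computable_primrec[where f = "\<lambda>ys. 0" and g = "\<lambda>ys. ys ! 1 + Suc (ys ! 0)"])
      (auto intro!: computable_add computable_Suc computable_nth computable_const)
  then have "computable 1 (\<lambda>xs. triangle (xs ! 0))"
    unfolding One_nat_def by (rule computable_cong) (auto simp: length_Suc_conv)
  then have "computable n (\<lambda>xs. triangle (g1 xs + g2 xs))"
    by (rule computable_comp1) (intro computable_add assms)
  then have "computable n (\<lambda>xs. triangle (g1 xs + g2 xs) + g1 xs)"
    by (intro computable_add assms)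
  then show ?thesis by (simp add: prod_encode_def)
qed

lemma computable_list_encode:
  "\<forall>g\<in>set gs. computable n g \<Longrightarrow> computable n (\<lambda>xs. list_encode (map (\<lambda>g. g xs) gs))"
  by (induction gs) (auto intro: computable_const computable_Suc computable_prod_encode)

text \<open>Each weight of the loop is affine in \<open>x\<close> with natural coefficients that
  depend on the dimension only. Such a weight has denominator 1, and a natural number
  \<open>m\<close> has the integer code \<open>2 * m\<close>, so addition, multiplication and
  pairing suffice.\<close>

lemma computable_scale_code:
  assumes "computable n g"
  shows "computable n (\<lambda>xs. vec_code (wvec (g xs) (Scale :: 'q vertex, Scale)))"
proof -
  define \<alpha> where "\<alpha> d = nat (scale_vec 1 d - scale_vec 0 d)" for d
  define \<beta> where "\<beta> d = nat (scale_vec 0 d)" for d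
  have affine: "scale_vec x d = int (\<alpha> d * x + \<beta> d)" for x d
  proof (cases d)
    case (Pos i) then show ?thesis by (cases i) (auto simp: \<alpha>_def \<beta>_def)
  next
    case (Neg i) then show ?thesis by (cases i) (auto simp: \<alpha>_def \<beta>_def)
  qed (auto simp: \<alpha>_def \<beta>_def)
  have rat: "rat_code (of_int (int m)) = prod_encode (2 * m, int_encode 1)" for m
  proof -
    have "quotient_of (rat_of_int (int m)) = (int m, 1)" by (simp add: of_int_rat quotient_of_Fract Rat.normalize_def)
    then show ?thesis by (simp add: rat_code_def int_encode_def sum_encode_def)
  qed
  define D where "D k = inv dim_bij (of_nat k)" for k
  have "vec_code (wvec (g xs) (Scale :: 'q vertex, Scale)) =
      list_encode (map (\<lambda>h. h xs) (map (\<lambda>k xs. prod_encode (2 * (\<alpha> (D k) * g xs + \<beta> (D k)), int_encode 1)) [1..<11]))" for xs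
    unfolding vec_code_def wvec_def vec_lambda_beta wt_simps affine rat D_def map_map comp_def ..
  moreover have "computable n (\<lambda>xs. list_encode (map (\<lambda>h. h xs)
      (map (\<lambda>k xs. prod_encode (2 * (\<alpha> (D k) * g xs + \<beta> (D k)), int_encode 1)) [1..<11])))"
    by (rule computable_list_encode)
      (auto intro!: computable_prod_encode computable_mult computable_add computable_const assms)
  ultimately show ?thesis by (simp only:)
qed

text \<open>The game of a machine run on the description of that same game is won by player 1 iff
  the machine halts, which it does iff the supposed algorithm answers that player 1 does not
  win.\<close>

theorem theorem1:
  shows "\<not> decidable_problem instance_code {I. valid_instance I} instance_wins"
proof
  assume "decidable_problem instance_code {I. valid_instance I} instance_wins"
  then obtain f where f: "\<And>I. valid_instance I \<Longrightarrow> rec_eval f [instance_code I] (if instance_wins I then 1 else 0)"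
    by (auto simp: decidable_problem_def)
  define X where "X xs = (\<Prod>r<3. nth_prime r ^ (xs ! r))" for xs :: "nat list"
  define S where "S = to_nat (Scale :: bool prog list vertex)"
  \<comment> \<open>This reproduces \<open>instance_code\<close> with the loop at
    \<open>Scale\<close> consed to the other arcs. All compiled machines share the state type
    \<open>bool prog list\<close>, so the codes of \<open>Scale\<close> and \<open>Reset\<close> are
    constants available before the machine exists.\<close>
  define E where "E xs = list_encode [xs ! 0, xs ! 1,
      Suc (prod_encode (list_encode [S, S, vec_code (wvec (X xs) (Scale :: bool prog list vertex, Scale))], xs ! 2)),
      to_nat (Reset :: bool prog list vertex), cond_code game_cond]" for xs :: "nat list"
  have X: "computable 3 X"
  proof -
    have "computable 3 (\<lambda>xs. nth_prime 0 ^ (xs ! 0) * nth_prime 1 ^ (xs ! 1) * nth_prime 2 ^ (xs ! 2))"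
      by (intro computable_mult computable_power computable_nth) auto
    then show ?thesis by (rule computable_cong) (simp add: X_def numeral_3_eq_3 numeral_2_eq_2)
  qed
  have "computable 3 E"
    unfolding E_def list_encode.simps
    by (intro computable_Suc computable_prod_encode computable_const computable_nth computable_scale_code X) auto
  then obtain F where F: "\<And>xs. length xs = 3 \<Longrightarrow> rec_eval F xs (E xs)" by (auto simp: computable_def)
  \<comment> \<open>The body ignores the search index: \<open>Mu\<close> stops at once if
    \<open>f\<close> answers 0 and runs forever if \<open>f\<close> answers 1.\<close>
  define h where "h = Mu (Comp f [Comp F [Proj 1, Proj 2, Proj 3]])"
  have inner: "rec_eval (Comp F [Proj 1, Proj 2, Proj 3]) (n # xs) y \<longleftrightarrow> y = E xs" if len: "length xs = 3" for n xs y
  proof -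
    obtain a b c where xs: "xs = [a, b, c]" using len by (auto simp: numeral_3_eq_3 length_Suc_conv)
    have "rec_eval (Comp F [Proj 1, Proj 2, Proj 3]) (n # xs) y \<longleftrightarrow> rec_eval F xs y"
      unfolding rec_eval_Comp by (auto simp: xs list_all2_Cons1 rec_eval_Proj numeral_2_eq_2 numeral_3_eq_3)
    then show ?thesis using F[OF len] rec_eval_deterministic by blast
  qed
  have body: "rec_eval (Comp f [Comp F [Proj 1, Proj 2, Proj 3]]) (n # xs) z \<longleftrightarrow> rec_eval f [E xs] z" if "length xs = 3" for n xs z
    unfolding rec_eval_Comp[of f] list_all2_Cons1 inner[OF that] by auto
  have h: "(\<exists>y. rec_eval h xs y) \<longleftrightarrow> rec_eval f [E xs] 0" if "length xs = 3" for xs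
    unfolding h_def rec_eval_Mu body[OF that] by auto
  obtain T :: "bool prog list trans set" and q0 where T: "finite T"
    and acc: "\<And>xs. length xs = 3 \<Longrightarrow> accepts T q0 [] (X xs) \<longleftrightarrow> (\<exists>y. rec_eval h xs y)"
    using rec_eval_machine[of 3 h] unfolding X_def by blast
  have fin: "finite (vertices1 T q0 [])" "finite (vertices2 T)"
    using T by (auto simp: vertices1_def vertices2_def states_def)
  obtain l1 l2 where l: "set l1 = vertices1 T q0 []" "set l2 = vertices2 T"
    using finite_list[OF fin(1)] finite_list[OF fin(2)] by blast
  have "finite ({(u, v). edge T q0 [] u v} - {(Scale, Scale)})" using finite_edges[OF T] by blast
  then obtain es where es: "set es = {(u, v). edge T q0 [] u v} - {(Scale, Scale)}" "distinct es"
    using finite_distinct_list by metis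
  have es': "distinct ((Scale, Scale) # es)" "set ((Scale, Scale) # es) = {(u, v). edge T q0 [] u v}"
    using es by (auto intro: edge.Scale_Scale)
  have const: "wvec x e = wvec 0 e" if "e \<noteq> (Scale, Scale)" for x and e :: "bool prog list vertex \<times> bool prog list vertex"
    using that by (cases e) (auto simp: wvec_def wt_def fun_eq_iff split: vertex.split)
  \<comment> \<open>The three numbers describe the game of the machine for \<open>h\<close>, up to
    the weights on the loop at \<open>Scale\<close>. Those are determined by \<open>X xs\<close>,
    and since \<open>h\<close> and hence \<open>T\<close> were fixed before \<open>xs\<close>, the
    reference to itself is not circular.\<close>
  define xs where "xs = [list_encode (map to_nat l1), list_encode (map to_nat l2),
      list_encode (map arc_code (map (\<lambda>(u, v). ((to_nat u, to_nat v), wvec 0 (u, v))) es))]"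
  define I where "I = machine_instance l1 l2 es (X xs)"
  have len: "length xs = 3" by (simp add: xs_def)
  have xs_nth: "xs ! 0 = list_encode (map to_nat l1)" "xs ! 1 = list_encode (map to_nat l2)"
    "xs ! 2 = list_encode (map arc_code (map (\<lambda>(u, v). ((to_nat u, to_nat v), wvec 0 (u, v))) es))"
    by (simp_all add: xs_def)
  have eq: "map (\<lambda>(u, v). ((to_nat u, to_nat v), wvec (X xs) (u, v))) es =
      map (\<lambda>(u, v). ((to_nat u, to_nat v), wvec 0 (u, v))) es"
    using es(1) const by (auto simp del: Pair_inject)
  have "map arc_code (arcs I) = list_encode [S, S, vec_code (wvec (X xs) (Scale :: bool prog list vertex, Scale))] #
      map arc_code (map (\<lambda>(u, v). ((to_nat u, to_nat v), wvec 0 (u, v))) es)"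
    by (simp only: I_def machine_instance_def mp_instance.simps list.map prod.case arc_code.simps S_def eq)
  then have "list_encode (map arc_code (arcs I)) =
      Suc (prod_encode (list_encode [S, S, vec_code (wvec (X xs) (Scale :: bool prog list vertex, Scale))], xs ! 2))"
    unfolding xs_nth(3) by (simp only: list_encode.simps)
  then have code: "instance_code I = E xs"
    unfolding instance_code_def E_def xs_nth(1,2) by (simp add: I_def machine_instance_def)
  have valid: "valid_instance I" and wins: "instance_wins I \<longleftrightarrow> accepts T q0 [] (X xs)"
    unfolding I_def by (rule machine_instance_correct[OF T l es'])+
  have "instance_wins I \<longleftrightarrow> rec_eval f [instance_code I] 0"
    unfolding wins acc[OF len] h[OF len] code ..
  then show False
    using f[OF valid] rec_eval_deterministic[of f "[instance_code I]" 0 1] by (auto split: if_splits)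
qed

end
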